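(* Let $d_1,d_2\geq 2$ and let $\rho$ be an absolutely PPT state on $\mathbb{C}^{d_1}\otimes\mathbb{C}^{d_2}$. Then $\mathrm{SN}(\rho)\leq\min(d_1,d_2)-1$.
   Context: A quantum state $\rho$ on $\mathbb{C}^{d_1}\otimes\mathbb{C}^{d_2}$ is PPT if $(\mathrm{id}\otimes T)(\rho)\geq 0$, with $T$ the transposition in the computational basis; it is absolutely PPT if $U\rho U^\dagger$ is PPT for every unitary $U$ on $\mathbb{C}^{d_1}\otimes\mathbb{C}^{d_2}$. The Schmidt rank of $\ket{\psi}$ is the rank of $\mathrm{tr}_A\ket{\psi}\bra{\psi}$; $\mathrm{SN}(\rho)$ is the minimum over decompositions $\rho=\sum_ip_i\ket{\psi_i}\bra{\psi_i}$ into convex combinations of pure states of the maximal Schmidt rank of the $\ket{\psi_i}$. *)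

theory Defs
  imports "Jordan_Normal_Form.DL_Rank"
begin

text \<open>Bipartite space C^d1 (x) C^d2 is modelled as C^(d1*d2), with the
  computational product basis vector e_i (x) e_j (i < d1, j < d2) at index i*d2 + j.\<close>

definition adj :: "complex mat \<Rightarrow> complex mat" where
  "adj A = mat (dim_col A) (dim_row A) (\<lambda>(i,j). cnj (A $$ (j,i)))"

definition psd :: "nat \<Rightarrow> complex mat \<Rightarrow> bool" where
  "psd n A \<longleftrightarrow> A \<in> carrier_mat n n \<and>
     (\<forall>v \<in> carrier_vec n. let q = (\<Sum>i<n. \<Sum>j<n. cnj (v $ i) * A $$ (i,j) * v $ j)
                              in Im q = 0 \<and> Re q \<ge> 0)"

definition is_state :: "nat \<Rightarrow> nat \<Rightarrow> complex mat \<Rightarrow> bool" where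
  "is_state d1 d2 \<rho> \<longleftrightarrow> psd (d1*d2) \<rho> \<and> (\<Sum>i<d1*d2. \<rho> $$ (i,i)) = 1"

definition unitary_mat :: "nat \<Rightarrow> complex mat \<Rightarrow> bool" where
  "unitary_mat n U \<longleftrightarrow> U \<in> carrier_mat n n \<and> U * adj U = 1\<^sub>m n \<and> adj U * U = 1\<^sub>m n"

definition partial_transpose :: "nat \<Rightarrow> nat \<Rightarrow> complex mat \<Rightarrow> complex mat" where
  "partial_transpose d1 d2 \<rho> = mat (d1*d2) (d1*d2)
     (\<lambda>(r,c). \<rho> $$ ((r div d2) * d2 + c mod d2, (c div d2) * d2 + r mod d2))"

definition PPT :: "nat \<Rightarrow> nat \<Rightarrow> complex mat \<Rightarrow> bool" where
  "PPT d1 d2 \<rho> \<longleftrightarrow> psd (d1*d2) (partial_transpose d1 d2 \<rho>)"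

definition absolutely_PPT :: "nat \<Rightarrow> nat \<Rightarrow> complex mat \<Rightarrow> bool" where
  "absolutely_PPT d1 d2 \<rho> \<longleftrightarrow>
     (\<forall>U. unitary_mat (d1*d2) U \<longrightarrow> PPT d1 d2 (U * \<rho> * adj U))"

definition proj :: "complex vec \<Rightarrow> complex mat" where
  "proj v = mat (dim_vec v) (dim_vec v) (\<lambda>(i,j). v $ i * cnj (v $ j))"

definition ptrace_A :: "nat \<Rightarrow> nat \<Rightarrow> complex mat \<Rightarrow> complex mat" where
  "ptrace_A d1 d2 M = mat d2 d2 (\<lambda>(j,j'). \<Sum>i<d1. M $$ (i*d2 + j, i*d2 + j'))"

definition schmidt_rank :: "nat \<Rightarrow> nat \<Rightarrow> complex vec \<Rightarrow> nat" where
  "schmidt_rank d1 d2 \<psi> = vec_space.rank d2 (ptrace_A d1 d2 (proj \<psi>) :: complex mat)"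

definition has_decomp_rank_le :: "nat \<Rightarrow> nat \<Rightarrow> complex mat \<Rightarrow> nat \<Rightarrow> bool" where
  "has_decomp_rank_le d1 d2 \<rho> k \<longleftrightarrow>
     (\<exists>(m::nat) (p::nat \<Rightarrow> real) (\<psi>::nat \<Rightarrow> complex vec).
        (\<forall>i<m. p i > 0 \<and> \<psi> i \<in> carrier_vec (d1*d2)
               \<and> (\<Sum>l<d1*d2. cmod (\<psi> i $ l) ^ 2) = 1
               \<and> schmidt_rank d1 d2 (\<psi> i) \<le> k)
        \<and> (\<Sum>i<m. p i) = 1
        \<and> \<rho> = mat (d1*d2) (d1*d2) (\<lambda>rc. \<Sum>i<m. complex_of_real (p i) * proj (\<psi> i) $$ rc))"

definition schmidt_number :: "nat \<Rightarrow> nat \<Rightarrow> complex mat \<Rightarrow> nat" where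
  "schmidt_number d1 d2 \<rho> = (LEAST k. has_decomp_rank_le d1 d2 \<rho> k)"

end

theory Submission
  imports Defs "Jordan_Normal_Form.Spectral_Radius"
begin

text \<open>Let $a \le b \le c$ be the three smallest eigenvalues of the state and $L$ the largest. Move the eigenvectors
  of $a$ and $c$ to $|00\rangle$ and $|11\rangle$, those of $b$ and $L$ to $(|01\rangle \pm |10\rangle)/\sqrt 2$: a
  $2 \times 2$ principal minor of the partial transpose yields $(L - b)^2 \le 4ac$, and only this is used of the hypothesis.

  Embed the basis of $C^{d_1} \otimes C^{d_2}$ into that of $C^2 \otimes C^N$, $N = d_1 d_2$, so that the first two rows
  (columns, if $d_2 < d_1$) of a coefficient matrix lie over the same indices of $C^N$, and let the padded operator be $c$ on
  the complement. It is separable. Indeed, a rotation of $C^2$ makes both halves of the two bottom eigenvectors have norm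
  $1/\sqrt 2$, and for the blocks $A, B, B^*, C$ of the rotated operator the spectral inequality then gives
  $\|B\|^2 \le \lambda_{\min}(A) \lambda_{\min}(C)$. So $B$ is a multiple of a contraction, and diagonalising the Halmos
  dilation of the latter writes the operator as a sum of product vectors. On $C^{d_1} \otimes C^{d_2}$ a product vector
  has two proportional rows (columns), which costs one unit of Schmidt rank.\<close>

section \<open>Scalar inequalities\<close>

text \<open>The norm bound on \<open>B\<close> is positivity of the operator against a block witness
  with diagonal blocks \<open>s^2 y y^H\<close>, \<open>t^2 z z^H\<close> and off-diagonal block
  \<open>- s t u v^H\<close> (\<open>^H\<close> for the adjoint). The witness has trace 1, and a
  unit vector (\<tau>, \<sigma>) measures how much of \<open>u\<close>, \<open>v\<close> lies along
  and across \<open>y\<close>, \<open>z\<close>. Three estimates carry the proof: its value at the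
  lowest eigenvector is at most (1 + \<tau>)/2, its trace on the two lowest is at most (1 + \<tau> +
  \<sigma>)/2, and its negative part has rank at most one and norm at most \<sigma>/2. Together they
  reduce the claim to (c - a) \<tau> + (L - b) \<sigma> \<le> c + a. Over the unit circle the left
  side is at most sqrt ((c - a)^2 + (L - b)^2), so (L - b)^2 \<le> 4 a c is exactly what is needed.
  The first estimate fails for an eigenvector concentrated in one block, hence the balancing. Two
  vectors can always be balanced at once, because each imposes one linear condition on the Bloch
  vector of the rotation, a point of the unit sphere in R^3.\<close>

text \<open>Here \<open>a\<close>, \<open>b\<close>, \<open>c\<close>, \<open>d\<close> stand for
  the moduli of the components of a vector along \<open>Y\<close>, \<open>Y'\<close>,
  \<open>Z\<close>, \<open>Z'\<close>: the inequality bounds the lowest eigenvalue of the witness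
  from below by \<open>- \<sigma> / 2\<close>.\<close>

lemma cross_term_bound:
  fixes s t \<alpha> \<beta> \<gamma> \<delta> a b c d :: real
  assumes nn: "0 \<le> s" "0 \<le> t" "0 \<le> \<alpha>" "0 \<le> \<beta>" "0 \<le> \<gamma>" "0 \<le> \<delta>" "0 \<le> a" "0 \<le> b" "0 \<le> c" "0 \<le> d"
    and st: "s^2 + t^2 = 1" and ab: "\<alpha>^2 + \<beta>^2 = 1" and gd: "\<gamma>^2 + \<delta>^2 = 1"
    and sg: "0 \<le> \<sigma>" "\<sigma>^2 = s^2 * \<beta>^2 + t^2 * \<delta>^2"
  shows "2 * s * t * ((\<alpha> * a + \<beta> * b) * (\<gamma> * c + \<delta> * d)) \<le> s^2 * a^2 + t^2 * c^2 + \<sigma> / 2 * (a^2 + b^2 + c^2 + d^2)"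
proof (cases "\<sigma> = 0")
  case True
  then have "(s * \<beta>)^2 + (t * \<delta>)^2 = 0" using sg by (simp add: power_mult_distrib)
  then have z: "s * \<beta> = 0" "t * \<delta> = 0" by (auto simp: sum_power2_eq_zero_iff)
  have "\<alpha> \<le> 1" "\<gamma> \<le> 1" using ab gd by (smt (verit) zero_le_power2 power2_le_imp_le one_power2)+
  then have ag: "\<alpha> * \<gamma> \<le> 1" using nn by (simp add: mult_le_one)
  have "2 * s * t * ((\<alpha> * a + \<beta> * b) * (\<gamma> * c + \<delta> * d))
      = 2 * ((s * \<alpha> * a + (s * \<beta>) * b) * (t * \<gamma> * c + (t * \<delta>) * d))" by (simp add: algebra_simps)
  also have "\<dots> = (\<alpha> * \<gamma>) * (2 * (s * a) * (t * c))" unfolding z by simp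
  also have "\<dots> \<le> 2 * (s * a) * (t * c)" using ag nn by (simp add: mult_left_le_one_le)
  also have "\<dots> \<le> (s * a)^2 + (t * c)^2" by (rule sum_squares_bound)
  finally show ?thesis using True by (simp add: power_mult_distrib)
next
  case False
  \<comment> \<open>The right-hand side is \<open>P0 + P1\<close>, a form in \<open>(a, b)\<close>
    plus a form in \<open>(c, d)\<close>, both definite since \<open>\<nu> > 0\<close>. By AM-GM it
    suffices to bound \<open>s * t * (u * v)\<close> by the geometric mean of \<open>P0\<close> and
    \<open>P1\<close>.\<close>
  define \<nu> where "\<nu> = \<sigma> / 2"
  have \<nu>: "\<nu> > 0" using False sg by (simp add: \<nu>_def)
  define P0 where "P0 = (s^2 + \<nu>) * a^2 + \<nu> * b^2"
  define P1 where "P1 = (t^2 + \<nu>) * c^2 + \<nu> * d^2"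
  define u where "u = \<alpha> * a + \<beta> * b"
  define v where "v = \<gamma> * c + \<delta> * d"
  have P: "0 \<le> P0" "0 \<le> P1" using \<nu> by (auto simp: P0_def P1_def)
  \<comment> \<open>Cauchy-Schwarz with weights \<open>r + \<nu>\<close> and \<open>\<nu>\<close>:
    the constant \<open>x^2 / (r + \<nu>) + y^2 / \<nu>\<close> is written without
    denominators.\<close>
  have cs: "(x * p + y * q)^2 * (\<nu> * (r + \<nu>)) \<le> (\<nu> + r * y^2) * ((r + \<nu>) * p^2 + \<nu> * q^2)"
    if "x^2 + y^2 = 1" for x y p q r :: real
  proof -
    have "\<nu> + r * y^2 = \<nu> * (x^2 + y^2) + r * y^2" using that by simp
    then have e: "\<nu> + r * y^2 = x^2 * \<nu> + y^2 * (r + \<nu>)" by (simp only: algebra_simps)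
    have "(x^2 * \<nu> + y^2 * (r + \<nu>)) * ((r + \<nu>) * p^2 + \<nu> * q^2) - (x * p + y * q)^2 * (\<nu> * (r + \<nu>)) = (x * \<nu> * q - y * (r + \<nu>) * p)^2"
      by (simp add: power2_eq_square algebra_simps)
    then show ?thesis unfolding e by (metis diff_ge_0_iff_ge zero_le_power2)
  qed
  have stle: "s * t \<le> 1/2" using sum_squares_bound[of s t] st by simp
  have st0: "0 \<le> s * t" using nn by simp
  have A: "s^2 * t^2 \<le> 1/4"
    using mult_mono[OF stle stle _ st0] by (simp add: power2_eq_square algebra_simps)
  have am: "2 * (s * t) * (\<beta> * \<delta>) \<le> \<sigma>^2"
    using sum_squares_bound[of "s * \<beta>" "t * \<delta>"] sg by (simp add: power_mult_distrib algebra_simps)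
  have "(s * t)*(s * t) * (\<beta> * \<delta>) \<le> (1/2) * (s * t) * (\<beta> * \<delta>)"
    using stle st0 nn by (intro mult_right_mono) auto
  also have "\<dots> \<le> \<sigma>^2 / 4" using am by (simp add: ac_simps)
  finally have bd: "(s^2 * t^2) * (\<beta> * \<delta>) \<le> \<nu>^2" by (simp add: \<nu>_def power2_eq_square algebra_simps)
  have bd2: "(s^2 * t^2)^2 * (\<beta>^2 * \<delta>^2) \<le> \<nu>^4"
    using power_mono[OF bd, of 2] nn by (simp add: power_mult_distrib)
  have "s^2 * t^2 * (\<nu> * \<sigma>^2) \<le> 1/4 * (\<nu> * \<sigma>^2)" using A \<nu> by (intro mult_right_mono) auto
  also have "\<dots> = \<nu>^3" by (simp add: \<nu>_def power2_eq_square power3_eq_cube)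
  finally have l3: "s^2 * t^2 * (\<nu> * \<sigma>^2) \<le> \<nu>^3" .
  \<comment> \<open>Since \<open>s^2 + t^2 = 1\<close>, the right side equals
    \<open>s^2 * t^2 * \<nu>^2 + \<nu>^3 + \<nu>^4\<close>. The left side is dominated term by term,
    through \<open>l3\<close> and \<open>bd2\<close>; both rest on
    \<open>s * t \<le> 1/2\<close>.\<close>
  have key: "s^2 * t^2 * ((\<nu> + s^2 * \<beta>^2) * (\<nu> + t^2 * \<delta>^2)) \<le> \<nu>^2 * ((s^2 + \<nu>) * (t^2 + \<nu>))"
  proof -
    have "\<nu>^2 * ((s^2 + \<nu>) * (t^2 + \<nu>)) = \<nu>^2 * (s^2 * t^2 + \<nu> * (s^2 + t^2) + \<nu>^2)"
      by (simp add: power2_eq_square algebra_simps)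
    also have "\<dots> = s^2 * t^2 * \<nu>^2 + \<nu>^3 + \<nu>^4" unfolding st
      by (simp add: algebra_simps eval_nat_numeral)
    finally have r: "\<nu>^2 * ((s^2 + \<nu>) * (t^2 + \<nu>)) = s^2 * t^2 * \<nu>^2 + \<nu>^3 + \<nu>^4" .
    have "s^2 * t^2 * ((\<nu> + s^2 * \<beta>^2) * (\<nu> + t^2 * \<delta>^2))
       = s^2 * t^2 * \<nu>^2 + s^2 * t^2 * (\<nu> * (s^2 * \<beta>^2 + t^2 * \<delta>^2)) + (s^2 * t^2)^2 * (\<beta>^2 * \<delta>^2)"
      by (simp add: power2_eq_square algebra_simps)
    then show ?thesis using r l3 bd2 sg(2) by simp
  qed
  define D where "D = \<nu>^2 * ((s^2 + \<nu>) * (t^2 + \<nu>))"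
  have D: "D > 0" using \<nu> unfolding D_def by (intro mult_pos_pos) (auto simp: add_nonneg_pos)
  have c0: "u^2 * (\<nu> * (s^2 + \<nu>)) \<le> (\<nu> + s^2 * \<beta>^2) * P0" unfolding u_def P0_def by (rule cs[OF ab])
  have c1: "v^2 * (\<nu> * (t^2 + \<nu>)) \<le> (\<nu> + t^2 * \<delta>^2) * P1" unfolding v_def P1_def by (rule cs[OF gd])
  have "(s^2 * t^2 * (u^2 * v^2)) * D = s^2 * t^2 * ((u^2 * (\<nu> * (s^2 + \<nu>))) * (v^2 * (\<nu> * (t^2 + \<nu>))))"
    by (simp add: D_def power2_eq_square)
  also have "\<dots> \<le> s^2 * t^2 * (((\<nu> + s^2 * \<beta>^2) * P0) * ((\<nu> + t^2 * \<delta>^2) * P1))"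
    using mult_mono[OF c0 c1] \<nu> P by (intro mult_left_mono) auto
  also have "\<dots> = (s^2 * t^2 * ((\<nu> + s^2 * \<beta>^2) * (\<nu> + t^2 * \<delta>^2))) * (P0 * P1)" by (simp add: algebra_simps)
  also have "\<dots> \<le> D * (P0 * P1)" unfolding D_def using key P by (intro mult_right_mono) auto
  finally have "s^2 * t^2 * (u^2 * v^2) \<le> P0 * P1" using D by (simp add: mult.commute)
  then have "(2 * s * t * (u * v))^2 \<le> 4 * (P0 * P1)" by (simp add: power_mult_distrib)
  also have "\<dots> \<le> (P0 + P1)^2" using sum_squares_bound[of P0 P1] by (simp add: power2_sum)
  finally have "2 * s * t * (u * v) \<le> P0 + P1" using P power2_le_imp_le[of "2 * s * t * (u * v)" "P0 + P1"] by auto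
  then show ?thesis unfolding u_def v_def P0_def P1_def \<nu>_def by (simp add: algebra_simps)
qed

section \<open>Contractions of C^2 and their defect\<close>

lemma lagrange_identity2:
  fixes a1 a2 b1 b2 :: complex
  shows "(cmod (cnj a1 * b1 + cnj a2 * b2))^2 + (cmod (a1 * b2 - a2 * b1))^2
    = ((cmod a1)^2 + (cmod a2)^2) * ((cmod b1)^2 + (cmod b2)^2)"
  unfolding cmod_power2 by (simp add: power2_eq_square algebra_simps)

lemma cauchy_schwarz2:
  fixes a1 a2 b1 b2 :: complex
  shows "(cmod (cnj a1 * b1 + cnj a2 * b2))^2 \<le> ((cmod a1)^2 + (cmod a2)^2) * ((cmod b1)^2 + (cmod b2)^2)"
  using lagrange_identity2[of a1 b1 a2 b2] by (metis le_add_same_cancel1 zero_le_power2)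

text \<open>The 2 x 2 matrix with columns \<open>(a1, a2)\<close> and \<open>(b1, b2)\<close> has
  operator norm at most 1. The matrices in use are overlaps between two orthogonal pairs in a larger
  space, hence contractions and not unitaries.\<close>

definition contraction2 :: "complex \<Rightarrow> complex \<Rightarrow> complex \<Rightarrow> complex \<Rightarrow> bool" where
  "contraction2 a1 a2 b1 b2 \<longleftrightarrow>
     (\<forall>x w. (cmod (x * a1 + w * b1))^2 + (cmod (x * a2 + w * b2))^2 \<le> (cmod x)^2 + (cmod w)^2)"

lemma cnj_mult_self: "cnj z * z = complex_of_real ((cmod z)^2)"
  by (metis complex_norm_square mult.commute)

lemma ex_unimodular: "\<exists>e. cmod e = 1 \<and> e * z = of_real (cmod z)"
proof (cases "z = 0")
  case True then show ?thesis by (intro exI[of _ 1]) auto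
next
  case False
  have "cnj z / of_real (cmod z) * z = of_real (cmod z)"
    using False by (simp add: complex_norm_square[symmetric] power2_eq_square field_simps)
  then show ?thesis using False by (intro exI[of _ "cnj z / of_real (cmod z)"]) (simp add: norm_divide)
qed

text \<open>The angle is half the argument of the point \<open>(D, g)\<close>. It is the Jacobi
  angle that orthogonalises two columns with real overlap \<open>g\<close> whose squared norms
  differ by \<open>2 * D\<close>.\<close>

lemma ex_half_angle:
  fixes D g :: real
  shows "\<exists>c s. c^2 + s^2 = 1 \<and> 2 * c * s * D = (c^2 - s^2) * g"
proof (cases "D = 0 \<and> g = 0")
  case True then show ?thesis by (intro exI[of _ 1] exI[of _ 0]) auto
next
  case False
  define r where "r = sqrt (D^2 + g^2)"
  have r2: "r^2 = D^2 + g^2" by (simp add: r_def)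
  have rp: "r > 0" using False by (auto simp: r_def sum_power2_gt_zero_iff)
  have "(D / r)^2 + (g / r)^2 = 1" using rp
    by (simp add: power_divide add_divide_distrib[symmetric] r2[symmetric])
  then obtain \<phi> where \<phi>: "D / r = cos \<phi>" "g / r = sin \<phi>" by (metis sincos_total_2pi)
  have "cos \<phi> = (cos (\<phi>/2))^2 - (sin (\<phi>/2))^2" "sin \<phi> = 2 * sin (\<phi>/2) * cos (\<phi>/2)"
    using cos_double[of "\<phi>/2"] sin_double[of "\<phi>/2"] by auto
  moreover have "D = r * cos \<phi>" "g = r * sin \<phi>" using \<phi> rp by (auto simp: field_simps)
  ultimately have "2 * cos (\<phi>/2) * sin (\<phi>/2) * D = ((cos (\<phi>/2))^2 - (sin (\<phi>/2))^2) * g" by simp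
  then show ?thesis by (intro exI[of _ "cos (\<phi>/2)"] exI[of _ "sin (\<phi>/2)"]) auto
qed

text \<open>The right-hand side is the square of the trace norm of the matrix with columns \<open>m\<close> and \<open>n\<close>.\<close>

lemma contraction2_trace_bound:
  fixes m1 m2 n1 n2 a1 a2 b1 b2 :: complex
  assumes K: "contraction2 a1 a2 b1 b2"
  shows "(cmod (cnj m1 * a1 + cnj m2 * a2 + (cnj n1 * b1 + cnj n2 * b2)))^2
    \<le> (cmod m1)^2 + (cmod m2)^2 + ((cmod n1)^2 + (cmod n2)^2) + 2 * cmod (m1 * n2 - m2 * n1)"
proof -
  define g where "g = cnj m1 * n1 + cnj m2 * n2"
  obtain e where e: "cmod e = 1" "e * g = of_real (cmod g)" using ex_unimodular by blast
  have ee: "e * cnj e = 1" "cnj e * e = 1" using e(1) by (simp_all add: complex_norm_square[symmetric] mult.commute)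
  have g: "g = cnj e * of_real (cmod g)" using e(2) ee by (metis mult.assoc mult.left_neutral)
  have cg: "cnj g = e * of_real (cmod g)" by (subst g) simp
  define D where "D = ((cmod m1)^2 + (cmod m2)^2 - ((cmod n1)^2 + (cmod n2)^2)) / 2"
  \<comment> \<open>A Jacobi rotation of the columns, after the phase \<open>e\<close> has made
    their overlap real. Rotating both matrices alike preserves the trace pairing
    (\<open>tr\<close>), the Frobenius norm (\<open>nn\<close>) and the determinant
    (\<open>wd\<close>). The new columns \<open>p\<close>, \<open>q\<close> are orthogonal, so the
    trace norm becomes the sum of their lengths, \<open>P + Q\<close>.\<close>
  obtain c s :: real where cs: "c^2 + s^2 = 1" "2 * c * s * D = (c^2 - s^2) * cmod g" using ex_half_angle by blast
  define C S :: complex where "C = of_real c" and "S = of_real s"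
  have CS: "C * C + S * S = 1" using cs(1) unfolding C_def S_def
    by (metis of_real_1 of_real_add of_real_mult power2_eq_square)
  have cC: "cnj C = C" "cnj S = S" by (auto simp: C_def S_def)
  define p1 p2 q1 q2 where "p1 = C * m1 + e * S * n1" and "p2 = C * m2 + e * S * n2"
    and "q1 = C * n1 - cnj e * S * m1" and "q2 = C * n2 - cnj e * S * m2"
  define x1 x2 w1 w2 where "x1 = C * a1 + e * S * b1" and "x2 = C * a2 + e * S * b2"
    and "w1 = C * b1 - cnj e * S * a1" and "w2 = C * b2 - cnj e * S * a2"
  have rot: "cnj (C * m + e * S * n) * (C * a + e * S * b) + cnj (C * n - cnj e * S * m) * (C * b - cnj e * S * a)
      = cnj m * a + cnj n * b" for m n a b
  proof -
    have "cnj (C * m + e * S * n) * (C * a + e * S * b) + cnj (C * n - cnj e * S * m) * (C * b - cnj e * S * a)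
       = (C*C + (e * cnj e) * (S*S)) * (cnj m * a + cnj n * b)"
      by (simp add: cC algebra_simps)
    then show ?thesis using ee CS by simp
  qed
  have tr: "cnj m1 * a1 + cnj m2 * a2 + (cnj n1 * b1 + cnj n2 * b2) = (cnj p1 * x1 + cnj p2 * x2) + (cnj q1 * w1 + cnj q2 * w2)"
  proof -
    have "(cnj p1 * x1 + cnj p2 * x2) + (cnj q1 * w1 + cnj q2 * w2) = (cnj p1 * x1 + cnj q1 * w1) + (cnj p2 * x2 + cnj q2 * w2)"
      by simp
    also have "\<dots> = (cnj m1 * a1 + cnj n1 * b1) + (cnj m2 * a2 + cnj n2 * b2)"
      by (simp only: p1_def p2_def q1_def q2_def x1_def x2_def w1_def w2_def rot)
    finally show ?thesis by simp
  qed
  have n2: "(cmod p)^2 + (cmod q)^2 = (cmod m)^2 + (cmod n)^2"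
    if "p = C * m + e * S * n" "q = C * n - cnj e * S * m" for p q m n
  proof -
    have "complex_of_real ((cmod p)^2 + (cmod q)^2) = of_real ((cmod m)^2 + (cmod n)^2)"
      using rot[of m n m n] unfolding that[symmetric] cnj_mult_self by simp
    then show ?thesis using of_real_eq_iff by blast
  qed
  have nn: "(cmod p1)^2 + (cmod p2)^2 + ((cmod q1)^2 + (cmod q2)^2) = (cmod m1)^2 + (cmod m2)^2 + ((cmod n1)^2 + (cmod n2)^2)"
    using n2[OF p1_def q1_def] n2[OF p2_def q2_def] by simp
  have wd: "p1 * q2 - p2 * q1 = m1 * n2 - m2 * n1"
  proof -
    have "p1 * q2 - p2 * q1 = (C * C + (e * cnj e) * (S * S)) * (m1 * n2 - m2 * n1)"
      unfolding p1_def p2_def q1_def q2_def by (simp add: algebra_simps)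
    then show ?thesis using ee CS by simp
  qed
  have mm: "cnj m1 * m1 + cnj m2 * m2 - (cnj n1 * n1 + cnj n2 * n2) = 2 * of_real D"
    by (simp add: D_def complex_norm_square[symmetric] mult.commute[of "cnj _"])
  have "cnj p1 * q1 + cnj p2 * q2 = C * C * g - (cnj e * cnj e) * (S * S) * cnj g
      - cnj e * C * S * (cnj m1 * m1 + cnj m2 * m2 - (cnj n1 * n1 + cnj n2 * n2))"
    unfolding p1_def p2_def q1_def q2_def g_def by (simp add: cC algebra_simps)
  also have "\<dots> = cnj e * ((C * C) * of_real (cmod g) - (cnj e * e) * (S * S) * of_real (cmod g) - C * S * (2 * of_real D))"
    unfolding mm cg by (subst g) (simp add: algebra_simps)
  also have "\<dots> = cnj e * of_real ((c^2 - s^2) * cmod g - 2 * c * s * D)"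
    unfolding ee C_def S_def by (simp add: power2_eq_square algebra_simps)
  finally have orth: "cnj p1 * q1 + cnj p2 * q2 = 0" using cs(2) by simp
  define P where "P = sqrt ((cmod p1)^2 + (cmod p2)^2)"
  define Q where "Q = sqrt ((cmod q1)^2 + (cmod q2)^2)"
  have PQ0: "0 \<le> P" "0 \<le> Q" by (auto simp: P_def Q_def)
  have P2: "P^2 = (cmod p1)^2 + (cmod p2)^2" and Q2: "Q^2 = (cmod q1)^2 + (cmod q2)^2" by (auto simp: P_def Q_def)
  have "(P * Q)^2 = (cmod (m1 * n2 - m2 * n1))^2"
    using lagrange_identity2[of p1 q1 p2 q2] orth wd by (simp add: power_mult_distrib P2 Q2)
  then have PQ: "P * Q = cmod (m1 * n2 - m2 * n1)" using PQ0 by (metis norm_ge_zero power2_eq_imp_eq mult_nonneg_nonneg)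
  have cs1: "(cmod C)^2 + (cmod (e * S))^2 = 1" "(cmod (- (cnj e * S)))^2 + (cmod C)^2 = 1"
    using cs(1) e(1) by (auto simp: C_def S_def norm_mult power_mult_distrib)
  have X: "(cmod x1)^2 + (cmod x2)^2 \<le> 1"
    using K[unfolded contraction2_def, rule_format, of C "e * S"] cs1 unfolding x1_def x2_def by simp
  have Wn: "(cmod w1)^2 + (cmod w2)^2 \<le> 1"
    using K[unfolded contraction2_def, rule_format, of "- (cnj e * S)" C] cs1 unfolding w1_def w2_def
    by (simp add: algebra_simps)
  have b1: "cmod (cnj p1 * x1 + cnj p2 * x2) \<le> P"
  proof (rule power2_le_imp_le[OF _ PQ0(1)])
    have "(cmod (cnj p1 * x1 + cnj p2 * x2))^2 \<le> P^2 * ((cmod x1)^2 + (cmod x2)^2)" unfolding P2 by (rule cauchy_schwarz2)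
    also have "\<dots> \<le> P^2" using X by (simp add: mult_left_le)
    finally show "(cmod (cnj p1 * x1 + cnj p2 * x2))^2 \<le> P^2" .
  qed
  have b2: "cmod (cnj q1 * w1 + cnj q2 * w2) \<le> Q"
  proof (rule power2_le_imp_le[OF _ PQ0(2)])
    have "(cmod (cnj q1 * w1 + cnj q2 * w2))^2 \<le> Q^2 * ((cmod w1)^2 + (cmod w2)^2)" unfolding Q2 by (rule cauchy_schwarz2)
    also have "\<dots> \<le> Q^2" using Wn by (simp add: mult_left_le)
    finally show "(cmod (cnj q1 * w1 + cnj q2 * w2))^2 \<le> Q^2" .
  qed
  have "cmod (cnj m1 * a1 + cnj m2 * a2 + (cnj n1 * b1 + cnj n2 * b2)) \<le> P + Q"
    unfolding tr using b1 b2 norm_triangle_ineq by (smt (verit))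
  then have "(cmod (cnj m1 * a1 + cnj m2 * a2 + (cnj n1 * b1 + cnj n2 * b2)))^2 \<le> (P + Q)^2" by (intro power_mono) auto
  also have "\<dots> = P^2 + Q^2 + 2 * (P * Q)" by (simp add: power2_sum)
  finally show ?thesis unfolding PQ P2 Q2 using nn by simp
qed

lemma discriminant_bound:
  fixes P Q G :: real
  assumes "0 \<le> P" "0 \<le> Q" and q: "\<And>r. 0 \<le> P + 2 * r * G + r^2 * Q"
  shows "G^2 \<le> P * Q"
proof (cases "Q = 0")
  case True
  have "G = 0"
  proof (rule ccontr)
    assume "G \<noteq> 0"
    then show False using q[of "- (P + 1) / (2 * G)"] True by (simp add: field_simps)
  qed
  then show ?thesis using True by simp
next
  case False
  then have "Q > 0" using assms by simp
  then show ?thesis using q[of "- G / Q"] by (simp add: field_simps power2_eq_square)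
qed

lemma cmod_add_phase:
  assumes "cmod e = 1"
  shows "(cmod (x + of_real r * e * y))^2 = (cmod x)^2 + r^2 * (cmod y)^2 + 2 * r * Re (e * (cnj x * y))"
proof -
  have "(cmod (x + of_real r * e * y))^2 = (cmod x)^2 + (cmod (of_real r * e * y))^2 + 2 * Re (cnj x * (of_real r * e * y))"
    unfolding cmod_power2 by (simp add: power2_eq_square algebra_simps)
  moreover have "(cmod (of_real r * e * y))^2 = r^2 * (cmod y)^2" using assms by (simp add: norm_mult power_mult_distrib)
  moreover have "Re (cnj x * (of_real r * e * y)) = r * Re (e * (cnj x * y))" by (simp add: algebra_simps)
  ultimately show ?thesis by simp
qed

text \<open>For a contraction \<open>K\<close> the form of \<open>1 - adj K * K\<close> is positive
  semidefinite. The last claim is its Cauchy-Schwarz inequality for the unit vectors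
  \<open>(1, 0)\<close> and \<open>(\<alpha>, \<beta>)\<close>, whose images under \<open>K\<close>
  are \<open>a\<close> and \<open>u\<close>.\<close>

lemma contraction2_defect:
  assumes K: "contraction2 a1 a2 b1 b2" and ab: "\<alpha>^2 + \<beta>^2 = (1::real)"
    and u: "u1 = of_real \<alpha> * a1 + of_real \<beta> * b1" "u2 = of_real \<alpha> * a2 + of_real \<beta> * b2"
  shows "(cmod a1)^2 + (cmod a2)^2 \<le> 1" "(cmod b1)^2 + (cmod b2)^2 \<le> 1" "(cmod u1)^2 + (cmod u2)^2 \<le> 1"
    and "(cmod (of_real \<alpha> - (cnj a1 * u1 + cnj a2 * u2)))^2
      \<le> (1 - ((cmod a1)^2 + (cmod a2)^2)) * (1 - ((cmod u1)^2 + (cmod u2)^2))"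
proof -
  note K' = K[unfolded contraction2_def, rule_format]
  show a: "(cmod a1)^2 + (cmod a2)^2 \<le> 1" using K'[of 1 0] by simp
  show "(cmod b1)^2 + (cmod b2)^2 \<le> 1" using K'[of 0 1] by simp
  show u1: "(cmod u1)^2 + (cmod u2)^2 \<le> 1" using K'[of "of_real \<alpha>" "of_real \<beta>"] ab unfolding u by simp
  define g where "g = of_real \<alpha> - (cnj a1 * u1 + cnj a2 * u2)"
  obtain e where e: "cmod e = 1" "e * g = of_real (cmod g)" using ex_unimodular by blast
  have "(cmod g)^2 \<le> (1 - ((cmod a1)^2 + (cmod a2)^2)) * (1 - ((cmod u1)^2 + (cmod u2)^2))"
  proof (rule discriminant_bound)
    \<comment> \<open>The defect form is evaluated at
      \<open>(1, 0) + l * (\<alpha>, \<beta>)\<close>; the phase in \<open>l\<close> replaces the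
      real part of the mixed term by \<open>cmod g\<close>.\<close>
    fix r :: real
    define l where "l = of_real r * e"
    note sq = cmod_add_phase[OF e(1), of _ r, folded l_def]
    have "(cmod (a1 + l * u1))^2 + (cmod (a2 + l * u2))^2 \<le> (cmod (1 + l * of_real \<alpha>))^2 + (cmod (l * of_real \<beta>))^2"
      using K'[of "1 + l * of_real \<alpha>" "l * of_real \<beta>"] unfolding u by (simp add: algebra_simps)
    also have "(cmod (l * of_real \<beta>))^2 = r^2 * \<beta>^2" using e by (simp add: l_def norm_mult power_mult_distrib)
    finally have *: "(cmod a1)^2 + r^2 * (cmod u1)^2 + 2 * r * Re (e * (cnj a1 * u1))
        + ((cmod a2)^2 + r^2 * (cmod u2)^2 + 2 * r * Re (e * (cnj a2 * u2)))
        \<le> 1 + r^2 * \<alpha>^2 + 2 * r * Re (e * of_real \<alpha>) + r^2 * \<beta>^2"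
      unfolding sq by simp
    have "cmod g = Re (e * g)" using e by simp
    also have "\<dots> = Re (e * of_real \<alpha>) - Re (e * (cnj a1 * u1)) - Re (e * (cnj a2 * u2))"
      unfolding g_def by (simp add: algebra_simps)
    finally have eq: "cmod g = Re (e * of_real \<alpha>) - Re (e * (cnj a1 * u1)) - Re (e * (cnj a2 * u2))" .
    have "2 * r * cmod g = 2 * r * Re (e * of_real \<alpha>) - 2 * r * Re (e * (cnj a1 * u1)) - 2 * r * Re (e * (cnj a2 * u2))"
      by (simp only: eq right_diff_distrib)
    moreover have "r^2 * \<alpha>^2 + r^2 * \<beta>^2 = r^2" using ab by (metis distrib_left mult.right_neutral)
    ultimately show "0 \<le> 1 - ((cmod a1)^2 + (cmod a2)^2) + 2 * r * cmod g + r^2 * (1 - ((cmod u1)^2 + (cmod u2)^2))"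
      using * by (simp add: algebra_simps)
  qed (use a u1 in auto)
  then show "(cmod (of_real \<alpha> - (cnj a1 * u1 + cnj a2 * u2)))^2
      \<le> (1 - ((cmod a1)^2 + (cmod a2)^2)) * (1 - ((cmod u1)^2 + (cmod u2)^2))" unfolding g_def .
qed

text \<open>By duality: the left side \<open>F\<close> is the trace pairing of the contraction with
  columns \<open>z\<close>, \<open>z'\<close> against a matrix built from \<open>y\<close> and
  \<open>u\<close>, so \<open>F^2\<close> is at most the squared trace norm of that matrix.
  Estimating the latter gives \<open>F^2 \<le> F * (1 + \<kappa>)\<close>.\<close>

lemma overlap_wedge_bound:
  assumes K0: "contraction2 y1 y2 y1' y2'" and K1: "contraction2 z1 z2 z1' z2'"
    and nn: "0 \<le> \<alpha>" "0 \<le> \<beta>" "0 \<le> \<gamma>" "0 \<le> \<delta>"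
    and ab: "\<alpha>^2 + \<beta>^2 = (1::real)" and gd: "\<gamma>^2 + \<delta>^2 = (1::real)"
    and u: "u1 = of_real \<alpha> * y1 + of_real \<beta> * y1'" "u2 = of_real \<alpha> * y2 + of_real \<beta> * y2'"
    and v: "v1 = of_real \<gamma> * z1 + of_real \<delta> * z1'" "v2 = of_real \<gamma> * z2 + of_real \<delta> * z2'"
  shows "(cmod (cnj u1 * v1 + cnj u2 * v2))^2 + (cmod (y1 * z2 - y2 * z1))^2 \<le> 1 + (\<alpha> * \<delta> + \<beta> * \<gamma>)"
proof -
  define C1 where "C1 = cnj u1 * v1 + cnj u2 * v2"
  define C2 where "C2 = y1 * z2 - y2 * z1"
  define F where "F = (cmod C1)^2 + (cmod C2)^2"
  define \<kappa> where "\<kappa> = \<alpha> * \<delta> + \<beta> * \<gamma>"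
  define Y where "Y = (cmod y1)^2 + (cmod y2)^2"
  define U where "U = (cmod u1)^2 + (cmod u2)^2"
  define h where "h = cmod (cnj y1 * u1 + cnj y2 * u2)"
  note d = contraction2_defect[OF K0 ab u]
  have YU: "0 \<le> 1 - Y" "0 \<le> 1 - U" using d by (auto simp: Y_def U_def)
  have dle: "\<delta> \<le> 1" using gd nn by (smt (verit) zero_le_power2 power2_le_imp_le one_power2)
  \<comment> \<open>The vector \<open>(- cnj y2, cnj y1)\<close> represents the functional that
    sends \<open>z\<close> to \<open>y1 * z2 - y2 * z1\<close>, while the overlap of
    \<open>u\<close> with \<open>v\<close> is split along
    \<open>v = \<gamma> z + \<delta> z'\<close>. The pairing with \<open>(z, z')\<close> is then
    exactly \<open>F\<close>.\<close>
  define m1 m2 n1 n2 where "m1 = C1 * \<gamma> * u1 - C2 * cnj y2" and "m2 = C1 * \<gamma> * u2 + C2 * cnj y1"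
    and "n1 = C1 * \<delta> * u1" and "n2 = C1 * \<delta> * u2"
  have "cnj m1 * z1 + cnj m2 * z2 + (cnj n1 * z1' + cnj n2 * z2') = cnj C1 * C1 + cnj C2 * C2"
  proof -
    have "cnj C1 * C1 + cnj C2 * C2 = cnj C1 * (cnj u1 * v1 + cnj u2 * v2) + cnj C2 * (y1 * z2 - y2 * z1)"
      by (simp only: C1_def C2_def)
    then show ?thesis unfolding m1_def m2_def n1_def n2_def v by (simp add: algebra_simps)
  qed
  also have "\<dots> = of_real F" unfolding cnj_mult_self F_def by simp
  finally have Fe: "cnj m1 * z1 + cnj m2 * z2 + (cnj n1 * z1' + cnj n2 * z2') = of_real F" .
  have yu: "cmod (y1 * u2 - y2 * u1) \<le> \<beta>"
  proof -
    have "(cmod (y1 * y2' - y2 * y1'))^2 \<le> ((cmod y1)^2 + (cmod y2)^2) * ((cmod y1')^2 + (cmod y2')^2)"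
      using lagrange_identity2[of y1 y1' y2 y2'] by (metis le_add_same_cancel2 zero_le_power2)
    also have "\<dots> \<le> 1" using d by (intro mult_le_one) auto
    finally have "cmod (y1 * y2' - y2 * y1') \<le> 1" using power2_le_imp_le[of "cmod (y1 * y2' - y2 * y1')" 1] by simp
    moreover have "y1 * u2 - y2 * u1 = of_real \<beta> * (y1 * y2' - y2 * y1')" unfolding u by (simp add: algebra_simps)
    ultimately show ?thesis using nn by (simp add: norm_mult mult_left_le)
  qed
  have mm: "(cmod m1)^2 + (cmod m2)^2 = \<gamma>^2 * (cmod C1)^2 * U + (cmod C2)^2 * Y
      + 2 * \<gamma> * Re (cnj C1 * C2 * cnj (y1 * u2 - y2 * u1))"
    unfolding m1_def m2_def U_def Y_def cmod_power2 by (simp add: power2_eq_square algebra_simps)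
  have "Re (cnj C1 * C2 * cnj (y1 * u2 - y2 * u1)) \<le> cmod (cnj C1 * C2 * cnj (y1 * u2 - y2 * u1))" by (rule complex_Re_le_cmod)
  also have "\<dots> = cmod C1 * cmod C2 * cmod (y1 * u2 - y2 * u1)" by (simp only: norm_mult complex_mod_cnj)
  also have "\<dots> \<le> cmod C1 * cmod C2 * \<beta>" using yu by (intro mult_left_mono) auto
  finally have "2 * \<gamma> * Re (cnj C1 * C2 * cnj (y1 * u2 - y2 * u1)) \<le> 2 * \<gamma> * (cmod C1 * cmod C2 * \<beta>)"
    using nn by (intro mult_left_mono) auto
  with mm have mm': "(cmod m1)^2 + (cmod m2)^2 \<le> \<gamma>^2 * (cmod C1)^2 * U + (cmod C2)^2 * Y + 2 * (cmod C1 * cmod C2) * (\<beta> * \<gamma>)"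
    by (simp add: algebra_simps)
  have nn': "(cmod n1)^2 + (cmod n2)^2 = \<delta>^2 * (cmod C1)^2 * U"
    unfolding n1_def n2_def U_def by (simp add: norm_mult power_mult_distrib algebra_simps)
  have "m1 * n2 - m2 * n1 = - (C1 * C2 * of_real \<delta> * (cnj y1 * u1 + cnj y2 * u2))"
    unfolding m1_def m2_def n1_def n2_def by (simp add: algebra_simps)
  then have w: "cmod (m1 * n2 - m2 * n1) = cmod C1 * cmod C2 * \<delta> * h"
    using nn by (simp add: norm_mult h_def)
  have "\<gamma>^2 * (cmod C1)^2 * U + \<delta>^2 * (cmod C1)^2 * U = (\<gamma>^2 + \<delta>^2) * ((cmod C1)^2 * U)" by (simp only: algebra_simps)
  then have gdU: "\<gamma>^2 * (cmod C1)^2 * U + \<delta>^2 * (cmod C1)^2 * U = (cmod C1)^2 * U" using gd by simp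
  have F2: "F^2 \<le> (cmod C1)^2 * U + (cmod C2)^2 * Y + 2 * (cmod C1 * cmod C2) * (\<beta> * \<gamma>) + 2 * (cmod C1 * cmod C2 * \<delta> * h)"
    using contraction2_trace_bound[OF K1, of m1 m2 n1 n2] mm' nn' w gdU unfolding Fe by simp
  \<comment> \<open>By the defect inequality \<open>h\<close> exceeds \<open>\<alpha>\<close> by at
    most \<open>sqrt ((1 - Y) * (1 - U))\<close>. AM-GM charges this excess to the deficits
    \<open>1 - U\<close> and \<open>1 - Y\<close> by which the first two terms of \<open>F2\<close>
    fall short of \<open>F\<close>.\<close>
  have h: "2 * (cmod C1 * cmod C2 * \<delta> * (h - \<alpha>)) \<le> (cmod C1)^2 * (1 - U) + (cmod C2)^2 * (1 - Y)"
  proof (cases "h \<le> \<alpha>")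
    case True
    then have "cmod C1 * cmod C2 * \<delta> * (h - \<alpha>) \<le> 0" using nn by (intro mult_nonneg_nonpos) auto
    moreover have "0 \<le> (cmod C1)^2 * (1 - U) + (cmod C2)^2 * (1 - Y)" using YU by simp
    ultimately show ?thesis by linarith
  next
    case False
    have "h - \<alpha> \<le> cmod (of_real \<alpha> - (cnj y1 * u1 + cnj y2 * u2))"
      using norm_triangle_ineq2[of "cnj y1 * u1 + cnj y2 * u2" "of_real \<alpha>"] nn unfolding h_def
      by (simp add: norm_minus_commute)
    then have "(h - \<alpha>)^2 \<le> (cmod (of_real \<alpha> - (cnj y1 * u1 + cnj y2 * u2)))^2" using False by (intro power_mono) auto
    also have "\<dots> \<le> (1 - Y) * (1 - U)" using d(4) unfolding Y_def U_def .
    finally have h2: "(h - \<alpha>)^2 \<le> (1 - Y) * (1 - U)" .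
    let ?p = "(cmod C1)^2 * (1 - U)" and ?q = "(cmod C2)^2 * (1 - Y)"
    have p0: "0 \<le> ?p" "0 \<le> ?q" using YU by auto
    have "(2 * (cmod C1 * cmod C2 * (h - \<alpha>)))^2 = 4 * ((cmod C1)^2 * (cmod C2)^2) * (h - \<alpha>)^2"
      by (simp add: power_mult_distrib)
    also have "\<dots> \<le> 4 * ((cmod C1)^2 * (cmod C2)^2) * ((1 - Y) * (1 - U))" using h2 by (intro mult_left_mono) auto
    also have "\<dots> = 4 * (?p * ?q)" by (simp only: ac_simps)
    also have "\<dots> \<le> (?p + ?q)^2"
    proof -
      have "4 * (p * q) \<le> (p + q)^2" for p q :: real using sum_squares_bound[of p q] by (simp add: power2_sum)
      then show ?thesis .
    qed
    finally have "2 * (cmod C1 * cmod C2 * (h - \<alpha>)) \<le> ?p + ?q" using p0 power2_le_imp_le by (metis add_nonneg_nonneg)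
    moreover have "2 * (cmod C1 * cmod C2 * \<delta> * (h - \<alpha>)) \<le> 2 * (cmod C1 * cmod C2 * (h - \<alpha>))"
    proof -
      have "\<delta> * (cmod C1 * cmod C2 * (h - \<alpha>)) \<le> 1 * (cmod C1 * cmod C2 * (h - \<alpha>))"
        using False dle by (intro mult_right_mono) auto
      then have "2 * (\<delta> * (cmod C1 * cmod C2 * (h - \<alpha>))) \<le> 2 * (cmod C1 * cmod C2 * (h - \<alpha>))" by simp
      then show ?thesis by (simp only: ac_simps)
    qed
    ultimately show ?thesis by linarith
  qed
  have am: "2 * (cmod C1 * cmod C2) \<le> F" using sum_squares_bound[of "cmod C1" "cmod C2"] by (simp add: F_def)
  have "F^2 \<le> (cmod C1)^2 * U + (cmod C2)^2 * Y + 2 * (cmod C1 * cmod C2) * (\<beta> * \<gamma>)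
      + (2 * (cmod C1 * cmod C2) * (\<delta> * \<alpha>) + ((cmod C1)^2 * (1 - U) + (cmod C2)^2 * (1 - Y)))"
    using F2 h by (simp add: algebra_simps)
  also have "\<dots> = F + 2 * (cmod C1 * cmod C2) * \<kappa>" by (simp add: F_def \<kappa>_def algebra_simps)
  also have "\<dots> \<le> F + F * \<kappa>" using am nn by (intro add_left_mono mult_right_mono) (auto simp: \<kappa>_def)
  finally have FF: "F * F \<le> F * (1 + \<kappa>)" by (simp add: power2_eq_square algebra_simps)
  have "F \<ge> 0" by (simp add: F_def)
  then have "F \<le> 1 + \<kappa>" using FF nn by (cases "F = 0") (auto simp: \<kappa>_def)
  then show ?thesis unfolding F_def C1_def C2_def \<kappa>_def .
qed

text \<open>The bound on the trace of the witness against a balanced projection of rank two, in coordinates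
  that diagonalise its two diagonal blocks (eigenvalues \<open>c^2\<close> and \<open>d^2\<close>).\<close>

lemma balanced_pair_bound:
  assumes K0: "contraction2 y1 y2 y1' y2'" and K1: "contraction2 z1 z2 z1' z2'"
    and nn: "0 \<le> \<alpha>" "0 \<le> \<beta>" "0 \<le> \<gamma>" "0 \<le> \<delta>" "0 \<le> s" "0 \<le> t" "0 \<le> c" "0 \<le> d" "0 \<le> co" "0 \<le> sg"
    and ab: "\<alpha>^2 + \<beta>^2 = (1::real)" and gd: "\<gamma>^2 + \<delta>^2 = (1::real)" and st: "s^2 + t^2 = (1::real)" and cd: "c^2 + d^2 = (1::real)"
    and co: "co^2 = s^2 * \<alpha>^2 + t^2 * \<gamma>^2" and sg: "sg^2 = s^2 * \<beta>^2 + t^2 * \<delta>^2"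
    and u: "u1 = of_real \<alpha> * y1 + of_real \<beta> * y1'" "u2 = of_real \<alpha> * y2 + of_real \<beta> * y2'"
    and v: "v1 = of_real \<gamma> * z1 + of_real \<delta> * z1'" "v2 = of_real \<gamma> * z2 + of_real \<delta> * z2'"
  shows "s^2 * (c^2 * (cmod y1)^2 + d^2 * (cmod y2)^2) + t^2 * (d^2 * (cmod z1)^2 + c^2 * (cmod z2)^2)
    + 2 * s * t * (c * d) * cmod (cnj u1 * v1 + cnj u2 * v2) \<le> 1/2 + (co + sg) / 2"
proof -
  define X where "X = cmod (cnj u1 * v1 + cnj u2 * v2)"
  define x where "x = cmod (cnj y1 * z1 + cnj y2 * z2)"
  define Y where "Y = (cmod y1)^2 + (cmod y2)^2"
  define Z where "Z = (cmod z1)^2 + (cmod z2)^2"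
  define j where "j = c^2 - d^2"
  define Q where "Q = s^2 * ((cmod y1)^2 - (cmod y2)^2) - t^2 * ((cmod z1)^2 - (cmod z2)^2)"
  define N where "N = s^2 * Y + t^2 * Z"
  define A where "A = s^2 * t^2"
  define R where "R = co + sg"
  define \<kappa> where "\<kappa> = \<alpha> * \<delta> + \<beta> * \<gamma>"
  have YZ: "Y \<le> 1" "Z \<le> 1" using contraction2_defect[OF K0 ab u] contraction2_defect[OF K1 gd v] by (auto simp: Y_def Z_def)
  have A0: "0 \<le> A" by (simp add: A_def)
  \<comment> \<open>Lagrange's identity trades the wedge term of \<open>overlap_wedge_bound\<close>
    for \<open>x^2\<close>: this limits by how much the overlap of \<open>u\<close>,
    \<open>v\<close> can exceed that of \<open>y\<close>, \<open>z\<close>.\<close>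
  have w: "X^2 - x^2 \<le> \<kappa> + (1 - Y) + (1 - Z)"
  proof -
    have "x^2 + (cmod (y1 * z2 - y2 * z1))^2 = Y * Z"
      unfolding x_def Y_def Z_def by (rule lagrange_identity2)
    moreover have "X^2 + (cmod (y1 * z2 - y2 * z1))^2 \<le> 1 + \<kappa>"
      unfolding X_def \<kappa>_def by (rule overlap_wedge_bound[OF K0 K1 nn(1-4) ab gd u v])
    moreover have "0 \<le> (1 - Y) * (1 - Z)" using YZ by simp
    ultimately show ?thesis by (simp add: algebra_simps)
  qed
  have Qx: "Q^2 \<le> N^2 - 4 * A * x^2"
  proof -
    have "x \<le> cmod y1 * cmod z1 + cmod y2 * cmod z2"
      unfolding x_def by (rule order_trans[OF norm_triangle_ineq]) (simp add: norm_mult)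
    then have "x^2 \<le> (cmod y1 * cmod z1 + cmod y2 * cmod z2)^2" by (intro power_mono) (auto simp: x_def)
    then have "4 * A * x^2 \<le> 4 * A * (cmod y1 * cmod z1 + cmod y2 * cmod z2)^2" using A0 by (intro mult_left_mono) auto
    moreover have "Q^2 + 4 * A * (cmod y1 * cmod z1 + cmod y2 * cmod z2)^2 \<le> N^2"
    proof -
      have "N^2 - Q^2 - 4 * A * (cmod y1 * cmod z1 + cmod y2 * cmod z2)^2
        = 4 * (s^2 * (cmod y1 * cmod y2) - t^2 * (cmod z1 * cmod z2))^2"
        unfolding N_def Q_def A_def Y_def Z_def by (simp add: power2_eq_square algebra_simps)
      moreover have "0 \<le> 4 * (s^2 * (cmod y1 * cmod y2) - t^2 * (cmod z1 * cmod z2))^2" by simp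
      ultimately show ?thesis by linarith
    qed
    ultimately show ?thesis by linarith
  qed
  have s1: "s^2 \<le> 1" "t^2 \<le> 1" using st zero_le_power2[of s] zero_le_power2[of t] by linarith+
  have As: "A \<le> s^2" "A \<le> t^2" using s1 by (auto simp: A_def mult_left_le mult_left_le_one_le)
  \<comment> \<open>The right side is \<open>2 * co * sg\<close>, as \<open>co^2 + sg^2 = 1\<close>.
    The bound \<open>s * t * \<kappa> \<le> co * sg\<close> is Cauchy-Schwarz with its remainder
    written as a square, and \<open>2 * s * t \<le> 1\<close> supplies the other factor.\<close>
  have kR: "4 * A * \<kappa> \<le> R^2 - 1"
  proof -
    have "co^2 + sg^2 = s^2 * (\<alpha>^2 + \<beta>^2) + t^2 * (\<gamma>^2 + \<delta>^2)" unfolding co sg by (simp add: algebra_simps)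
    then have one: "co^2 + sg^2 = 1" using ab gd st by simp
    have "(s * t * \<kappa>)^2 \<le> (co * sg)^2"
    proof -
      have "(co * sg)^2 - (s * t * \<kappa>)^2 = (s^2 * \<alpha>^2 + t^2 * \<gamma>^2) * (s^2 * \<beta>^2 + t^2 * \<delta>^2) - s^2 * t^2 * \<kappa>^2"
        by (simp only: power_mult_distrib co sg)
      also have "\<dots> = (s^2 * (\<alpha> * \<beta>) - t^2 * (\<gamma> * \<delta>))^2"
        unfolding \<kappa>_def by (simp add: power2_eq_square algebra_simps)
      finally have "(co * sg)^2 - (s * t * \<kappa>)^2 = (s^2 * (\<alpha> * \<beta>) - t^2 * (\<gamma> * \<delta>))^2" .
      then show ?thesis by (metis diff_ge_0_iff_ge zero_le_power2)
    qed
    then have "s * t * \<kappa> \<le> co * sg" by (rule power2_le_imp_le) (use nn in simp)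
    moreover have "2 * A * \<kappa> \<le> s * t * \<kappa>"
    proof -
      have "s * t \<le> 1/2" using sum_squares_bound[of s t] st by simp
      then have "2 * (s * t) * (s * t * \<kappa>) \<le> 1 * (s * t * \<kappa>)" using nn by (intro mult_right_mono) (auto simp: \<kappa>_def)
      then show ?thesis by (simp add: A_def power2_eq_square ac_simps)
    qed
    ultimately show ?thesis using one by (simp add: R_def power2_sum)
  qed
  have N1: "N \<le> 1"
  proof -
    have "N \<le> s^2 * 1 + t^2 * 1" unfolding N_def using YZ by (intro add_mono mult_left_mono) auto
    then show ?thesis using st by simp
  qed
  have R1: "1 \<le> R"
  proof -
    have "0 \<le> 4 * A * \<kappa>" using A0 nn by (simp add: \<kappa>_def)
    then have "1^2 \<le> R^2" using kR by simp
    then show ?thesis by (rule power2_le_imp_le) (use nn in \<open>simp add: R_def\<close>)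
  qed
  have "4 * A * (X^2 - x^2) \<le> 4 * A * (\<kappa> + (1 - Y) + (1 - Z))" using w A0 by (intro mult_left_mono) auto
  also have "\<dots> = 4 * A * \<kappa> + 4 * (A * (1 - Y)) + 4 * (A * (1 - Z))" by (simp add: algebra_simps)
  also have "\<dots> \<le> (R^2 - 1) + 4 * (s^2 * (1 - Y)) + 4 * (t^2 * (1 - Z))"
    using kR As YZ by (intro add_mono mult_left_mono mult_right_mono) auto
  also have "\<dots> = R^2 - 1 + 4 * ((s^2 + t^2) - N)" by (simp add: N_def algebra_simps)
  finally have AX: "4 * A * X^2 - 4 * A * x^2 \<le> R^2 - 1 + 4 * (1 - N)" using st by (simp add: algebra_simps)
  have "Q^2 + 4 * A * X^2 \<le> N^2 + (R^2 - 1 + 4 * (1 - N))" using AX Qx by linarith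
  also have "\<dots> \<le> (1 + R - N)^2"
  proof -
    have "(1 + R - N)^2 - (N^2 + (R^2 - 1 + 4 * (1 - N))) = 2 * ((R - 1) * (1 - N))"
      by (simp add: power2_eq_square algebra_simps)
    moreover have "0 \<le> (R - 1) * (1 - N)" using R1 N1 by simp
    ultimately show ?thesis by linarith
  qed
  finally have QX: "Q^2 + (2 * s * t * X)^2 \<le> (1 + R - N)^2" by (simp add: A_def power_mult_distrib ac_simps)
  \<comment> \<open>\<open>j\<close> and \<open>2 * c * d\<close> are the cosine and sine of one
    angle. The left side of the claim is half of \<open>N\<close> plus the inner product of
    \<open>(j, 2 * c * d)\<close> with \<open>(Q, 2 * s * t * X)\<close>, so Cauchy-Schwarz removes
    \<open>c\<close> and \<open>d\<close> and \<open>QX\<close> finishes.\<close>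
  have jcd: "j^2 + (2 * c * d)^2 = 1"
  proof -
    have "j^2 + (2 * c * d)^2 = (c^2 + d^2)^2" by (simp add: j_def power2_eq_square algebra_simps)
    then show ?thesis using cd by simp
  qed
  have "(j * Q + (2 * c * d) * (2 * s * t * X))^2 \<le> (j^2 + (2 * c * d)^2) * (Q^2 + (2 * s * t * X)^2)"
  proof -
    have "(p * q + r * w)^2 \<le> (p^2 + r^2) * (q^2 + w^2)" for p q r w :: real
    proof -
      have "(p^2 + r^2) * (q^2 + w^2) - (p * q + r * w)^2 = (p * w - r * q)^2"
        by (simp add: power2_eq_square algebra_simps)
      then show ?thesis by (metis diff_ge_0_iff_ge zero_le_power2)
    qed
    then show ?thesis .
  qed
  also have "\<dots> \<le> (1 + R - N)^2" using jcd QX by simp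
  finally have fin: "j * Q + (2 * c * d) * (2 * s * t * X) \<le> 1 + R - N"
    by (rule power2_le_imp_le) (use R1 N1 in simp)
  have "s^2 * (c^2 * (cmod y1)^2 + d^2 * (cmod y2)^2) + t^2 * (d^2 * (cmod z1)^2 + c^2 * (cmod z2)^2)
     = ((c^2 + d^2) * N + j * Q) / 2"
    unfolding N_def j_def Q_def Y_def Z_def by (simp add: field_simps)
  then show ?thesis using fin cd unfolding R_def[symmetric] X_def[symmetric] by (simp add: algebra_simps)
qed

section \<open>Estimates for the block witness\<close>

definition cdot :: "'i set \<Rightarrow> ('i \<Rightarrow> complex) \<Rightarrow> ('i \<Rightarrow> complex) \<Rightarrow> complex" where
  "cdot S x y = (\<Sum>i\<in>S. cnj (x i) * y i)"

definition sqnorm :: "'i set \<Rightarrow> ('i \<Rightarrow> complex) \<Rightarrow> real" where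
  "sqnorm S x = (\<Sum>i\<in>S. (cmod (x i))^2)"

lemma sqnorm_nonneg: "0 \<le> sqnorm S x"
  by (simp add: sqnorm_def sum_nonneg)

lemma cdot_self: "cdot S x x = of_real (sqnorm S x)"
  by (simp only: cdot_def sqnorm_def cnj_mult_self of_real_sum)

lemma cdot_commute: "cdot S y x = cnj (cdot S x y)"
  by (simp add: cdot_def mult.commute)

lemma cdot_add_left: "cdot S (\<lambda>i. x i + y i) z = cdot S x z + cdot S y z"
  and cdot_add_right: "cdot S z (\<lambda>i. x i + y i) = cdot S z x + cdot S z y"
  and cdot_diff_left: "cdot S (\<lambda>i. x i - y i) z = cdot S x z - cdot S y z"
  and cdot_diff_right: "cdot S z (\<lambda>i. x i - y i) = cdot S z x - cdot S z y"
  and cdot_scale_left: "cdot S (\<lambda>i. e * x i) z = cnj e * cdot S x z"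
  and cdot_scale_right: "cdot S z (\<lambda>i. e * x i) = e * cdot S z x"
  by (simp_all add: cdot_def algebra_simps sum.distrib sum_subtractf sum_distrib_left)

lemmas cdot_bilinear = cdot_add_left cdot_add_right cdot_diff_left cdot_diff_right cdot_scale_left cdot_scale_right

lemma sqnorm_scale: "sqnorm S (\<lambda>i. e * x i) = (cmod e)^2 * sqnorm S x"
  by (simp add: sqnorm_def norm_mult power_mult_distrib sum_distrib_left)

lemma sqnorm_zeroD: "finite S \<Longrightarrow> sqnorm S x = 0 \<Longrightarrow> i \<in> S \<Longrightarrow> x i = 0"
  by (simp add: sqnorm_def sum_nonneg_eq_0_iff)

lemma weighted_cauchy_schwarz:
  fixes x y :: "'i \<Rightarrow> complex" and e :: "'i \<Rightarrow> real"
  assumes e: "\<And>i. i \<in> S \<Longrightarrow> 0 \<le> e i"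
  shows "(cmod (\<Sum>i\<in>S. of_real (e i) * (cnj (x i) * y i)))^2
    \<le> (\<Sum>i\<in>S. e i * (cmod (x i))^2) * (\<Sum>i\<in>S. e i * (cmod (y i))^2)"
proof (rule discriminant_bound)
  let ?g = "\<Sum>i\<in>S. of_real (e i) * (cnj (x i) * y i)"
  obtain z where z: "cmod z = 1" "z * ?g = of_real (cmod ?g)" using ex_unimodular by blast
  fix r :: real
  have "0 \<le> (\<Sum>i\<in>S. e i * (cmod (x i + of_real r * z * y i))^2)" using e by (simp add: sum_nonneg)
  also have "\<dots> = (\<Sum>i\<in>S. e i * (cmod (x i))^2 + r^2 * (e i * (cmod (y i))^2) + 2 * r * Re (z * (of_real (e i) * (cnj (x i) * y i))))"
    unfolding cmod_add_phase[OF z(1)] by (intro sum.cong refl) (simp add: algebra_simps)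
  also have "\<dots> = (\<Sum>i\<in>S. e i * (cmod (x i))^2) + r^2 * (\<Sum>i\<in>S. e i * (cmod (y i))^2) + 2 * r * Re (z * ?g)"
    by (simp only: sum.distrib sum_distrib_left[symmetric] Re_sum[symmetric])
  also have "Re (z * ?g) = cmod ?g" using z by simp
  finally show "0 \<le> (\<Sum>i\<in>S. e i * (cmod (x i))^2) + 2 * r * cmod ?g + r^2 * (\<Sum>i\<in>S. e i * (cmod (y i))^2)" by simp
qed (use e in \<open>auto intro!: sum_nonneg\<close>)

lemma cdot_cauchy_schwarz: "(cmod (cdot S x y))^2 \<le> sqnorm S x * sqnorm S y"
  using weighted_cauchy_schwarz[of S "\<lambda>_. 1" x y] by (simp add: cdot_def sqnorm_def)

text \<open>The residual is kept so that a second pair, orthogonal to the first, can be applied to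
  it in \<open>bessel4\<close>. Norms are only bounded by 1 because a normalised vector may
  degenerate to 0.\<close>

lemma bessel_pair:
  assumes a: "sqnorm S x \<le> 1" and b: "sqnorm S y \<le> 1" and o: "cdot S x y = 0"
  shows "(cmod (cdot S x \<theta>))^2 + (cmod (cdot S y \<theta>))^2
    + sqnorm S (\<lambda>i. \<theta> i - (cdot S x \<theta> * x i + cdot S y \<theta> * y i)) \<le> sqnorm S \<theta>"
proof -
  define p where "p = cdot S x \<theta>"
  define q where "q = cdot S y \<theta>"
  have o': "cdot S y x = 0" using o cdot_commute[of S y x] by simp
  have pq: "cdot S \<theta> x = cnj p" "cdot S \<theta> y = cnj q" unfolding p_def q_def by (rule cdot_commute)+
  have "complex_of_real (sqnorm S (\<lambda>i. \<theta> i - (p * x i + q * y i)))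
     = of_real (sqnorm S \<theta>) - 2 * (cnj p * p) - 2 * (cnj q * q) + cnj p * p * of_real (sqnorm S x) + cnj q * q * of_real (sqnorm S y)"
    unfolding cdot_self[symmetric] cdot_bilinear o o' pq p_def[symmetric] q_def[symmetric] by (simp add: algebra_simps)
  also have "\<dots> = of_real (sqnorm S \<theta> - 2 * (cmod p)^2 - 2 * (cmod q)^2 + (cmod p)^2 * sqnorm S x + (cmod q)^2 * sqnorm S y)"
    unfolding cnj_mult_self by simp
  finally have "sqnorm S (\<lambda>i. \<theta> i - (p * x i + q * y i))
     = sqnorm S \<theta> - 2 * (cmod p)^2 - 2 * (cmod q)^2 + (cmod p)^2 * sqnorm S x + (cmod q)^2 * sqnorm S y"
    unfolding of_real_eq_iff .
  moreover have "(cmod p)^2 * sqnorm S x \<le> (cmod p)^2" "(cmod q)^2 * sqnorm S y \<le> (cmod q)^2"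
    using a b by (auto simp: mult_left_le)
  ultimately show ?thesis unfolding p_def[symmetric] q_def[symmetric] by linarith
qed

lemma bessel2:
  assumes "sqnorm S x \<le> 1" "sqnorm S y \<le> 1" "cdot S x y = 0"
  shows "(cmod (cdot S x \<theta>))^2 + (cmod (cdot S y \<theta>))^2 \<le> sqnorm S \<theta>"
  using bessel_pair[OF assms, of \<theta>] sqnorm_nonneg[of S "\<lambda>i. \<theta> i - (cdot S x \<theta> * x i + cdot S y \<theta> * y i)"] by linarith

lemma bessel4:
  assumes "sqnorm S x \<le> 1" "sqnorm S y \<le> 1" "cdot S x y = 0"
    and "sqnorm S z \<le> 1" "sqnorm S w \<le> 1" "cdot S z w = 0"
    and o: "cdot S z x = 0" "cdot S z y = 0" "cdot S w x = 0" "cdot S w y = 0"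
  shows "(cmod (cdot S x \<theta>))^2 + (cmod (cdot S y \<theta>))^2 + ((cmod (cdot S z \<theta>))^2 + (cmod (cdot S w \<theta>))^2) \<le> sqnorm S \<theta>"
proof -
  define \<theta>' where "\<theta>' = (\<lambda>i. \<theta> i - (cdot S x \<theta> * x i + cdot S y \<theta> * y i))"
  have "cdot S z \<theta>' = cdot S z \<theta>" "cdot S w \<theta>' = cdot S w \<theta>" unfolding \<theta>'_def cdot_bilinear o by auto
  then show ?thesis
    using bessel_pair[OF assms(1-3), of \<theta>, folded \<theta>'_def] bessel2[OF assms(4-6), of \<theta>'] by simp
qed

text \<open>Gram-Schmidt for two unit vectors. The phase \<open>e\<close> makes their overlap
  nonnegative, so that both coefficients are real and \<open>(\<alpha>, \<beta>)\<close> lies in the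
  first quadrant.\<close>

lemma unit_pair_decomposition:
  assumes S: "finite S" and y: "sqnorm S y = 1" and u: "sqnorm S u = 1"
  shows "\<exists>e y' \<alpha> \<beta>. cmod e = 1 \<and> 0 \<le> \<alpha> \<and> 0 \<le> \<beta> \<and> \<alpha>^2 + \<beta>^2 = 1
     \<and> (\<forall>i\<in>S. u i = of_real \<alpha> * (e * y i) + of_real \<beta> * y' i)
     \<and> cdot S (\<lambda>i. e * y i) y' = 0 \<and> sqnorm S y' \<le> 1"
proof -
  define g where "g = cdot S y u"
  obtain f where f: "cmod f = 1" "f * g = of_real (cmod g)" using ex_unimodular by blast
  define e where "e = cnj f"
  have e: "cmod e = 1" "cnj e * g = of_real (cmod g)" using f by (auto simp: e_def)
  define yt where "yt = (\<lambda>i. e * y i)"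
  define \<alpha> where "\<alpha> = cmod g"
  have "\<alpha>^2 \<le> 1" using cdot_cauchy_schwarz[of S y u] y u by (simp add: \<alpha>_def g_def)
  define \<beta> where "\<beta> = sqrt (1 - \<alpha>^2)"
  have b2: "\<beta>^2 = 1 - \<alpha>^2" using \<open>\<alpha>^2 \<le> 1\<close> by (simp add: \<beta>_def)
  define w where "w = (\<lambda>i. u i - of_real \<alpha> * yt i)"
  have yt: "sqnorm S yt = 1" unfolding yt_def sqnorm_scale using e y by simp
  have yu: "cdot S yt u = of_real \<alpha>" unfolding yt_def cdot_scale_left \<alpha>_def using e by (simp add: g_def)
  have uy: "cdot S u yt = of_real \<alpha>" using cdot_commute[of S u yt] yu by simp
  have "complex_of_real (sqnorm S w) = of_real (1 - \<alpha>^2)"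
    unfolding cdot_self[symmetric] w_def cdot_bilinear yu uy cdot_self yt u by (simp add: power2_eq_square algebra_simps)
  then have w: "sqnorm S w = \<beta>^2" unfolding of_real_eq_iff b2 .
  have yw: "cdot S yt w = 0" unfolding w_def cdot_bilinear yu cdot_self yt by simp
  \<comment> \<open>For \<open>\<beta> = 0\<close> division by zero gives \<open>y' = 0\<close>;
    this is why only \<open>sqnorm S y' \<le> 1\<close> is claimed.\<close>
  define y' where "y' = (\<lambda>i. of_real (1 / \<beta>) * w i)"
  have "u i = of_real \<alpha> * (e * y i) + of_real \<beta> * y' i" if "i \<in> S" for i
  proof (cases "\<beta> = 0")
    case True
    then have "w i = 0" using sqnorm_zeroD[OF S _ that] w by simp
    then show ?thesis using True by (simp add: w_def yt_def)
  next
    case False then show ?thesis by (simp add: y'_def w_def yt_def)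
  qed
  moreover have "sqnorm S y' \<le> 1" unfolding y'_def sqnorm_scale w by (cases "\<beta> = 0") (auto simp: power_divide norm_divide)
  moreover have "cdot S yt y' = 0" unfolding y'_def cdot_scale_right yw by simp
  moreover have "0 \<le> \<alpha>" "0 \<le> \<beta>" "\<alpha>^2 + \<beta>^2 = 1" using b2 \<open>\<alpha>^2 \<le> 1\<close> by (auto simp: \<alpha>_def \<beta>_def)
  ultimately show ?thesis using e(1) unfolding yt_def by blast
qed

section \<open>Bounds for the diagonal of the witness in the eigenbasis\<close>

lemma cross_term_complex:
  fixes a b c d :: complex
  assumes nn: "0 \<le> s" "0 \<le> t" "0 \<le> \<alpha>" "0 \<le> \<beta>" "0 \<le> \<gamma>" "0 \<le> \<delta>"
    and st: "s^2 + t^2 = (1::real)" and ab: "\<alpha>^2 + \<beta>^2 = (1::real)" and gd: "\<gamma>^2 + \<delta>^2 = (1::real)"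
    and sg: "0 \<le> \<sigma>" "\<sigma>^2 = s^2 * \<beta>^2 + t^2 * \<delta>^2"
  shows "2 * s * t * \<bar>Re (cnj (of_real \<alpha> * a + of_real \<beta> * b) * (of_real \<gamma> * c + of_real \<delta> * d))\<bar>
    \<le> s^2 * (cmod a)^2 + t^2 * (cmod c)^2 + \<sigma> / 2 * ((cmod a)^2 + (cmod b)^2 + ((cmod c)^2 + (cmod d)^2))"
proof -
  have n: "cmod (of_real x * p + of_real y * q) \<le> x * cmod p + y * cmod q" if "0 \<le> x" "0 \<le> y" for x y p q
    using norm_triangle_ineq[of "of_real x * p" "of_real y * q"] that by (simp add: norm_mult)
  have "\<bar>Re (cnj (of_real \<alpha> * a + of_real \<beta> * b) * (of_real \<gamma> * c + of_real \<delta> * d))\<bar>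
     \<le> cmod (of_real \<alpha> * a + of_real \<beta> * b) * cmod (of_real \<gamma> * c + of_real \<delta> * d)"
    by (rule order_trans[OF abs_Re_le_cmod]) (simp only: norm_mult complex_mod_cnj order_refl)
  also have "\<dots> \<le> (\<alpha> * cmod a + \<beta> * cmod b) * (\<gamma> * cmod c + \<delta> * cmod d)"
    using n[of \<alpha> \<beta> a b] n[of \<gamma> \<delta> c d] nn by (intro mult_mono) auto
  finally have "2 * s * t * \<bar>Re (cnj (of_real \<alpha> * a + of_real \<beta> * b) * (of_real \<gamma> * c + of_real \<delta> * d))\<bar>
    \<le> 2 * s * t * ((\<alpha> * cmod a + \<beta> * cmod b) * (\<gamma> * cmod c + \<delta> * cmod d))"
    using nn by (intro mult_left_mono) auto
  also have "\<dots> \<le> s^2 * (cmod a)^2 + t^2 * (cmod c)^2 + \<sigma> / 2 * ((cmod a)^2 + (cmod b)^2 + (cmod c)^2 + (cmod d)^2)"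
    by (rule cross_term_bound) (use nn st ab gd sg in auto)
  finally show ?thesis by (simp add: algebra_simps)
qed

text \<open>Polarisation turns the cross term of the witness into
  \<open>(s t / 2) (h h^H - g g^H)\<close> with \<open>g = U + V\<close> and
  \<open>h = U - V\<close>. A single rank-one term is negative, so a weight between 0 and
  \<open>l\<close> meets the lowest eigenvalue, at least \<open>- \<sigma> / 2\<close>, only
  once.\<close>

lemma witness_lower_bound:
  fixes Y Y' Z Z' U V :: "'k \<Rightarrow> complex" and e :: "'k \<Rightarrow> real"
  assumes orth: "cdot K Y Y' = 0" "cdot K Z Z' = 0" "cdot K Z Y = 0" "cdot K Z Y' = 0" "cdot K Z' Y = 0" "cdot K Z' Y' = 0"
    and le1: "sqnorm K Y \<le> 1" "sqnorm K Y' \<le> 1" "sqnorm K Z \<le> 1" "sqnorm K Z' \<le> 1"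
    and nn: "0 \<le> s" "0 \<le> t" "0 \<le> \<alpha>" "0 \<le> \<beta>" "0 \<le> \<gamma>" "0 \<le> \<delta>"
    and st: "s^2 + t^2 = (1::real)" and ab: "\<alpha>^2 + \<beta>^2 = (1::real)" and gd: "\<gamma>^2 + \<delta>^2 = (1::real)"
    and sg: "0 \<le> \<sigma>" "\<sigma>^2 = s^2 * \<beta>^2 + t^2 * \<delta>^2"
    and U: "U = (\<lambda>k. of_real \<alpha> * Y k + of_real \<beta> * Y' k)" and V: "V = (\<lambda>k. of_real \<gamma> * Z k + of_real \<delta> * Z' k)"
    and e: "\<And>k. k \<in> K \<Longrightarrow> 0 \<le> e k" "\<And>k. k \<in> K \<Longrightarrow> e k \<le> l" and l: "0 \<le> l"
  shows "- (l * (\<sigma> / 2)) \<le> (\<Sum>k\<in>K. e k * (s^2 * (cmod (Y k))^2 + t^2 * (cmod (Z k))^2 - 2 * s * t * Re (cnj (U k) * V k)))"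
proof -
  define g where "g = (\<lambda>k. U k + V k)"
  define h where "h = (\<lambda>k. U k - V k)"
  define q where "q = (\<lambda>X. \<Sum>k\<in>K. e k * (cmod (X k))^2)"
  have q0: "0 \<le> q X" for X unfolding q_def using e by (auto intro!: sum_nonneg)
  \<comment> \<open>The test vector is the weight applied to \<open>g\<close>. Weighted
    Cauchy-Schwarz (\<open>wcs\<close>) is an equality at \<open>g\<close> and an inequality at
    \<open>Y\<close>, \<open>Z\<close>, \<open>h\<close>; hence \<open>q g * W\<close> is at least
    the value of the witness at \<open>\<theta>\<close>, which \<open>cross_term_complex\<close>
    controls.\<close>
  define \<theta> where "\<theta> = (\<lambda>k. of_real (e k) * g k)"
  have wcs: "(cmod (cdot K X \<theta>))^2 \<le> q X * q g" for X
    using weighted_cauchy_schwarz[of K e X g] e unfolding cdot_def \<theta>_def q_def by (simp add: ac_simps)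
  have gt: "cdot K g \<theta> = of_real (q g)"
    unfolding cdot_def \<theta>_def q_def of_real_sum of_real_mult cnj_mult_self[symmetric]
    by (simp add: ac_simps)
  have pol: "4 * Re (cnj x * y) = (cmod (x + y))^2 - (cmod (x - y))^2" for x y
    unfolding cmod_power2 by (simp add: power2_eq_square algebra_simps)
  have pol': "2 * s * t * Re (cnj x * y) = s * t / 2 * ((cmod (x + y))^2 - (cmod (x - y))^2)" for x y
    unfolding pol[symmetric] by simp
  define W where "W = (\<Sum>k\<in>K. e k * (s^2 * (cmod (Y k))^2 + t^2 * (cmod (Z k))^2 - 2 * s * t * Re (cnj (U k) * V k)))"
  have "W = (\<Sum>k\<in>K. s^2 * (e k * (cmod (Y k))^2) + t^2 * (e k * (cmod (Z k))^2)
      + s * t / 2 * (e k * (cmod (h k))^2) - s * t / 2 * (e k * (cmod (g k))^2))"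
    unfolding W_def
  proof (intro sum.cong refl)
    fix k
    have eq: "2 * s * t * Re (cnj (U k) * V k) = s * t / 2 * ((cmod (g k))^2 - (cmod (h k))^2)"
      unfolding g_def h_def by (rule pol')
    show "e k * (s^2 * (cmod (Y k))^2 + t^2 * (cmod (Z k))^2 - 2 * s * t * Re (cnj (U k) * V k))
      = s^2 * (e k * (cmod (Y k))^2) + t^2 * (e k * (cmod (Z k))^2)
      + s * t / 2 * (e k * (cmod (h k))^2) - s * t / 2 * (e k * (cmod (g k))^2)"
      unfolding eq by (simp add: algebra_simps)
  qed
  then have W: "W = s^2 * q Y + t^2 * q Z + s * t / 2 * q h - s * t / 2 * q g"
    unfolding q_def by (simp only: sum.distrib sum_subtractf sum_distrib_left[symmetric])
  have "q g * W \<ge> - (l * (\<sigma> / 2)) * q g"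
  proof -
    define a where "a = cdot K Y \<theta>"
    define b where "b = cdot K Y' \<theta>"
    define c where "c = cdot K Z \<theta>"
    define d where "d = cdot K Z' \<theta>"
    have Ut: "cdot K U \<theta> = of_real \<alpha> * a + of_real \<beta> * b" and Vt: "cdot K V \<theta> = of_real \<gamma> * c + of_real \<delta> * d"
      unfolding U V cdot_bilinear a_def b_def c_def d_def by auto
    have ht: "cdot K h \<theta> = cdot K U \<theta> - cdot K V \<theta>" and gt': "cdot K g \<theta> = cdot K U \<theta> + cdot K V \<theta>"
      unfolding h_def g_def cdot_bilinear by auto
    have "sqnorm K \<theta> \<le> l * q g"
    proof -
      have "sqnorm K \<theta> = (\<Sum>k\<in>K. e k * (e k * (cmod (g k))^2))"
        unfolding sqnorm_def \<theta>_def
        by (intro sum.cong refl) (simp add: norm_mult power_mult_distrib power2_eq_square[of "e _"])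
      also have "\<dots> \<le> (\<Sum>k\<in>K. l * (e k * (cmod (g k))^2))" using e by (intro sum_mono mult_right_mono) auto
      finally show ?thesis unfolding q_def sum_distrib_left .
    qed
    moreover have "(cmod a)^2 + (cmod b)^2 + ((cmod c)^2 + (cmod d)^2) \<le> sqnorm K \<theta>"
      unfolding a_def b_def c_def d_def by (rule bessel4) (use orth le1 in auto)
    ultimately have B: "\<sigma> / 2 * ((cmod a)^2 + (cmod b)^2 + ((cmod c)^2 + (cmod d)^2)) \<le> \<sigma> / 2 * (l * q g)"
      using sg by (intro mult_left_mono) auto
    have "2 * s * t * Re (cnj (cdot K U \<theta>) * cdot K V \<theta>) \<le> 2 * s * t * \<bar>Re (cnj (cdot K U \<theta>) * cdot K V \<theta>)\<bar>"
      using nn by (intro mult_left_mono) auto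
    also have "\<dots> \<le> s^2 * (cmod a)^2 + t^2 * (cmod c)^2 + \<sigma> / 2 * ((cmod a)^2 + (cmod b)^2 + ((cmod c)^2 + (cmod d)^2))"
      unfolding Ut Vt by (rule cross_term_complex) (use nn st ab gd sg in auto)
    finally have m: "s * t / 2 * ((cmod (cdot K g \<theta>))^2 - (cmod (cdot K h \<theta>))^2)
        \<le> s^2 * (cmod a)^2 + t^2 * (cmod c)^2 + \<sigma> / 2 * (l * q g)"
      using B unfolding ht gt' pol' by linarith
    have "s^2 * (cmod a)^2 + t^2 * (cmod c)^2 + s * t / 2 * (cmod (cdot K h \<theta>))^2
       \<le> s^2 * (q Y * q g) + t^2 * (q Z * q g) + s * t / 2 * (q h * q g)"
      using nn wcs unfolding a_def c_def by (intro add_mono mult_left_mono) auto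
    moreover have "(cmod (cdot K g \<theta>))^2 = q g * q g" unfolding gt using q0 by (simp add: power2_eq_square)
    ultimately have "s * t / 2 * (q g * q g) \<le> s^2 * (q Y * q g) + t^2 * (q Z * q g) + s * t / 2 * (q h * q g) + \<sigma> / 2 * (l * q g)"
      using m by (simp add: algebra_simps)
    then show ?thesis unfolding W by (simp add: algebra_simps)
  qed
  then have "0 \<le> q g * (W + l * (\<sigma> / 2))" by (simp add: algebra_simps)
  moreover have "0 \<le> W + l * (\<sigma> / 2)" if "q g = 0"
  proof -
    have "0 \<le> W" unfolding W that using nn q0 by simp
    then show ?thesis using l sg by simp
  qed
  ultimately have "0 \<le> W + l * (\<sigma> / 2)" using q0[of g] by (cases "q g = 0") (auto simp: zero_le_mult_iff)
  then show ?thesis unfolding W_def by simp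
qed

text \<open>Summation by parts over the levels \<open>a \<le> b \<le> c\<close>: as the witness has
  trace 1, the sum is \<open>c\<close> minus the gaps \<open>b - a\<close> and \<open>c - b\<close>
  times \<open>W k0\<close> and \<open>W k0 + W k1\<close>, plus the contribution of the eigenvalues
  above \<open>c\<close>.\<close>

lemma witness_nonneg:
  fixes Y Y' Z Z' U V :: "'k \<Rightarrow> complex" and lam :: "'k \<Rightarrow> real"
  assumes K: "finite K" "k0 \<in> K" "k1 \<in> K" "k0 \<noteq> k1"
    and orth: "cdot K Y Y' = 0" "cdot K Z Z' = 0" "cdot K Z Y = 0" "cdot K Z Y' = 0" "cdot K Z' Y = 0" "cdot K Z' Y' = 0"
    and one: "sqnorm K Y = 1" "sqnorm K Z = 1" and le1: "sqnorm K Y' \<le> 1" "sqnorm K Z' \<le> 1"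
    and nn: "0 \<le> s" "0 \<le> t" "0 \<le> \<alpha>" "0 \<le> \<beta>" "0 \<le> \<gamma>" "0 \<le> \<delta>"
    and st: "s^2 + t^2 = (1::real)" and ab: "\<alpha>^2 + \<beta>^2 = (1::real)" and gd: "\<gamma>^2 + \<delta>^2 = (1::real)"
    and sg: "0 \<le> \<sigma>" "\<sigma>^2 = s^2 * \<beta>^2 + t^2 * \<delta>^2"
    and co: "0 \<le> \<tau>" "\<tau>^2 = s^2 * \<alpha>^2 + t^2 * \<gamma>^2"
    and U: "U = (\<lambda>k. of_real \<alpha> * Y k + of_real \<beta> * Y' k)" and V: "V = (\<lambda>k. of_real \<gamma> * Z k + of_real \<delta> * Z' k)"
    and W: "W = (\<lambda>k. s^2 * (cmod (Y k))^2 + t^2 * (cmod (Z k))^2 - 2 * s * t * Re (cnj (U k) * V k))"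
    and half: "(cmod (Y k0))^2 + (cmod (Y' k0))^2 \<le> 1/2" "(cmod (Z k0))^2 + (cmod (Z' k0))^2 \<le> 1/2"
    and pair: "W k0 + W k1 \<le> 1/2 + (\<tau> + \<sigma>) / 2"
    and ev: "lam k0 = a" "lam k1 = b" "0 \<le> a" "a \<le> b" "b \<le> c" "c \<le> L" "b \<le> L"
    and rest: "\<And>k. k \<in> K - {k0, k1} \<Longrightarrow> c \<le> lam k \<and> lam k \<le> L"
    and spec: "(L - b)^2 \<le> 4 * a * c"
  shows "0 \<le> (\<Sum>k\<in>K. lam k * W k)"
proof -
  have UV: "cdot K U V = 0"
  proof -
    have "cdot K Y Z = 0" "cdot K Y' Z = 0" "cdot K Y Z' = 0" "cdot K Y' Z' = 0"
      using orth cdot_commute[of K Y Z] cdot_commute[of K Y' Z] cdot_commute[of K Y Z'] cdot_commute[of K Y' Z'] by auto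
    then show ?thesis unfolding U V cdot_bilinear by simp
  qed
  have "(\<Sum>k\<in>K. W k) = s^2 * sqnorm K Y + t^2 * sqnorm K Z - 2 * s * t * Re (cdot K U V)"
    unfolding W sqnorm_def cdot_def by (simp only: sum.distrib sum_subtractf sum_distrib_left Re_sum)
  then have W1: "(\<Sum>k\<in>K. W k) = 1" using one UV st by simp
  \<comment> \<open>The excess over \<open>c\<close>, between 0 and \<open>L - c\<close>, and set to
    0 at the two lowest indices, where \<open>lam\<close> may lie below \<open>c\<close>.\<close>
  define e where "e = (\<lambda>k. if k \<in> {k0, k1} then 0 else lam k - c)"
  have E: "- ((L - c) * (\<sigma> / 2)) \<le> (\<Sum>k\<in>K. e k * W k)"
    unfolding W by (rule witness_lower_bound[OF orth(1-6) _ le1(1) _ le1(2) nn st ab gd sg U V])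
      (use one ev rest in \<open>auto simp: e_def\<close>)
  have W0: "W k0 \<le> 1/2 + \<tau> / 2"
  proof -
    \<comment> \<open>exchanging \<open>Y, Z\<close> with \<open>Y', Z'\<close> turns the witness into its complement\<close>
    have "2 * s * t * \<bar>Re (cnj (of_real \<beta> * Y' k0 + of_real \<alpha> * Y k0) * (of_real \<delta> * Z' k0 + of_real \<gamma> * Z k0))\<bar>
      \<le> s^2 * (cmod (Y' k0))^2 + t^2 * (cmod (Z' k0))^2
        + \<tau> / 2 * ((cmod (Y' k0))^2 + (cmod (Y k0))^2 + ((cmod (Z' k0))^2 + (cmod (Z k0))^2))"
      by (rule cross_term_complex) (use nn st ab gd co in \<open>auto simp: add.commute\<close>)
    then have "2 * s * t * \<bar>Re (cnj (U k0) * V k0)\<bar>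
      \<le> s^2 * (cmod (Y' k0))^2 + t^2 * (cmod (Z' k0))^2
        + \<tau> / 2 * ((cmod (Y' k0))^2 + (cmod (Y k0))^2 + ((cmod (Z' k0))^2 + (cmod (Z k0))^2))"
      unfolding U V by (simp only: add.commute)
    moreover have "\<tau> / 2 * ((cmod (Y' k0))^2 + (cmod (Y k0))^2 + ((cmod (Z' k0))^2 + (cmod (Z k0))^2)) \<le> \<tau> / 2 * 1"
      using half co by (intro mult_left_mono) auto
    moreover have "- (2 * s * t * Re (cnj (U k0) * V k0)) \<le> 2 * s * t * \<bar>Re (cnj (U k0) * V k0)\<bar>"
    proof -
      have "- (2 * s * t * r) \<le> 2 * s * t * \<bar>r\<bar>" for r
        using mult_left_mono[of "- r" "\<bar>r\<bar>" "2 * s * t"] nn by simp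
      then show ?thesis .
    qed
    moreover have "s^2 * ((cmod (Y k0))^2 + (cmod (Y' k0))^2) + t^2 * ((cmod (Z k0))^2 + (cmod (Z' k0))^2) \<le> s^2 * (1/2) + t^2 * (1/2)"
      using half by (intro add_mono mult_left_mono) auto
    ultimately show ?thesis using st unfolding W by (simp add: algebra_simps)
  qed
  have "(\<Sum>k\<in>K. lam k * W k) = (\<Sum>k\<in>K. c * W k + ((if k = k0 then (a - c) * W k0 else 0) + (if k = k1 then (b - c) * W k1 else 0)) + e k * W k)"
    using K ev by (intro sum.cong refl) (auto simp: e_def algebra_simps)
  also have "\<dots> = c * (\<Sum>k\<in>K. W k) + ((a - c) * W k0 + (b - c) * W k1) + (\<Sum>k\<in>K. e k * W k)"
    using K by (simp add: sum.distrib sum_distrib_left)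
  finally have sum: "(\<Sum>k\<in>K. lam k * W k) = c - (b - a) * W k0 - (c - b) * (W k0 + W k1) + (\<Sum>k\<in>K. e k * W k)"
    using W1 by (simp add: algebra_simps)
  have "(b - a) * W k0 \<le> (b - a) * (1/2 + \<tau> / 2)" "(c - b) * (W k0 + W k1) \<le> (c - b) * (1/2 + (\<tau> + \<sigma>) / 2)"
    using W0 pair ev by (auto intro!: mult_left_mono)
  then have f1: "c - (b - a) * (1/2 + \<tau> / 2) - (c - b) * (1/2 + (\<tau> + \<sigma>) / 2) - (L - c) * (\<sigma> / 2) \<le> (\<Sum>k\<in>K. lam k * W k)"
    using sum E by linarith
  have f2: "c - (b - a) * (1/2 + \<tau> / 2) - (c - b) * (1/2 + (\<tau> + \<sigma>) / 2) - (L - c) * (\<sigma> / 2)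
     = ((c + a) - ((c - a) * \<tau> + (L - b) * \<sigma>)) / 2" by (simp add: field_simps)
  \<comment> \<open>\<open>(\<tau>, \<sigma>)\<close> is a unit vector, so the left side is at most
    \<open>sqrt ((c - a)^2 + (L - b)^2)\<close>. Since
    \<open>(c + a)^2 - (c - a)^2 = 4 * a * c\<close>, the hypothesis \<open>spec\<close> says
    precisely that this is at most \<open>c + a\<close>.\<close>
  have f3: "(c - a) * \<tau> + (L - b) * \<sigma> \<le> c + a"
  proof (rule power2_le_imp_le)
    have "\<tau>^2 + \<sigma>^2 = s^2 * (\<alpha>^2 + \<beta>^2) + t^2 * (\<gamma>^2 + \<delta>^2)" unfolding co sg by (simp add: algebra_simps)
    then have one: "\<tau>^2 + \<sigma>^2 = 1" using ab gd st by simp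
    have "((c - a) * \<tau> + (L - b) * \<sigma>)^2 + ((c - a) * \<sigma> - (L - b) * \<tau>)^2 = ((c - a)^2 + (L - b)^2) * (\<tau>^2 + \<sigma>^2)"
      by (simp add: power2_eq_square algebra_simps)
    then have "((c - a) * \<tau> + (L - b) * \<sigma>)^2 \<le> (c - a)^2 + (L - b)^2"
      unfolding one by (metis le_add_same_cancel1 mult.right_neutral zero_le_power2)
    also have "\<dots> \<le> (c - a)^2 + 4 * a * c" using spec by simp
    also have "\<dots> = (c + a)^2" by (simp add: power2_eq_square algebra_simps)
    finally show "((c - a) * \<tau> + (L - b) * \<sigma>)^2 \<le> (c + a)^2" .
  qed (use ev in auto)
  have "0 \<le> ((c + a) - ((c - a) * \<tau> + (L - b) * \<sigma>)) / 2" using f3 by simp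
  then show ?thesis using f1 unfolding f2 by (rule order_trans)
qed

section \<open>Resolutions of the identity and the two lowest eigenvectors\<close>

lemma cdot_cong: "(\<And>i. i \<in> S \<Longrightarrow> x i = x' i) \<Longrightarrow> (\<And>i. i \<in> S \<Longrightarrow> y i = y' i) \<Longrightarrow> cdot S x y = cdot S x' y'"
  unfolding cdot_def by (intro sum.cong refl) auto

lemma sqnorm_add:
  "sqnorm S (\<lambda>i. x i + y i) = sqnorm S x + sqnorm S y + 2 * Re (cdot S x y)"
proof -
  have "complex_of_real (sqnorm S (\<lambda>i. x i + y i)) = of_real (sqnorm S x) + of_real (sqnorm S y) + (cdot S x y + cnj (cdot S x y))"
    unfolding cdot_self[symmetric] cdot_bilinear cdot_commute[of S y x] by simp
  also have "\<dots> = of_real (sqnorm S x + sqnorm S y + 2 * Re (cdot S x y))"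
    by (simp add: complex_eq_iff)
  finally show ?thesis unfolding of_real_eq_iff .
qed

lemma cdot_sum_frame:
  fixes p q :: "'k \<Rightarrow> 'i \<Rightarrow> complex"
  shows "cdot K (\<lambda>k. cdot S (p k) x) (\<lambda>k. cdot T (q k) y)
    = (\<Sum>i\<in>S. \<Sum>j\<in>T. cnj (x i) * y j * (\<Sum>k\<in>K. p k i * cnj (q k j)))"
proof -
  have "cdot K (\<lambda>k. cdot S (p k) x) (\<lambda>k. cdot T (q k) y)
     = (\<Sum>k\<in>K. \<Sum>i\<in>S. \<Sum>j\<in>T. cnj (x i) * y j * (p k i * cnj (q k j)))"
    unfolding cdot_def cnj_sum sum_product by (intro sum.cong refl) (simp add: ac_simps)
  also have "\<dots> = (\<Sum>i\<in>S. \<Sum>j\<in>T. \<Sum>k\<in>K. cnj (x i) * y j * (p k i * cnj (q k j)))"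
    by (subst sum.swap, intro sum.cong refl, rule sum.swap)
  finally show ?thesis by (simp add: sum_distrib_left)
qed

lemma parseval:
  assumes "finite S" and "\<And>i j. i \<in> S \<Longrightarrow> j \<in> S \<Longrightarrow> (\<Sum>k\<in>K. p k i * cnj (p k j)) = (if i = j then 1 else 0)"
  shows "cdot K (\<lambda>k. cdot S (p k) x) (\<lambda>k. cdot S (p k) y) = cdot S x y"
proof -
  have "cdot K (\<lambda>k. cdot S (p k) x) (\<lambda>k. cdot S (p k) y) = (\<Sum>i\<in>S. \<Sum>j\<in>S. if i = j then cnj (x i) * y j else 0)"
    unfolding cdot_sum_frame using assms(2) by (intro sum.cong refl) auto
  then show ?thesis using assms(1) by (simp add: cdot_def)
qed

text \<open>The matrix is a composition of two contractions: the map with columns \<open>y\<close>,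
  \<open>y'\<close>, followed by taking overlaps with \<open>f1\<close>, \<open>f2\<close>.\<close>

lemma contraction2_frame:
  assumes f: "sqnorm S f1 \<le> 1" "sqnorm S f2 \<le> 1" "cdot S f1 f2 = 0"
    and y: "sqnorm S y \<le> 1" "sqnorm S y' \<le> 1" "cdot S y y' = 0"
  shows "contraction2 (cdot S f1 y) (cdot S f2 y) (cdot S f1 y') (cdot S f2 y')"
  unfolding contraction2_def
proof (intro allI)
  fix x w
  let ?v = "\<lambda>i. x * y i + w * y' i"
  have "(cmod (cdot S f1 ?v))^2 + (cmod (cdot S f2 ?v))^2 \<le> sqnorm S ?v" by (rule bessel2[OF f])
  also have "\<dots> = (cmod x)^2 * sqnorm S y + (cmod w)^2 * sqnorm S y'"
    unfolding sqnorm_add cdot_bilinear sqnorm_scale y(3) by simp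
  also have "\<dots> \<le> (cmod x)^2 + (cmod w)^2" using y by (intro add_mono) (auto simp: mult_left_le)
  finally show "(cmod (x * cdot S f1 y + w * cdot S f1 y'))^2 + (cmod (x * cdot S f2 y + w * cdot S f2 y'))^2
     \<le> (cmod x)^2 + (cmod w)^2" unfolding cdot_bilinear .
qed

text \<open>The pairs \<open>(p0, q0)\<close> and \<open>(p1, q1)\<close> are orthonormal with
  halves of equal norm, and \<open>opq\<close> makes the overlaps in the two blocks opposite. Hence
  both diagonal blocks of the projection on their span have the eigenvalues
  \<open>1/2 + \<kappa>\<close> and \<open>1/2 - \<kappa>\<close>, in opposite order, and in
  eigencoordinates the claim is \<open>balanced_pair_bound\<close>.\<close>

lemma balanced_pair_witness:
  fixes p0 p1 q0 q1 y y' z z' u v :: "'i \<Rightarrow> complex"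
  assumes S: "finite S"
    and half: "sqnorm S p0 = 1/2" "sqnorm S p1 = 1/2" "sqnorm S q0 = 1/2" "sqnorm S q1 = 1/2"
    and opq: "cdot S p0 p1 + cdot S q0 q1 = 0"
    and y: "sqnorm S y \<le> 1" "sqnorm S y' \<le> 1" "cdot S y y' = 0"
    and z: "sqnorm S z \<le> 1" "sqnorm S z' \<le> 1" "cdot S z z' = 0"
    and nn: "0 \<le> \<alpha>" "0 \<le> \<beta>" "0 \<le> \<gamma>" "0 \<le> \<delta>" "0 \<le> s" "0 \<le> t" "0 \<le> co" "0 \<le> sg"
    and ab: "\<alpha>^2 + \<beta>^2 = (1::real)" and gd: "\<gamma>^2 + \<delta>^2 = (1::real)" and st: "s^2 + t^2 = (1::real)"
    and co: "co^2 = s^2 * \<alpha>^2 + t^2 * \<gamma>^2" and sg: "sg^2 = s^2 * \<beta>^2 + t^2 * \<delta>^2"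
    and u: "u = (\<lambda>i. of_real \<alpha> * y i + of_real \<beta> * y' i)" and v: "v = (\<lambda>i. of_real \<gamma> * z i + of_real \<delta> * z' i)"
  shows "s^2 * ((cmod (cdot S p0 y))^2 + (cmod (cdot S p1 y))^2) + t^2 * ((cmod (cdot S q0 z))^2 + (cmod (cdot S q1 z))^2)
    - 2 * s * t * Re (cnj (cdot S p0 u) * cdot S q0 v + cnj (cdot S p1 u) * cdot S q1 v) \<le> 1/2 + (co + sg) / 2"
proof -
  define g where "g = cdot S p0 p1"
  obtain f where f: "cmod f = 1" "f * g = of_real (cmod g)" using ex_unimodular by blast
  have ff: "f * cnj f = 1" "cnj f * f = 1" using f(1) by (simp_all add: complex_norm_square[symmetric] mult.commute)
  define \<kappa> where "\<kappa> = cmod g"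
  define P1 where "P1 = (\<lambda>i. f * p1 i)"
  define Q1 where "Q1 = (\<lambda>i. f * q1 i)"
  have sqP: "sqnorm S P1 = 1/2" "sqnorm S Q1 = 1/2" unfolding P1_def Q1_def sqnorm_scale using f half by auto
  have gq: "cdot S q0 q1 = - g" using opq by (simp add: g_def add_eq_0_iff)
  have dp: "cdot S p0 P1 = of_real \<kappa>" "cdot S q0 Q1 = of_real (- \<kappa>)"
    unfolding P1_def Q1_def cdot_scale_right gq g_def[symmetric] using f by (auto simp: \<kappa>_def)
  have dp': "cdot S P1 p0 = of_real \<kappa>" "cdot S Q1 q0 = of_real (- \<kappa>)"
    using cdot_commute[of S P1 p0] cdot_commute[of S Q1 q0] dp by auto
  have "\<kappa>^2 \<le> (1/2)^2" using cdot_cauchy_schwarz[of S p0 p1] half unfolding \<kappa>_def g_def by (simp add: power2_eq_square)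
  then have \<kappa>: "\<kappa> \<le> 1/2" by (rule power2_le_imp_le) simp
  have \<kappa>0: "0 \<le> \<kappa>" by (simp add: \<kappa>_def)
  define c where "c = sqrt (1/2 + \<kappa>)"
  define d where "d = sqrt (1/2 - \<kappa>)"
  have c2: "c^2 = 1/2 + \<kappa>" and d2: "d^2 = 1/2 - \<kappa>" and cd0: "0 \<le> c" "0 \<le> d"
    using \<kappa> \<kappa>0 by (auto simp: c_def d_def)
  define r where "r = sqrt (1/2)"
  have r2: "r^2 = 1/2" and r0: "0 \<le> r" by (auto simp: r_def)
  \<comment> \<open>The overlap of \<open>p0\<close> and \<open>P1\<close> is real and their norms
    agree, so sum and difference are orthogonal: they diagonalise the block. In the other block the
    overlap has the opposite sign, so there the sum has norm \<open>d\<close> and the difference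
    norm \<open>c\<close>.\<close>
  define a1 where "a1 = (\<lambda>i. of_real r * (p0 i + P1 i))"
  define a2 where "a2 = (\<lambda>i. of_real r * (p0 i - P1 i))"
  define b1 where "b1 = (\<lambda>i. of_real r * (q0 i + Q1 i))"
  define b2 where "b2 = (\<lambda>i. of_real r * (q0 i - Q1 i))"
  have sqd: "sqnorm S (\<lambda>i. x i - w i) = sqnorm S x + sqnorm S w - 2 * Re (cdot S x w)" for x w :: "'i \<Rightarrow> complex"
    using sqnorm_add[of S x "\<lambda>i. (-1) * w i"] unfolding cdot_scale_right sqnorm_scale by simp
  have sqa: "sqnorm S a1 = c^2" "sqnorm S a2 = d^2" "sqnorm S b1 = d^2" "sqnorm S b2 = c^2"
    unfolding a1_def a2_def b1_def b2_def sqnorm_scale sqnorm_add sqd dp half sqP c2 d2 using r2 by (auto simp: field_simps)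
  have oa: "cdot S a1 a2 = 0" "cdot S b1 b2 = 0"
    unfolding a1_def a2_def b1_def b2_def cdot_bilinear cdot_self dp dp' half sqP by (auto simp: algebra_simps)
  define f1 where "f1 = (\<lambda>i. of_real (1 / c) * a1 i)"
  define f2 where "f2 = (\<lambda>i. of_real (1 / d) * a2 i)"
  define h1 where "h1 = (\<lambda>i. of_real (1 / d) * b1 i)"
  define h2 where "h2 = (\<lambda>i. of_real (1 / c) * b2 i)"
  \<comment> \<open>When \<open>\<kappa> = 1/2\<close>, \<open>d\<close> vanishes and the normalised
    vectors \<open>f2\<close>, \<open>h1\<close> are 0. The bounds by 1 and the relation
    \<open>bck\<close> survive this case.\<close>
  have nrm: "sqnorm S (\<lambda>i. of_real (1 / x) * w i) \<le> 1" if "sqnorm S w = x^2" for x :: real and w :: "'i \<Rightarrow> complex"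
    unfolding sqnorm_scale that by (cases "x = 0") (auto simp: power_divide norm_divide)
  have bck: "of_real x * cdot S (\<lambda>i. of_real (1 / x) * w i) l = cdot S w l"
    if "sqnorm S w = x^2" for x :: real and w l :: "'i \<Rightarrow> complex"
  proof (cases "x = 0")
    case True
    then have "cdot S w l = 0" unfolding cdot_def using sqnorm_zeroD[OF S] that by (simp add: sum.neutral)
    then show ?thesis using True by simp
  next
    case False
    show ?thesis unfolding cdot_scale_left using False by simp
  qed
  have nf: "sqnorm S f1 \<le> 1" "sqnorm S f2 \<le> 1" "sqnorm S h1 \<le> 1" "sqnorm S h2 \<le> 1"
    unfolding f1_def f2_def h1_def h2_def by (rule nrm, rule sqa)+
  have orf: "cdot S f1 f2 = 0" "cdot S h1 h2 = 0" unfolding f1_def f2_def h1_def h2_def cdot_scale_left cdot_scale_right oa by auto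
  note bk = bck[OF sqa(1), folded f1_def] bck[OF sqa(2), folded f2_def] bck[OF sqa(3), folded h1_def] bck[OF sqa(4), folded h2_def]
  have ce: "cdot S a1 l = of_real r * (cdot S p0 l + cnj f * cdot S p1 l)" "cdot S a2 l = of_real r * (cdot S p0 l - cnj f * cdot S p1 l)"
      "cdot S b1 l = of_real r * (cdot S q0 l + cnj f * cdot S q1 l)" "cdot S b2 l = of_real r * (cdot S q0 l - cnj f * cdot S q1 l)" for l
    unfolding a1_def a2_def b1_def b2_def P1_def Q1_def cdot_bilinear by auto
  have par: "(cmod (of_real r * (x + cnj f * w)))^2 + (cmod (of_real r * (x - cnj f * w)))^2 = (cmod x)^2 + (cmod w)^2" for x w
  proof -
    have "(cmod (of_real r * (x + l)))^2 + (cmod (of_real r * (x - l)))^2 = (cmod x)^2 + (cmod l)^2" for l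
      unfolding norm_mult power_mult_distrib norm_of_real power2_abs r2 cmod_power2
      by (simp add: power2_eq_square algebra_simps)
    from this[of "cnj f * w"] show ?thesis using f by (simp add: norm_mult)
  qed
  have par': "cnj (of_real r * (x + cnj f * w)) * (of_real r * (x' + cnj f * w')) + cnj (of_real r * (x - cnj f * w)) * (of_real r * (x' - cnj f * w'))
     = cnj x * x' + cnj w * w'" for x w x' w'
  proof -
    have "cnj (of_real r * (x + cnj f * w)) * (of_real r * (x' + cnj f * w')) + cnj (of_real r * (x - cnj f * w)) * (of_real r * (x' - cnj f * w'))
     = 2 * of_real (r^2) * (cnj x * x' + (f * cnj f) * (cnj w * w'))"
      by (simp add: power2_eq_square algebra_simps)
    then show ?thesis unfolding ff r2 by simp
  qed
  have sc: "(cmod (of_real x * w))^2 = x^2 * (cmod w)^2" for x w by (simp add: norm_mult power_mult_distrib)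
  define u1 where "u1 = cdot S f1 u"
  define u2 where "u2 = cdot S f2 u"
  define v1 where "v1 = cdot S h1 v"
  define v2 where "v2 = cdot S h2 v"
  have main: "s^2 * (c^2 * (cmod (cdot S f1 y))^2 + d^2 * (cmod (cdot S f2 y))^2)
      + t^2 * (d^2 * (cmod (cdot S h1 z))^2 + c^2 * (cmod (cdot S h2 z))^2)
      + 2 * s * t * (c * d) * cmod (cnj u1 * v1 + cnj u2 * v2) \<le> 1/2 + (co + sg) / 2"
    by (rule balanced_pair_bound[OF contraction2_frame[OF nf(1,2) orf(1) y] contraction2_frame[OF nf(3,4) orf(2) z]
        nn(1-6) cd0 nn(7,8) ab gd st _ co sg])
      (auto simp: c2 d2 u1_def u2_def v1_def v2_def u v cdot_bilinear)
  have A: "c^2 * (cmod (cdot S f1 y))^2 + d^2 * (cmod (cdot S f2 y))^2 = (cmod (cdot S p0 y))^2 + (cmod (cdot S p1 y))^2"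
    unfolding sc[symmetric] bk ce par ..
  have B: "d^2 * (cmod (cdot S h1 z))^2 + c^2 * (cmod (cdot S h2 z))^2 = (cmod (cdot S q0 z))^2 + (cmod (cdot S q1 z))^2"
    unfolding sc[symmetric] bk ce par ..
  have C: "of_real (c * d) * (cnj u1 * v1 + cnj u2 * v2) = cnj (cdot S p0 u) * cdot S q0 v + cnj (cdot S p1 u) * cdot S q1 v"
  proof -
    have "of_real (c * d) * (cnj u1 * v1 + cnj u2 * v2)
      = cnj (of_real c * u1) * (of_real d * v1) + cnj (of_real d * u2) * (of_real c * v2)" by (simp add: algebra_simps)
    then show ?thesis unfolding u1_def u2_def v1_def v2_def bk ce par' .
  qed
  have "- Re (cnj (cdot S p0 u) * cdot S q0 v + cnj (cdot S p1 u) * cdot S q1 v) \<le> (c * d) * cmod (cnj u1 * v1 + cnj u2 * v2)"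
  proof -
    have "- Re X \<le> cmod X" for X using abs_Re_le_cmod[of X] by linarith
    from this[of "of_real (c * d) * (cnj u1 * v1 + cnj u2 * v2)"] show ?thesis
      unfolding C[symmetric] norm_mult norm_of_real using cd0 by simp
  qed
  then have "2 * s * t * (- Re (cnj (cdot S p0 u) * cdot S q0 v + cnj (cdot S p1 u) * cdot S q1 v))
      \<le> 2 * s * t * ((c * d) * cmod (cnj u1 * v1 + cnj u2 * v2))"
    using nn by (intro mult_left_mono) auto
  then show ?thesis using main unfolding A B by (simp add: algebra_simps)
qed

text \<open>The vectors \<open>y\<close>, \<open>z\<close> are later taken to be lowest eigenvectors
  of the diagonal blocks, while \<open>u\<close>, \<open>v\<close> probe the off-diagonal block.
  They are therefore left unrelated, and \<open>unit_pair_decomposition\<close> produces the angles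
  between them.\<close>

lemma block_witness_nonneg:
  fixes p q :: "'k \<Rightarrow> nat \<Rightarrow> complex" and lam :: "'k \<Rightarrow> real"
  assumes K: "finite K" "k0 \<in> K" "k1 \<in> K" "k0 \<noteq> k1" and S: "finite S"
    and pp: "\<And>i j. i \<in> S \<Longrightarrow> j \<in> S \<Longrightarrow> (\<Sum>k\<in>K. p k i * cnj (p k j)) = (if i = j then 1 else 0)"
    and qq: "\<And>i j. i \<in> S \<Longrightarrow> j \<in> S \<Longrightarrow> (\<Sum>k\<in>K. q k i * cnj (q k j)) = (if i = j then 1 else 0)"
    and pq: "\<And>i j. i \<in> S \<Longrightarrow> j \<in> S \<Longrightarrow> (\<Sum>k\<in>K. p k i * cnj (q k j)) = 0"
    and half: "sqnorm S (p k0) = 1/2" "sqnorm S (p k1) = 1/2" "sqnorm S (q k0) = 1/2" "sqnorm S (q k1) = 1/2"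
    and opq: "cdot S (p k0) (p k1) + cdot S (q k0) (q k1) = 0"
    and ev: "lam k0 = a" "lam k1 = b" "0 \<le> a" "a \<le> b" "b \<le> c" "c \<le> L" "b \<le> L"
    and rest: "\<And>k. k \<in> K - {k0, k1} \<Longrightarrow> c \<le> lam k \<and> lam k \<le> L"
    and spec: "(L - b)^2 \<le> 4 * a * c"
    and unit: "sqnorm S y = 1" "sqnorm S u = 1" "sqnorm S z = 1" "sqnorm S v = 1"
    and st: "0 \<le> s" "0 \<le> t" "s^2 + t^2 = (1::real)"
  shows "2 * s * t * Re (\<Sum>k\<in>K. of_real (lam k) * (cnj (cdot S (p k) u) * cdot S (q k) v))
     \<le> s^2 * (\<Sum>k\<in>K. lam k * (cmod (cdot S (p k) y))^2) + t^2 * (\<Sum>k\<in>K. lam k * (cmod (cdot S (q k) z))^2)"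
proof -
  obtain e y' \<alpha> \<beta> where Y: "cmod e = 1" "0 \<le> \<alpha>" "0 \<le> \<beta>" "\<alpha>^2 + \<beta>^2 = 1"
    "\<forall>i\<in>S. u i = of_real \<alpha> * (e * y i) + of_real \<beta> * y' i" "cdot S (\<lambda>i. e * y i) y' = 0" "sqnorm S y' \<le> 1"
    using unit_pair_decomposition[OF S unit(1,2)] by blast
  obtain f z' \<gamma> \<delta> where Z: "cmod f = 1" "0 \<le> \<gamma>" "0 \<le> \<delta>" "\<gamma>^2 + \<delta>^2 = 1"
    "\<forall>i\<in>S. v i = of_real \<gamma> * (f * z i) + of_real \<delta> * z' i" "cdot S (\<lambda>i. f * z i) z' = 0" "sqnorm S z' \<le> 1"
    using unit_pair_decomposition[OF S unit(3,4)] by blast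
  define yt where "yt = (\<lambda>i. e * y i)"
  define zt where "zt = (\<lambda>i. f * z i)"
  define ut where "ut = (\<lambda>i. of_real \<alpha> * yt i + of_real \<beta> * y' i)"
  define vt where "vt = (\<lambda>i. of_real \<gamma> * zt i + of_real \<delta> * z' i)"
  have ut: "cdot S x ut = cdot S x u" and vt: "cdot S x vt = cdot S x v" for x
    using Y(5) Z(5) by (auto intro!: cdot_cong simp: ut_def vt_def yt_def zt_def)
  have yt: "sqnorm S yt = 1" "cdot S yt y' = 0" and zt: "sqnorm S zt = 1" "cdot S zt z' = 0"
    unfolding yt_def zt_def sqnorm_scale using Y Z unit by auto
  have ym: "cmod (cdot S x yt) = cmod (cdot S x y)" and zm: "cmod (cdot S x zt) = cmod (cdot S x z)" for x
    unfolding yt_def zt_def cdot_scale_right using Y Z by (auto simp: norm_mult)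
  define sg where "sg = sqrt (s^2 * \<beta>^2 + t^2 * \<delta>^2)"
  define co where "co = sqrt (s^2 * \<alpha>^2 + t^2 * \<gamma>^2)"
  have sg: "0 \<le> sg" "sg^2 = s^2 * \<beta>^2 + t^2 * \<delta>^2" and co: "0 \<le> co" "co^2 = s^2 * \<alpha>^2 + t^2 * \<gamma>^2"
    by (auto simp: sg_def co_def)
  define cp where "cp = (\<lambda>x k. cdot S (p k) x)"
  define cq where "cq = (\<lambda>x k. cdot S (q k) x)"
  define W where "W = (\<lambda>k. s^2 * (cmod (cp yt k))^2 + t^2 * (cmod (cq zt k))^2 - 2 * s * t * Re (cnj (cp ut k) * cq vt k))"
  \<comment> \<open>Passing to coefficient sequences preserves inner products within each block and
    makes the two blocks orthogonal, so the witness can be studied on functions over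
    \<open>K\<close>, where \<open>lam\<close> acts diagonally.\<close>
  have dpp: "cdot K (cp x) (cp w) = cdot S x w" and dqq: "cdot K (cq x) (cq w) = cdot S x w" for x w
    unfolding cp_def cq_def by (rule parseval[OF S pp] parseval[OF S qq]; assumption)+
  have dpq: "cdot K (cp x) (cq w) = 0" for x w
    unfolding cp_def cq_def cdot_sum_frame using pq by (simp add: sum.neutral)
  have dqp: "cdot K (cq x) (cp w) = 0" for x w using cdot_commute[of K "cq x" "cp w"] dpq by simp
  have npp: "sqnorm K (cp x) = sqnorm S x" and nqq: "sqnorm K (cq x) = sqnorm S x" for x
    using dpp[of x x] dqq[of x x] unfolding cdot_self of_real_eq_iff by auto
  have sw: "(cmod (cdot S x w))^2 = (cmod (cdot S w x))^2" for x w
    unfolding cdot_commute[of S x w] by simp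
  have "0 \<le> (\<Sum>k\<in>K. lam k * W k)"
  proof (rule witness_nonneg[where Y = "cp yt" and Y' = "cp y'" and Z = "cq zt" and Z' = "cq z'" and U = "cp ut" and V = "cq vt"
        and s = s and t = t and \<alpha> = \<alpha> and \<beta> = \<beta> and \<gamma> = \<gamma> and \<delta> = \<delta> and \<sigma> = sg and \<tau> = co, OF K _ _ _ _ _ _ _ _ _ _ st(1,2) Y(2,3) Z(2,3) st(3) Y(4) Z(4) sg co _ _ W_def _ _ _ ev _ spec])
    show "cp ut = (\<lambda>k. of_real \<alpha> * cp yt k + of_real \<beta> * cp y' k)"
      unfolding ut_def cp_def cdot_bilinear ..
    show "cq vt = (\<lambda>k. of_real \<gamma> * cq zt k + of_real \<delta> * cq z' k)"
      unfolding vt_def cq_def cdot_bilinear ..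
    show "(cmod (cp yt k0))^2 + (cmod (cp y' k0))^2 \<le> 1/2"
      using bessel2[of S yt y' "p k0"] yt Y(7) half unfolding cp_def sw[of "p k0"] by simp
    show "(cmod (cq zt k0))^2 + (cmod (cq z' k0))^2 \<le> 1/2"
      using bessel2[of S zt z' "q k0"] zt Z(7) half unfolding cq_def sw[of "q k0"] by simp
    have "s^2 * ((cmod (cdot S (p k0) yt))^2 + (cmod (cdot S (p k1) yt))^2) + t^2 * ((cmod (cdot S (q k0) zt))^2 + (cmod (cdot S (q k1) zt))^2)
      - 2 * s * t * Re (cnj (cdot S (p k0) ut) * cdot S (q k0) vt + cnj (cdot S (p k1) ut) * cdot S (q k1) vt) \<le> 1/2 + (co + sg) / 2"
      by (rule balanced_pair_witness[OF S half opq _ Y(7) yt(2) _ Z(7) zt(2) Y(2,3) Z(2,3) st(1,2) co(1) sg(1) Y(4) Z(4) st(3) co(2) sg(2) ut_def vt_def])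
        (use yt zt in auto)
    then show "W k0 + W k1 \<le> 1/2 + (co + sg) / 2"
      unfolding W_def cp_def cq_def plus_complex.simps distrib_left by linarith
  qed (use rest in \<open>auto simp: dpp dqq dpq dqp npp nqq yt zt Y(7) Z(7)\<close>)
  also have "(\<Sum>k\<in>K. lam k * W k) = s^2 * (\<Sum>k\<in>K. lam k * (cmod (cdot S (p k) y))^2) + t^2 * (\<Sum>k\<in>K. lam k * (cmod (cdot S (q k) z))^2)
     - 2 * s * t * Re (\<Sum>k\<in>K. of_real (lam k) * (cnj (cdot S (p k) u) * cdot S (q k) v))"
  proof -
    have "lam k * W k = s^2 * (lam k * (cmod (cdot S (p k) y))^2) + t^2 * (lam k * (cmod (cdot S (q k) z))^2)
       - 2 * s * t * Re (of_real (lam k) * (cnj (cdot S (p k) u) * cdot S (q k) v))" for k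
    proof -
      have r: "Re (of_real (lam k) * x) = lam k * Re x" for x by simp
      show ?thesis unfolding W_def cp_def cq_def ut vt ym zm r by (simp only: algebra_simps)
    qed
    then show ?thesis by (simp only: sum.distrib sum_subtractf sum_distrib_left Re_sum)
  qed
  finally show ?thesis by simp
qed

section \<open>Diagonalisation and dilation\<close>

lemma adj_carrier[simp, intro]: "A \<in> carrier_mat n m \<Longrightarrow> adj A \<in> carrier_mat m n"
  by (simp add: adj_def)

lemma adj_dim[simp]: "dim_row (adj A) = dim_col A" "dim_col (adj A) = dim_row A"
  by (simp_all add: adj_def)

lemma square_mult_carrier: "A \<in> carrier_mat n n \<Longrightarrow> B \<in> carrier_mat n n \<Longrightarrow> A * B \<in> carrier_mat n n"
  by (rule mult_carrier_mat)

lemma square_mult_assoc: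
  "A \<in> carrier_mat n n \<Longrightarrow> B \<in> carrier_mat n n \<Longrightarrow> C \<in> carrier_mat n n \<Longrightarrow> A * B * C = A * (B * C)"
  by (rule assoc_mult_mat)

lemma mat_diag_carrier: "mat_diag n d \<in> carrier_mat n n"
  by (simp add: mat_diag_def)

lemmas square_mat = square_mult_carrier square_mult_assoc mat_diag_carrier adj_carrier

lemma adj_index[simp]: "A \<in> carrier_mat n m \<Longrightarrow> i < m \<Longrightarrow> j < n \<Longrightarrow> adj A $$ (i, j) = cnj (A $$ (j, i))"
  by (simp add: adj_def)

lemma adj_adj[simp]: "adj (adj A) = A"
  by (rule eq_matI) (auto simp: adj_def)

lemma mult_index_sum:
  "A \<in> carrier_mat n m \<Longrightarrow> B \<in> carrier_mat m l \<Longrightarrow> i < n \<Longrightarrow> j < l \<Longrightarrow> (A * B) $$ (i, j) = (\<Sum>k<m. A $$ (i, k) * B $$ (k, j))"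
  by (auto simp: scalar_prod_def atLeast0LessThan)

lemma adj_mult: "A \<in> carrier_mat n m \<Longrightarrow> B \<in> carrier_mat m l \<Longrightarrow> adj (A * B) = adj B * adj A"
  by (rule eq_matI) (auto simp: adj_def scalar_prod_def mult.commute)

lemma mult_adj_index: "A \<in> carrier_mat n m \<Longrightarrow> B \<in> carrier_mat l m \<Longrightarrow> i < n \<Longrightarrow> j < l
    \<Longrightarrow> (A * adj B) $$ (i, j) = (\<Sum>k<m. A $$ (i, k) * cnj (B $$ (j, k)))"
  by (subst mult_index_sum[of _ n m _ l]) auto

lemma adj_mult_index: "A \<in> carrier_mat m n \<Longrightarrow> B \<in> carrier_mat m l \<Longrightarrow> i < n \<Longrightarrow> j < l
    \<Longrightarrow> (adj A * B) $$ (i, j) = (\<Sum>k<m. cnj (A $$ (k, i)) * B $$ (k, j))"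
  by (subst mult_index_sum[of _ n m _ l]) auto

lemma unitary_matI: "U \<in> carrier_mat n n \<Longrightarrow> U * adj U = 1\<^sub>m n \<Longrightarrow> unitary_mat n U"
  unfolding unitary_mat_def using mat_mult_left_right_inverse[of U n "adj U"] by auto

lemma unitary_matD:
  assumes "unitary_mat n U"
  shows "U \<in> carrier_mat n n" "U * adj U = 1\<^sub>m n" "adj U * U = 1\<^sub>m n"
  using assms by (auto simp: unitary_mat_def)

lemma unitary_mat_rows: "unitary_mat n U \<Longrightarrow> i < n \<Longrightarrow> j < n \<Longrightarrow> (\<Sum>k<n. U $$ (i, k) * cnj (U $$ (j, k))) = (if i = j then 1 else 0)"
  using mult_adj_index[of U n n U n i j] unitary_matD[of n U] by simp

lemma unitary_mat_cols: "unitary_mat n U \<Longrightarrow> i < n \<Longrightarrow> j < n \<Longrightarrow> (\<Sum>k<n. cnj (U $$ (k, i)) * U $$ (k, j)) = (if i = j then 1 else 0)"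
  using adj_mult_index[of U n n U n i j] unitary_matD[of n U] by simp

lemma unitary_mat_adj: "unitary_mat n U \<Longrightarrow> unitary_mat n (adj U)"
  unfolding unitary_mat_def by auto

lemma unitary_mat_mult:
  assumes U: "unitary_mat n U" and V: "unitary_mat n V"
  shows "unitary_mat n (U * V)"
proof (rule unitary_matI)
  note u = unitary_matD[OF U] and v = unitary_matD[OF V]
  show "U * V \<in> carrier_mat n n" using u v by auto
  have "U * V * adj (U * V) = U * (V * adj V) * adj U"
    using u(1) v(1) by (simp add: adj_mult[of U n n V n] square_mat[where n = "n"])
  then show "U * V * adj (U * V) = 1\<^sub>m n" using u v by simp
qed

section \<open>Spectral theorem for normal matrices\<close>

definition conj_diag :: "nat \<Rightarrow> complex mat \<Rightarrow> (nat \<Rightarrow> complex) \<Rightarrow> complex mat" where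
  "conj_diag n U d = U * mat_diag n d * adj U"

lemma conj_diag_carrier: "U \<in> carrier_mat n n \<Longrightarrow> conj_diag n U d \<in> carrier_mat n n"
  unfolding conj_diag_def by (intro mult_carrier_mat[of _ n n]) auto

lemma conj_diag_index:
  assumes U: "U \<in> carrier_mat n n" and ij: "i < n" "j < n"
  shows "conj_diag n U d $$ (i, j) = (\<Sum>k<n. d k * U $$ (i, k) * cnj (U $$ (j, k)))"
proof -
  have "U * mat_diag n d = mat n n (\<lambda>(i, j). U $$ (i, j) * d j)"
    by (rule mat_diag_mult_right[OF U])
  then show ?thesis unfolding conj_diag_def using U ij
    by (subst mult_adj_index[of _ n n _ n]) (auto intro!: sum.cong)
qed

lemma adj_conj_diag: "U \<in> carrier_mat n n \<Longrightarrow> adj (conj_diag n U d) = conj_diag n U (\<lambda>k. cnj (d k))"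
  by (rule eq_matI)
    (auto simp: conj_diag_index ac_simps adj_index[OF conj_diag_carrier] carrier_matD[OF conj_diag_carrier])

lemma conj_diag_mult:
  assumes U: "unitary_mat n U"
  shows "conj_diag n U d * conj_diag n U e = conj_diag n U (\<lambda>k. d k * e k)"
proof -
  note u = unitary_matD[OF U]
  have "conj_diag n U d * conj_diag n U e = U * mat_diag n d * (adj U * U) * mat_diag n e * adj U"
    unfolding conj_diag_def using u(1) by (simp add: square_mat[where n = "n"])
  also have "\<dots> = U * (mat_diag n d * mat_diag n e) * adj U" unfolding u(3) using u(1)
    by (simp add: square_mat[where n = "n"] right_mult_one_mat[of _ n n])
  finally show ?thesis unfolding conj_diag_def by (simp add: mat_diag_diag)
qed

lemma conj_diag_one: "unitary_mat n U \<Longrightarrow> conj_diag n U (\<lambda>_. 1) = 1\<^sub>m n"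
  unfolding conj_diag_def using unitary_matD[of n U] by (simp add: mat_diag_one)

lemma conj_diag_inject:
  assumes U: "unitary_mat n U" and e: "conj_diag n U d = conj_diag n U e" and k: "k < n"
  shows "d k = e k"
proof -
  note u = unitary_matD[OF U]
  have "adj U * conj_diag n U d * U = (adj U * U) * mat_diag n d * (adj U * U)" for d
    unfolding conj_diag_def using u(1) by (simp add: square_mat[where n = "n"])
  then have *: "adj U * conj_diag n U d * U = mat_diag n d" for d unfolding u(3)
    by (simp add: right_mult_one_mat[of _ n n] left_mult_one_mat[of _ n n])
  have "mat_diag n d $$ (k, k) = mat_diag n e $$ (k, k)" using *[of d] *[of e] e by simp
  then show ?thesis using k by (simp add: mat_diag_def)
qed

text \<open>The reflection along \<open>w\<close>, the difference of \<open>e * v\<close> and the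
  first basis vector. It exchanges two unit vectors only if their overlap is real, which is what the
  phase \<open>e\<close> achieves.\<close>

lemma householder:
  fixes v :: "nat \<Rightarrow> complex"
  assumes n: "0 < n" and v: "(\<Sum>i<n. (cmod (v i))^2) = 1"
  shows "\<exists>H e. unitary_mat n H \<and> cmod e = 1 \<and> (\<forall>i<n. H $$ (i, 0) = e * v i)"
proof -
  obtain e where e: "cmod e = 1" "e * v 0 = of_real (cmod (v 0))" using ex_unimodular by blast
  define w where "w = (\<lambda>i. e * v i - (if i = 0 then 1 else 0))"
  define r where "r = sqnorm {..<n} w"
  \<comment> \<open>If \<open>r = 0\<close>, then \<open>e * v\<close> already is the first basis
    vector; division by zero makes \<open>\<kappa> = 0\<close> and \<open>H\<close> the
    identity.\<close>
  define \<kappa> where "\<kappa> = complex_of_real (2 / r)"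
  define H where "H = mat n n (\<lambda>(i, j). (if i = j then 1 else 0) - \<kappa> * w i * cnj (w j))"
  have Hc: "H \<in> carrier_mat n n" by (simp add: H_def)
  have ww: "(\<Sum>k<n. cnj (w k) * w k) = of_real r"
    using cdot_self[of "{..<n}" w] by (simp add: r_def cdot_def)
  have kr: "\<kappa> * \<kappa> * of_real r = 2 * \<kappa>" unfolding \<kappa>_def by (cases "r = 0") (auto simp: field_simps)
  have "H * adj H = 1\<^sub>m n"
  proof (rule eq_matI)
    fix i j assume "i < dim_row (1\<^sub>m n :: complex mat)" "j < dim_col (1\<^sub>m n :: complex mat)"
    then have ij: "i < n" "j < n" by auto
    have ck: "cnj \<kappa> = \<kappa>" by (simp add: \<kappa>_def)
    have "(H * adj H) $$ (i, j) = (\<Sum>k<n. H $$ (i, k) * cnj (H $$ (j, k)))"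
      by (rule mult_adj_index[OF Hc Hc ij])
    also have "\<dots> = (\<Sum>k<n. (if k = i then (if i = j then 1 else 0) else 0)
        - (if k = i then \<kappa> * w i * cnj (w j) else 0) - (if k = j then \<kappa> * w i * cnj (w j) else 0)
        + \<kappa> * \<kappa> * w i * cnj (w j) * (cnj (w k) * w k))"
      using ij by (intro sum.cong refl) (auto simp: H_def ck algebra_simps)
    also have "\<dots> = (if i = j then 1 else 0) - 2 * (\<kappa> * w i * cnj (w j)) + w i * cnj (w j) * (\<kappa> * \<kappa> * of_real r)"
      using ij by (simp add: sum.distrib sum_subtractf sum_distrib_left[symmetric] ww)
    also have "\<dots> = (if i = j then 1 else 0)" unfolding kr by simp
    finally show "(H * adj H) $$ (i, j) = 1\<^sub>m n $$ (i, j)" using ij by simp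
  qed (use Hc in auto)
  then have H: "unitary_mat n H" by (rule unitary_matI[OF Hc])
  have r: "r = 2 - 2 * cmod (v 0)"
  proof -
    have "r = (\<Sum>i<n. (cmod (v i))^2 + (if i = 0 then 1 - 2 * cmod (v 0) else 0))"
      unfolding r_def sqnorm_def
    proof (intro sum.cong refl)
      fix i
      have "(cmod (of_real (cmod (v 0)) - 1))^2 = (cmod (v 0) - 1)^2"
        by (metis norm_of_real of_real_1 of_real_diff power2_abs)
      then show "(cmod (w i))^2 = (cmod (v i))^2 + (if i = 0 then 1 - 2 * cmod (v 0) else 0)"
        using e by (auto simp: w_def norm_mult power2_eq_square algebra_simps)
    qed
    then show ?thesis using v n by (simp add: sum.distrib)
  qed
  have "H $$ (i, 0) = e * v i" if i: "i < n" for i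
  proof (cases "r = 0")
    case True
    then have "w i = 0" using sqnorm_zeroD[of "{..<n}" w i] i by (simp add: r_def)
    then show ?thesis using i n by (auto simp: H_def w_def)
  next
    case False
    have "cnj (w 0) = of_real (cmod (v 0) - 1)" using e by (simp add: w_def)
    then have "\<kappa> * cnj (w 0) = of_real (2 / r * (cmod (v 0) - 1))" unfolding \<kappa>_def by simp
    also have "2 / r * (cmod (v 0) - 1) = -1" using r False by (simp add: field_simps)
    finally have "\<kappa> * cnj (w 0) = -1" by simp
    moreover have "H $$ (i, 0) = (if i = 0 then 1 else 0) - w i * (\<kappa> * cnj (w 0))"
      using i n by (simp add: H_def ac_simps)
    ultimately have "H $$ (i, 0) = (if i = 0 then 1 else 0) + w i" by simp
    then show ?thesis by (simp add: w_def)
  qed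
  then show ?thesis using H e by blast
qed

text \<open>Normality is the right generality because the result is applied both to Hermitian
  matrices and to the unitary dilation of a contraction. The proof deflates by one eigenvector,
  moved to the first column by a Householder matrix.\<close>

theorem normal_mat_diagonalisation:
  assumes "A \<in> carrier_mat n n" and "A * adj A = adj A * A"
  shows "\<exists>U d. unitary_mat n U \<and> A = conj_diag n U d"
  using assms
proof (induction n arbitrary: A)
  case 0
  then have "A = conj_diag 0 (1\<^sub>m 0) (\<lambda>_. 0)" by (intro eq_matI) (auto simp: conj_diag_def)
  moreover have "unitary_mat 0 (1\<^sub>m 0)" by (intro unitary_matI) (auto intro!: eq_matI)
  ultimately show ?case by blast
next
  case (Suc n)
  let ?N = "Suc n"
  note A = Suc.prems(1)
  obtain \<mu> where "\<mu> \<in> spectrum A" using spectrum_non_empty[OF A] by auto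
  then obtain x where x: "x \<in> carrier_vec ?N" "x \<noteq> 0\<^sub>v ?N" "A *\<^sub>v x = \<mu> \<cdot>\<^sub>v x"
    using A unfolding spectrum_def eigenvalue_def eigenvector_def by auto
  define r where "r = sqnorm {..<?N} (\<lambda>i. x $ i)"
  have "r \<noteq> 0"
  proof
    assume "r = 0"
    then have "x $ i = 0" if "i < ?N" for i using sqnorm_zeroD[of "{..<?N}" "\<lambda>i. x $ i" i] that by (simp add: r_def)
    then have "x = 0\<^sub>v ?N" using x(1) by (intro eq_vecI) auto
    then show False using x by simp
  qed
  then have r: "r > 0" using sqnorm_nonneg[of "{..<?N}" "\<lambda>i. x $ i"] by (simp add: r_def)
  define v where "v = (\<lambda>i. of_real (1 / sqrt r) * x $ i)"
  have "(\<Sum>i<?N. (cmod (v i))^2) = 1"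
    using sqnorm_scale[of "{..<?N}" "of_real (1 / sqrt r)" "\<lambda>i. x $ i"] r
    unfolding sqnorm_def[symmetric] v_def r_def[symmetric] by (simp add: power_divide norm_divide)
  then obtain H e where H: "unitary_mat ?N H" and He: "\<forall>i<?N. H $$ (i, 0) = e * v i"
    using householder[of ?N v] by auto
  note h = unitary_matD[OF H]
  define A' where "A' = adj H * A * H"
  have A': "A' \<in> carrier_mat ?N ?N" using h A by (auto simp: A'_def)
  have AA': "A = H * A' * adj H"
  proof -
    have "H * A' * adj H = (H * adj H) * A * (H * adj H)" unfolding A'_def using h(1) A
      by (simp add: square_mat[where n = "?N"])
    then show ?thesis unfolding h(2) using A by simp
  qed
  have AH: "(A * H) $$ (i, 0) = \<mu> * H $$ (i, 0)" if i: "i < ?N" for i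
  proof -
    have "(A *\<^sub>v x) $ i = \<mu> * x $ i" using x i by simp
    then have e1: "(\<Sum>k<?N. A $$ (i, k) * x $ k) = \<mu> * x $ i"
      using A i x(1) by (simp add: scalar_prod_def atLeast0LessThan)
    have "(A * H) $$ (i, 0) = (\<Sum>k<?N. A $$ (i, k) * (e * v k))"
      using mult_index_sum[OF A h(1) i, of 0] He by simp
    also have "\<dots> = e * of_real (1 / sqrt r) * (\<Sum>k<?N. A $$ (i, k) * x $ k)"
      by (simp only: v_def sum_distrib_left ac_simps)
    finally show ?thesis using He i unfolding e1 by (simp add: v_def)
  qed
  have col: "A' $$ (i, 0) = (if i = 0 then \<mu> else 0)" if i: "i < ?N" for i
  proof -
    have "A' = adj H * (A * H)" unfolding A'_def using h(1) A by (simp add: square_mat[where n = "?N"])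
    then have "A' $$ (i, 0) = (\<Sum>k<?N. cnj (H $$ (k, i)) * (A * H) $$ (k, 0))"
      using adj_mult_index[of H ?N ?N "A * H" ?N i 0] h(1) A i by simp
    also have "\<dots> = \<mu> * (\<Sum>k<?N. cnj (H $$ (k, i)) * H $$ (k, 0))" using AH by (simp add: sum_distrib_left ac_simps del: sum.lessThan_Suc)
    finally show ?thesis using unitary_mat_cols[OF H i, of 0] by simp
  qed
  have normal: "A' * adj A' = adj A' * A'"
  proof -
    have aA: "adj A' = adj H * adj A * H" unfolding A'_def using h(1) A
      by (simp add: adj_mult[of _ ?N ?N _ ?N] square_mat[where n = "?N"])
    have "A' * adj A' = adj H * A * (H * adj H) * adj A * H" unfolding aA unfolding A'_def using h(1) A
      by (simp add: square_mat[where n = "?N"])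
    also have "\<dots> = adj H * (A * adj A) * H" unfolding h(2) using h(1) A
      by (simp add: square_mat[where n = "?N"] right_mult_one_mat[of _ ?N ?N])
    also have "\<dots> = adj H * adj A * (H * adj H) * A * H" unfolding h(2) Suc.prems(2) using h(1) A
      by (simp add: square_mat[where n = "?N"] right_mult_one_mat[of _ ?N ?N])
    also have "\<dots> = adj A' * A'" unfolding aA unfolding A'_def using h(1) A
      by (simp add: square_mat[where n = "?N"])
    finally show ?thesis .
  qed
  \<comment> \<open>A normal matrix has a first row and a first column of equal norm. The column
    contributes only \<open>\<mu>\<close>, which also is the corner of the row, so nothing is left
    for the rest of the row.\<close>
  have row: "A' $$ (0, Suc j) = 0" if j: "j < n" for j
  proof -
    have "(A' * adj A') $$ (0, 0) = (\<Sum>k<?N. A' $$ (0, k) * cnj (A' $$ (0, k)))"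
      by (rule mult_adj_index[OF A' A']) auto
    also have "\<dots> = \<mu> * cnj \<mu> + (\<Sum>k<n. A' $$ (0, Suc k) * cnj (A' $$ (0, Suc k)))"
      unfolding sum.lessThan_Suc_shift using col[of 0] by simp
    finally have 1: "(A' * adj A') $$ (0, 0) = \<mu> * cnj \<mu> + (\<Sum>k<n. A' $$ (0, Suc k) * cnj (A' $$ (0, Suc k)))" .
    have "(adj A' * A') $$ (0, 0) = (\<Sum>k<?N. cnj (A' $$ (k, 0)) * A' $$ (k, 0))"
      by (rule adj_mult_index[OF A' A']) auto
    also have "\<dots> = \<mu> * cnj \<mu>" unfolding sum.lessThan_Suc_shift using col by simp
    finally have "(\<Sum>k<n. A' $$ (0, Suc k) * cnj (A' $$ (0, Suc k))) = 0" using 1 normal by simp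
    then have "of_real (sqnorm {..<n} (\<lambda>k. A' $$ (0, Suc k))) = (0 :: complex)"
      unfolding cdot_self[symmetric] cdot_def by (simp add: mult.commute)
    then show ?thesis using sqnorm_zeroD[of "{..<n}" "\<lambda>k. A' $$ (0, Suc k)" j] j by simp
  qed
  define B where "B = mat n n (\<lambda>(i, j). A' $$ (Suc i, Suc j))"
  have B: "B \<in> carrier_mat n n" by (simp add: B_def)
  have "B * adj B = adj B * B"
  proof (rule eq_matI)
    fix i j assume "i < dim_row (adj B * B)" "j < dim_col (adj B * B)"
    then have ij: "i < n" "j < n" using B by auto
    have "(B * adj B) $$ (i, j) = (A' * adj A') $$ (Suc i, Suc j)"
      using mult_adj_index[OF B B ij] mult_adj_index[OF A' A', of "Suc i" "Suc j"] ij col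
      by (simp add: B_def sum.lessThan_Suc_shift del: sum.lessThan_Suc)
    moreover have "(adj B * B) $$ (i, j) = (adj A' * A') $$ (Suc i, Suc j)"
      using adj_mult_index[OF B B ij] adj_mult_index[OF A' A', of "Suc i" "Suc j"] ij row
      by (simp add: B_def sum.lessThan_Suc_shift del: sum.lessThan_Suc)
    ultimately show "(B * adj B) $$ (i, j) = (adj B * B) $$ (i, j)" using normal by simp
  qed (use B in auto)
  then obtain V d where V: "unitary_mat n V" and Bd: "B = conj_diag n V d" using Suc.IH[OF B] by blast
  define V' where "V' = mat ?N ?N (\<lambda>(i, j). if i = 0 then if j = 0 then 1 else 0 else if j = 0 then 0 else V $$ (i - 1, j - 1))"
  define d' where "d' = (\<lambda>k. if k = 0 then \<mu> else d (k - 1))"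
  have V'c: "V' \<in> carrier_mat ?N ?N" by (simp add: V'_def)
  have V': "unitary_mat ?N V'"
  proof (rule unitary_matI[OF V'c], rule eq_matI)
    fix i j assume "i < dim_row (1\<^sub>m ?N :: complex mat)" "j < dim_col (1\<^sub>m ?N :: complex mat)"
    then have ij: "i < ?N" "j < ?N" by auto
    have "(V' * adj V') $$ (i, j) = (\<Sum>k<?N. V' $$ (i, k) * cnj (V' $$ (j, k)))" by (rule mult_adj_index[OF V'c V'c ij])
    also have "\<dots> = 1\<^sub>m ?N $$ (i, j)"
      using ij unitary_mat_rows[OF V, of "i - 1" "j - 1"]
      by (cases i; cases j) (auto simp: V'_def sum.lessThan_Suc_shift simp del: sum.lessThan_Suc)
    finally show "(V' * adj V') $$ (i, j) = 1\<^sub>m ?N $$ (i, j)" .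
  qed (auto simp: V'_def adj_def)
  have "A' = conj_diag ?N V' d'"
  proof (rule eq_matI)
    fix i j assume "i < dim_row (conj_diag ?N V' d')" "j < dim_col (conj_diag ?N V' d')"
    then have ij: "i < ?N" "j < ?N" using conj_diag_carrier[OF V'c, of d'] by (auto)
    have "A' $$ (Suc i, Suc j) = (\<Sum>k<n. d k * V $$ (i, k) * cnj (V $$ (j, k)))" if "i < n" "j < n" for i j
    proof -
      have "A' $$ (Suc i, Suc j) = B $$ (i, j)" using that by (simp add: B_def)
      then show ?thesis unfolding Bd conj_diag_index[OF unitary_matD(1)[OF V] that] .
    qed
    then show "A' $$ (i, j) = conj_diag ?N V' d' $$ (i, j)"
      unfolding conj_diag_index[OF V'c ij] using ij col row
      by (cases i; cases j) (auto simp: V'_def d'_def sum.lessThan_Suc_shift simp del: sum.lessThan_Suc)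
  qed (use A' carrier_matD[OF conj_diag_carrier[OF V'c, of d']] in \<open>auto\<close>)
  then have "A = conj_diag ?N (H * V') d'"
    unfolding AA' conj_diag_def using h(1) V'c
    by (simp add: adj_mult[of H ?N ?N V' ?N] square_mat[where n = "?N"])
  then show ?case using unitary_mat_mult[OF H V'] by blast
qed

section \<open>Functions of Hermitian matrices and dilation of contractions\<close>

lemma conj_diag_cancel:
  assumes U: "unitary_mat n U"
  shows "adj U * conj_diag n U d * U = mat_diag n d"
proof -
  note u = unitary_matD[OF U]
  have "adj U * conj_diag n U d * U = (adj U * U) * mat_diag n d * (adj U * U)"
    unfolding conj_diag_def using u(1) by (simp add: square_mat[where n = n])
  then show ?thesis unfolding u(3) by (simp add: right_mult_one_mat[of _ n n] left_mult_one_mat[of _ n n])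
qed

lemma conj_diag_add:
  assumes U: "U \<in> carrier_mat n n"
  shows "conj_diag n U d + conj_diag n U e = conj_diag n U (\<lambda>k. d k + e k)"
  by (rule eq_matI) (auto simp: conj_diag_index[OF U] carrier_matD[OF conj_diag_carrier[OF U]] algebra_simps sum.distrib)

text \<open>Between the two eigenbases the relation reads
  \<open>G $$ (i, j) * d j = d' i * G $$ (i, j)\<close>: wherever \<open>G\<close> does not vanish
  the eigenvalues agree, hence so do their images under an arbitrary \<open>f\<close>. With a square
  root for \<open>f\<close> this moves \<open>K\<close> past the defect operators of the
  dilation.\<close>

lemma conj_diag_intertwine:
  assumes U: "unitary_mat n U" and V: "unitary_mat n V" and K: "K \<in> carrier_mat n n"
    and e: "K * conj_diag n U d = conj_diag n V d' * K"
  shows "K * conj_diag n U (\<lambda>k. f (d k)) = conj_diag n V (\<lambda>k. f (d' k)) * K"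
proof -
  note u = unitary_matD[OF U] and v = unitary_matD[OF V]
  define G where "G = adj V * K * U"
  have G: "G \<in> carrier_mat n n" using u v K by (simp add: G_def square_mat)
  have l: "adj V * (K * conj_diag n U c) * U = G * mat_diag n c" for c
  proof -
    have "adj V * (K * conj_diag n U c) * U = G * mat_diag n c * (adj U * U)"
      unfolding conj_diag_def G_def using u(1) v(1) K by (simp add: square_mat[where n = n])
    then show ?thesis unfolding u(3) using G by (simp add: right_mult_one_mat[of _ n n] square_mat[where n = n])
  qed
  have r: "adj V * (conj_diag n V c * K) * U = mat_diag n c * G" for c
  proof -
    have "adj V * (conj_diag n V c * K) * U = (adj V * V) * mat_diag n c * G"
      unfolding conj_diag_def G_def using u(1) v(1) K by (simp add: square_mat[where n = n])
    then show ?thesis unfolding v(3) by (simp add: left_mult_one_mat[of _ n n] square_mat[where n = n])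
  qed
  have gd: "G * mat_diag n c = mat n n (\<lambda>(i, j). G $$ (i, j) * c j)" "mat_diag n c * G = mat n n (\<lambda>(i, j). c i * G $$ (i, j))" for c
    by (rule mat_diag_mult_right[OF G], rule mat_diag_mult_left[OF G])
  have gd': "G $$ (i, j) * d j = d' i * G $$ (i, j)" if "i < n" "j < n" for i j
  proof -
    have "mat n n (\<lambda>(i, j). G $$ (i, j) * d j) $$ (i, j) = mat n n (\<lambda>(i, j). d' i * G $$ (i, j)) $$ (i, j)"
      using l[of d] r[of d'] e gd by simp
    then show ?thesis using that by simp
  qed
  have "G $$ (i, j) * f (d j) = f (d' i) * G $$ (i, j)" if "i < n" "j < n" for i j
    using gd'[OF that] by (cases "G $$ (i, j) = 0") (auto simp: mult.commute)
  then have "G * mat_diag n (\<lambda>k. f (d k)) = mat_diag n (\<lambda>k. f (d' k)) * G"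
    unfolding gd by (intro eq_matI) auto
  then have eq: "adj V * (K * conj_diag n U (\<lambda>k. f (d k))) * U = adj V * (conj_diag n V (\<lambda>k. f (d' k)) * K) * U"
    unfolding l r .
  have inv: "V * (adj V * Z * U) * adj U = Z" if Z: "Z \<in> carrier_mat n n" for Z
  proof -
    have "V * (adj V * Z * U) * adj U = (V * adj V) * Z * (U * adj U)" using u(1) v(1) Z by (simp add: square_mat[where n = n])
    then show ?thesis unfolding u(2) v(2) using Z by simp
  qed
  have "K * conj_diag n U (\<lambda>k. f (d k)) \<in> carrier_mat n n" "conj_diag n V (\<lambda>k. f (d' k)) * K \<in> carrier_mat n n"
    using K u(1) v(1) by (auto intro!: square_mult_carrier conj_diag_carrier)
  from inv[OF this(1)] inv[OF this(2)] show ?thesis unfolding eq by simp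
qed

text \<open>Each eigenvalue of \<open>adj K * K\<close> is the squared norm of the image under
  \<open>K\<close> of a unit eigenvector, so it lies between 0 and 1.\<close>

lemma gram_diagonalisation:
  assumes K: "K \<in> carrier_mat n n"
    and c: "\<And>v. sqnorm {..<n} (\<lambda>i. \<Sum>j<n. K $$ (i, j) * v j) \<le> sqnorm {..<n} v"
  shows "\<exists>U e. unitary_mat n U \<and> adj K * K = conj_diag n U (\<lambda>k. of_real (e k)) \<and> (\<forall>k<n. 0 \<le> e k \<and> e k \<le> 1)"
proof -
  let ?N = "adj K * K"
  have N: "?N \<in> carrier_mat n n" "adj ?N = ?N" using K by (auto simp: adj_mult[of _ n n _ n])
  then obtain U d where U: "unitary_mat n U" and d: "?N = conj_diag n U d"
    using normal_mat_diagonalisation[of ?N n] by auto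
  note u = unitary_matD[OF U]
  define e where "e = (\<lambda>k. sqnorm {..<n} (\<lambda>i. \<Sum>j<n. K $$ (i, j) * U $$ (j, k)))"
  have de: "d k = of_real (e k)" if k: "k < n" for k
  proof -
    have "mat_diag n d = adj (K * U) * (K * U)"
      unfolding conj_diag_cancel[OF U, symmetric] d[symmetric] using u(1) K
      by (simp add: adj_mult[of _ n n _ n] square_mat[where n = n])
    then have "mat_diag n d $$ (k, k) = (\<Sum>i<n. cnj ((K * U) $$ (i, k)) * (K * U) $$ (i, k))"
      using adj_mult_index[of "K * U" n n "K * U" n k k] K u(1) k by simp
    also have "\<dots> = of_real (e k)"
      unfolding e_def cdot_self[symmetric] cdot_def using mult_index_sum[OF K u(1)] k by (intro sum.cong refl) simp
    finally show ?thesis using k by (simp add: mat_diag_def)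
  qed
  have e1: "e k \<le> 1" if k: "k < n" for k
  proof -
    have "e k \<le> sqnorm {..<n} (\<lambda>j. U $$ (j, k))" unfolding e_def by (rule c)
    also have "complex_of_real (sqnorm {..<n} (\<lambda>j. U $$ (j, k))) = of_real 1"
      unfolding cdot_self[symmetric] cdot_def using unitary_mat_cols[OF U k k] by simp
    then have "sqnorm {..<n} (\<lambda>j. U $$ (j, k)) = 1" unfolding of_real_eq_iff .
    finally show ?thesis .
  qed
  have "conj_diag n U d = conj_diag n U (\<lambda>k. of_real (e k))"
    by (rule eq_matI) (auto simp: conj_diag_index[OF u(1)] carrier_matD[OF conj_diag_carrier[OF u(1)]] de intro!: sum.cong)
  then show ?thesis using U d e1 by (intro exI[of _ U] exI[of _ e]) (auto simp: e_def sqnorm_nonneg)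
qed

text \<open>Halmos' unitary dilation of \<open>K\<close>, diagonalised and compressed back to the first block.\<close>

lemma contraction_normal_dilation:
  assumes K: "K \<in> carrier_mat n n"
    and c: "\<And>u v. (cmod (\<Sum>i<n. \<Sum>j<n. cnj (u i) * K $$ (i, j) * v j))^2 \<le> sqnorm {..<n} u * sqnorm {..<n} v"
  shows "\<exists>z \<zeta>. (\<forall>k<n+n. cmod (z k) = 1) \<and> (\<forall>i<n. \<forall>j<n. (\<Sum>k<n+n. \<zeta> k i * cnj (\<zeta> k j)) = (if i = j then 1 else 0)
     \<and> K $$ (i, j) = (\<Sum>k<n+n. z k * \<zeta> k i * cnj (\<zeta> k j)))"
proof -
  let ?S = "{..<n}"
  have sq: "a \<le> b" if "a^2 \<le> a * b" "0 \<le> a" "0 \<le> b" for a b :: real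
    using that by (cases "a = 0") (auto simp: power2_eq_square)
  \<comment> \<open>The form bound is tested with the image of \<open>v\<close> as its first
    argument; \<open>sq\<close> then cancels one factor of the squared norm.\<close>
  have c1: "sqnorm ?S (\<lambda>i. \<Sum>j<n. K $$ (i, j) * v j) \<le> sqnorm ?S v" for v
  proof -
    let ?u = "\<lambda>i. \<Sum>j<n. K $$ (i, j) * v j"
    have "(\<Sum>i<n. \<Sum>j<n. cnj (?u i) * K $$ (i, j) * v j) = cdot ?S ?u ?u"
      unfolding cdot_def by (simp only: sum_distrib_left mult.assoc)
    then have "(sqnorm ?S ?u)^2 \<le> sqnorm ?S ?u * sqnorm ?S v" using c[of ?u v] unfolding cdot_self by simp
    then show ?thesis by (rule sq) (auto simp: sqnorm_nonneg)
  qed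
  have c2: "sqnorm ?S (\<lambda>i. \<Sum>j<n. adj K $$ (i, j) * v j) \<le> sqnorm ?S v" for v
  proof -
    let ?u = "\<lambda>i. \<Sum>j<n. adj K $$ (i, j) * v j"
    have "(\<Sum>i<n. \<Sum>j<n. cnj (v i) * K $$ (i, j) * ?u j) = (\<Sum>j<n. \<Sum>i<n. cnj (v i) * K $$ (i, j) * ?u j)"
      by (rule sum.swap)
    also have "\<dots> = cdot ?S ?u ?u"
      unfolding cdot_def cnj_sum sum_distrib_right
      by (intro sum.cong refl) (use K in \<open>simp add: adj_index[OF K] ac_simps\<close>)
    finally have "(sqnorm ?S ?u)^2 \<le> sqnorm ?S ?u * sqnorm ?S v" using c[of v ?u] unfolding cdot_self
      by (simp add: mult.commute)
    then show ?thesis by (rule sq) (auto simp: sqnorm_nonneg)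
  qed
  obtain U e where U: "unitary_mat n U" "adj K * K = conj_diag n U (\<lambda>k. of_real (e k))" "\<forall>k<n. 0 \<le> e k \<and> e k \<le> 1"
    using gram_diagonalisation[OF K c1] by blast
  obtain V f where V: "unitary_mat n V" "K * adj K = conj_diag n V (\<lambda>k. of_real (f k))" "\<forall>k<n. 0 \<le> f k \<and> f k \<le> 1"
    using gram_diagonalisation[OF adj_carrier[OF K] c2] by auto
  note u = unitary_matD[OF U(1)] and v = unitary_matD[OF V(1)]
  \<comment> \<open>The function sqrt (1 - w), taken on complex numbers so that
    \<open>conj_diag_intertwine\<close> can carry one and the same function from
    \<open>adj K * K\<close> to \<open>K * adj K\<close>.\<close>
  define h where "h = (\<lambda>w. complex_of_real (sqrt (1 - Re w)))"
  have hh: "h (of_real x) * h (of_real x) = 1 - of_real x" if "x \<le> 1" for x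
  proof -
    have "h (of_real x) * h (of_real x) = of_real (sqrt (1 - x) * sqrt (1 - x))"
      by (simp only: h_def Re_complex_of_real of_real_mult)
    then show ?thesis using that by simp
  qed
  define X where "X = conj_diag n U (\<lambda>k. h (of_real (e k)))"
  define Y where "Y = conj_diag n V (\<lambda>k. - h (of_real (f k)))"
  have XY: "X \<in> carrier_mat n n" "Y \<in> carrier_mat n n" using u v by (auto simp: X_def Y_def conj_diag_carrier)
  have aXY: "adj X = X" "adj Y = Y" unfolding X_def Y_def adj_conj_diag[OF u(1)] adj_conj_diag[OF v(1)] by (auto simp: h_def)
  have cong: "conj_diag n Q d = conj_diag n Q d'" if "Q \<in> carrier_mat n n" "\<And>k. k < n \<Longrightarrow> d k = d' k" for Q d d'
    using that by (intro eq_matI) (auto simp: conj_diag_index carrier_matD[OF conj_diag_carrier] intro!: sum.cong)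
  have XX: "X * X + adj K * K = 1\<^sub>m n"
    unfolding X_def conj_diag_mult[OF U(1)] U(2) conj_diag_add[OF u(1)] conj_diag_one[OF U(1), symmetric]
    by (rule cong[OF u(1)]) (use U(3) hh in auto)
  have YY: "K * adj K + Y * Y = 1\<^sub>m n"
    unfolding Y_def conj_diag_mult[OF V(1)] V(2) conj_diag_add[OF v(1)] conj_diag_one[OF V(1), symmetric]
    by (rule cong[OF v(1)]) (use V(3) hh in auto)
  have KX: "K * X + Y * K = 0\<^sub>m n n"
  proof -
    have "K * conj_diag n U (\<lambda>k. of_real (e k)) = conj_diag n V (\<lambda>k. of_real (f k)) * K"
      unfolding U(2)[symmetric] V(2)[symmetric] using K by (simp add: square_mat[where n = n])
    then have "K * X = conj_diag n V (\<lambda>k. h (of_real (f k))) * K"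
      unfolding X_def by (rule conj_diag_intertwine[OF U(1) V(1) K])
    then have "K * X + Y * K = (conj_diag n V (\<lambda>k. h (of_real (f k))) + Y) * K"
      using K XY v by (simp add: add_mult_distrib_mat[of _ n n _ _ n] conj_diag_carrier)
    also have "conj_diag n V (\<lambda>k. h (of_real (f k))) + Y = 0\<^sub>m n n"
      unfolding Y_def conj_diag_add[OF v(1)]
      by (rule eq_matI) (auto simp: conj_diag_index[OF v(1)] carrier_matD[OF conj_diag_carrier[OF v(1)]])
    finally show ?thesis using K by simp
  qed
  have XK: "X * adj K + adj K * Y = 0\<^sub>m n n"
  proof -
    have "adj (A + B) = adj A + adj B" if "A \<in> carrier_mat n n" "B \<in> carrier_mat n n" for A B
      using that by (intro eq_matI) (auto simp: adj_def)
    then have "adj (K * X + Y * K) = X * adj K + adj K * Y"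
      using K XY aXY by (simp add: adj_mult[of _ n n _ n] square_mat[where n = n])
    moreover have "adj (0\<^sub>m n n) = 0\<^sub>m n n" by (rule eq_matI) (auto simp: adj_def)
    ultimately show ?thesis unfolding KX by simp
  qed
  \<comment> \<open>The minus sign inside \<open>Y\<close> makes the block rows orthogonal:
    \<open>K * X\<close> and \<open>Y * K\<close> cancel by the intertwining relation.\<close>
  define M where "M = four_block_mat K Y X (adj K)"
  have M: "M \<in> carrier_mat (n + n) (n + n)" using K XY by (auto simp: M_def)
  have cXY: "cnj (X $$ (j, i)) = X $$ (i, j)" "cnj (Y $$ (j, i)) = Y $$ (i, j)" if "i < n" "j < n" for i j
    using adj_index[OF XY(1) that] adj_index[OF XY(2) that] unfolding aXY by auto
  have aM: "adj M = four_block_mat (adj K) X Y K"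
    using K XY unfolding M_def by (intro eq_matI) (auto simp: adj_def cXY)
  have "M * adj M = four_block_mat (K * adj K + Y * Y) (K * X + Y * K) (X * adj K + adj K * Y) (X * X + adj K * K)"
    unfolding aM unfolding M_def by (rule mult_four_block_mat) (use K XY in auto)
  also have "\<dots> = 1\<^sub>m (n + n)" unfolding XX YY KX XK by (rule four_block_one_mat)
  finally have UM: "unitary_mat (n + n) M" by (rule unitary_matI[OF M])
  note m = unitary_matD[OF UM]
  obtain Q z where Q: "unitary_mat (n + n) Q" and Mz: "M = conj_diag (n + n) Q z"
    using normal_mat_diagonalisation[OF M] m by auto
  note q = unitary_matD[OF Q]
  have "conj_diag (n + n) Q (\<lambda>k. z k * cnj (z k)) = conj_diag (n + n) Q (\<lambda>_. 1)"
    using m(2) unfolding Mz adj_conj_diag[OF q(1)] conj_diag_mult[OF Q] conj_diag_one[OF Q] .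
  then have zz: "z k * cnj (z k) = 1" if "k < n + n" for k using conj_diag_inject[OF Q _ that] by blast
  have "cmod (z k) = 1" if "k < n + n" for k
  proof -
    have "complex_of_real ((cmod (z k))^2) = of_real 1" using zz[OF that] by (simp only: complex_norm_square of_real_1)
    then have "(cmod (z k))^2 = 1" unfolding of_real_eq_iff .
    then show ?thesis by (metis norm_ge_zero one_power2 power2_eq_imp_eq zero_le_one)
  qed
  moreover have "(\<Sum>k<n+n. Q $$ (i, k) * cnj (Q $$ (j, k))) = (if i = j then 1 else 0)"
    and "K $$ (i, j) = (\<Sum>k<n+n. z k * Q $$ (i, k) * cnj (Q $$ (j, k)))" if ij: "i < n" "j < n" for i j
  proof -
    show "(\<Sum>k<n+n. Q $$ (i, k) * cnj (Q $$ (j, k))) = (if i = j then 1 else 0)"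
      using unitary_mat_rows[OF Q, of i j] ij by simp
    have "K $$ (i, j) = M $$ (i, j)" using ij K XY by (simp add: M_def)
    then show "K $$ (i, j) = (\<Sum>k<n+n. z k * Q $$ (i, k) * cnj (Q $$ (j, k)))"
      unfolding Mz using conj_diag_index[OF q(1), of i j z] ij by simp
  qed
  ultimately show ?thesis by (intro exI[of _ z] exI[of _ "\<lambda>k i. Q $$ (i, k)"]) blast
qed

text \<open>The least eigenvalue is also exhibited as a value of the quadratic form, so that its
  sign and the test vectors of later bounds can be read off.\<close>

lemma hermitian_diagonalisation_min:
  assumes A: "A \<in> carrier_mat n n" and h: "adj A = A" and n: "0 < n"
  shows "\<exists>U e k0. unitary_mat n U \<and> A = conj_diag n U (\<lambda>k. of_real (e k)) \<and> k0 < n \<and> (\<forall>k<n. e k0 \<le> e k)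
    \<and> (\<Sum>i<n. \<Sum>j<n. cnj (U $$ (i, k0)) * A $$ (i, j) * U $$ (j, k0)) = of_real (e k0)"
proof -
  obtain U d where U: "unitary_mat n U" and d: "A = conj_diag n U d"
    using normal_mat_diagonalisation[OF A] h by auto
  note u = unitary_matD[OF U]
  have "conj_diag n U (\<lambda>k. cnj (d k)) = conj_diag n U d" using h unfolding d adj_conj_diag[OF u(1)] .
  then have cd: "cnj (d k) = d k" if "k < n" for k using conj_diag_inject[OF U _ that] by blast
  define e where "e = (\<lambda>k. Re (d k))"
  have de: "d k = of_real (e k)" if "k < n" for k using cd[OF that] by (simp add: e_def complex_eq_iff)
  have Ae: "A = conj_diag n U (\<lambda>k. of_real (e k))"
    unfolding d by (rule eq_matI) (auto simp: conj_diag_index[OF u(1)] carrier_matD[OF conj_diag_carrier[OF u(1)]] de intro!: sum.cong)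
  have "Min (e ` {..<n}) \<in> e ` {..<n}" using n by (intro Min_in) auto
  then obtain k0 where k0: "k0 < n" "e k0 = Min (e ` {..<n})" by auto
  have min: "\<forall>k<n. e k0 \<le> e k" unfolding k0(2) by auto
  have "adj U * (A * U) = mat_diag n d"
    unfolding conj_diag_cancel[OF U, symmetric] d[symmetric] using u(1) A by (simp add: square_mat[where n = n])
  then have "(adj U * (A * U)) $$ (k0, k0) = d k0" using k0 by (simp add: mat_diag_def)
  moreover have "(adj U * (A * U)) $$ (k0, k0) = (\<Sum>i<n. cnj (U $$ (i, k0)) * (A * U) $$ (i, k0))"
    using adj_mult_index[of U n n "A * U" n k0 k0] u(1) A k0 by simp
  moreover have "\<dots> = (\<Sum>i<n. \<Sum>j<n. cnj (U $$ (i, k0)) * A $$ (i, j) * U $$ (j, k0))"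
    using mult_index_sum[OF A u(1)] k0 by (intro sum.cong refl) (simp add: sum_distrib_left mult.assoc)
  ultimately show ?thesis using U Ae k0(1) min de[OF k0(1)] by (intro exI[of _ U] exI[of _ e] exI[of _ k0]) auto
qed

section \<open>Separability from the spectrum\<close>

lemma sum_list_map_upt: "(\<Sum>k\<leftarrow>[0..<n]. f k) = (\<Sum>k<n. f k)"
  by (simp add: interv_sum_list_conv_sum_set_nat atLeast0LessThan)

text \<open>Only the least eigenvalues \<open>p\<close>, \<open>r\<close> of \<open>A\<close>,
  \<open>C\<close> matter. \<open>A - p\<close> and \<open>C - r\<close> are positive and split off
  as product vectors supported on one block each. The remainder has diagonal blocks
  \<open>p\<close>, \<open>r\<close> times the identity and off-diagonal block
  \<open>sqrt (p * r)\<close> times a contraction, so its dilation resolves all of them over the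
  same vectors \<open>\<zeta> k\<close>.\<close>

lemma block_product_decomposition:
  fixes A B C :: "complex mat" and a c :: real
  assumes n: "0 < n" and A: "A \<in> carrier_mat n n" and B: "B \<in> carrier_mat n n" and C: "C \<in> carrier_mat n n"
    and h: "adj A = A" "adj C = C"
    and pos: "\<And>y. 0 \<le> Re (\<Sum>i<n. \<Sum>j<n. cnj (y i) * A $$ (i, j) * y j)" "\<And>y. 0 \<le> Re (\<Sum>i<n. \<Sum>j<n. cnj (y i) * C $$ (i, j) * y j)"
    and bound: "\<And>y z u v s t. sqnorm {..<n} y = 1 \<Longrightarrow> sqnorm {..<n} z = 1 \<Longrightarrow> sqnorm {..<n} u = 1 \<Longrightarrow> sqnorm {..<n} v = 1
      \<Longrightarrow> 0 \<le> s \<Longrightarrow> 0 \<le> t \<Longrightarrow> s^2 + t^2 = 1 \<Longrightarrow>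
      2 * s * t * Re (\<Sum>i<n. \<Sum>j<n. cnj (u i) * B $$ (i, j) * v j)
      \<le> s^2 * Re (\<Sum>i<n. \<Sum>j<n. cnj (y i) * A $$ (i, j) * y j) + t^2 * Re (\<Sum>i<n. \<Sum>j<n. cnj (z i) * C $$ (i, j) * z j)"
  shows "\<exists>xs :: ((nat \<Rightarrow> complex) \<times> (nat \<Rightarrow> complex)) list. \<forall>i<n. \<forall>j<n.
     A $$ (i, j) = (\<Sum>(\<xi>, \<zeta>)\<leftarrow>xs. (\<xi> 0 * \<zeta> i) * cnj (\<xi> 0 * \<zeta> j))
   \<and> B $$ (i, j) = (\<Sum>(\<xi>, \<zeta>)\<leftarrow>xs. (\<xi> 0 * \<zeta> i) * cnj (\<xi> 1 * \<zeta> j))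
   \<and> C $$ (i, j) = (\<Sum>(\<xi>, \<zeta>)\<leftarrow>xs. (\<xi> 1 * \<zeta> i) * cnj (\<xi> 1 * \<zeta> j))"
proof -
  let ?S = "{..<n}"
  let ?q = "\<lambda>M u v. \<Sum>i<n. \<Sum>j<n. cnj (u i) * M $$ (i, j) * v j"
  obtain U e ka where U: "unitary_mat n U" "A = conj_diag n U (\<lambda>k. of_real (e k))" "ka < n" "\<forall>k<n. e ka \<le> e k"
      "?q A (\<lambda>i. U $$ (i, ka)) (\<lambda>i. U $$ (i, ka)) = of_real (e ka)"
    using hermitian_diagonalisation_min[OF A h(1) n] by blast
  obtain V f kc where V: "unitary_mat n V" "C = conj_diag n V (\<lambda>k. of_real (f k))" "kc < n" "\<forall>k<n. f kc \<le> f k"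
      "?q C (\<lambda>i. V $$ (i, kc)) (\<lambda>i. V $$ (i, kc)) = of_real (f kc)"
    using hermitian_diagonalisation_min[OF C h(2) n] by blast
  note u = unitary_matD[OF U(1)] and v = unitary_matD[OF V(1)]
  define p where "p = e ka"
  define r where "r = f kc"
  have pr: "0 \<le> p" "0 \<le> r" using pos(1)[of "\<lambda>i. U $$ (i, ka)"] pos(2)[of "\<lambda>i. V $$ (i, kc)"] U(5) V(5) by (auto simp: p_def r_def)
  have unit: "sqnorm ?S (\<lambda>i. Q $$ (i, k)) = 1" if "unitary_mat n Q" "k < n" for Q k
  proof -
    have "complex_of_real (sqnorm ?S (\<lambda>i. Q $$ (i, k))) = of_real 1"
      unfolding cdot_self[symmetric] cdot_def using unitary_mat_cols[OF that(1) that(2) that(2)] by simp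
    then show ?thesis unfolding of_real_eq_iff .
  qed
  have w: "2 * s * t * Re (?q B x y) \<le> s^2 * p + t^2 * r"
    if "sqnorm ?S x = 1" "sqnorm ?S y = 1" "0 \<le> s" "0 \<le> t" "s^2 + t^2 = 1" for x y s t
    using bound[OF unit[OF U(1,3)] unit[OF V(1,3)] that] U(5) V(5) by (simp add: p_def r_def)
  have b1: "(cmod (?q B x y))^2 \<le> p * r" if x: "sqnorm ?S x = 1" and y: "sqnorm ?S y = 1" for x y
  proof (rule discriminant_bound[OF pr])
    fix l :: real
    obtain z where z: "cmod z = 1" "z * ?q B x y = of_real (cmod (?q B x y))" using ex_unimodular by blast
    show "0 \<le> p + 2 * l * cmod (?q B x y) + l^2 * r"
    proof (cases "0 \<le> l")
      case True then show ?thesis using pr by simp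
    next
      case False
      \<comment> \<open>For negative \<open>l\<close> the point \<open>(1, - l) / N\<close> of the
        unit circle serves as \<open>(s, t)\<close>; for \<open>l \<ge> 0\<close> every summand is
        nonnegative anyway.\<close>
      define N where "N = sqrt (1 + l^2)"
      have N: "N > 0" "N^2 = 1 + l^2" by (auto simp: N_def add_pos_nonneg)
      have "?q B x (\<lambda>j. z * y j) = z * ?q B x y" unfolding sum_distrib_left by (intro sum.cong refl) (simp add: ac_simps)
      then have Re: "Re (?q B x (\<lambda>j. z * y j)) = cmod (?q B x y)" using z by simp
      have "2 * (1 / N) * (- l / N) * Re (?q B x (\<lambda>j. z * y j)) \<le> (1 / N)^2 * p + (- l / N)^2 * r"
      proof (rule w)
        show "(1 / N)^2 + (- l / N)^2 = 1" using N(1)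
          by (simp add: power_divide add_divide_distrib[symmetric] N(2)[symmetric])
      qed (use x y z N False in \<open>auto simp: sqnorm_scale divide_le_0_iff\<close>)
      then have "N^2 * (2 * (1 / N) * (- l / N) * cmod (?q B x y)) \<le> N^2 * ((1 / N)^2 * p + (- l / N)^2 * r)"
        unfolding Re by (rule mult_left_mono) simp
      moreover have "N^2 * (2 * (1 / N) * (- l / N) * cmod (?q B x y)) = - (2 * l * cmod (?q B x y))"
        using N(1) by (simp add: power2_eq_square)
      moreover have "N^2 * ((1 / N)^2 * p + (- l / N)^2 * r) = p + l^2 * r"
        using N(1) by (simp add: power_divide distrib_left)
      ultimately show ?thesis by simp
    qed
  qed
  have bnd: "(cmod (?q B x y))^2 \<le> p * r * (sqnorm ?S x * sqnorm ?S y)" for x y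
  proof (cases "sqnorm ?S x = 0 \<or> sqnorm ?S y = 0")
    case True
    then have "(\<forall>i<n. x i = 0) \<or> (\<forall>i<n. y i = 0)" using sqnorm_zeroD[of ?S] by auto
    then have "?q B x y = 0" by (auto intro!: sum.neutral)
    then show ?thesis using pr by (simp add: sqnorm_nonneg)
  next
    case False
    then have N: "sqnorm ?S x > 0" "sqnorm ?S y > 0" using sqnorm_nonneg[of ?S x] sqnorm_nonneg[of ?S y] by auto
    define cx where "cx = 1 / sqrt (sqnorm ?S x)"
    define cy where "cy = 1 / sqrt (sqnorm ?S y)"
    have cc: "cx^2 * sqnorm ?S x = 1" "cy^2 * sqnorm ?S y = 1" using N by (auto simp: cx_def cy_def power_divide)
    have "?q B (\<lambda>i. of_real cx * x i) (\<lambda>j. of_real cy * y j) = of_real (cx * cy) * ?q B x y"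
      unfolding sum_distrib_left by (intro sum.cong refl) (simp add: ac_simps)
    then have "(cmod (?q B (\<lambda>i. of_real cx * x i) (\<lambda>j. of_real cy * y j)))^2 = cx^2 * cy^2 * (cmod (?q B x y))^2"
      by (simp add: norm_mult power_mult_distrib)
    moreover have "(cmod (?q B (\<lambda>i. of_real cx * x i) (\<lambda>j. of_real cy * y j)))^2 \<le> p * r"
      by (rule b1) (use cc in \<open>auto simp: sqnorm_scale\<close>)
    ultimately have "cx^2 * cy^2 * (cmod (?q B x y))^2 * (sqnorm ?S x * sqnorm ?S y) \<le> p * r * (sqnorm ?S x * sqnorm ?S y)"
      using N by (intro mult_right_mono) auto
    moreover have "cx^2 * cy^2 * (cmod (?q B x y))^2 * (sqnorm ?S x * sqnorm ?S y)
       = (cx^2 * sqnorm ?S x) * (cy^2 * sqnorm ?S y) * (cmod (?q B x y))^2" by (simp only: ac_simps)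
    ultimately show ?thesis unfolding cc by simp
  qed
  define g where "g = sqrt (p * r)"
  have g: "0 \<le> g" "g^2 = p * r" "g = sqrt p * sqrt r"
    using pr by (simp_all add: g_def) (simp add: real_sqrt_mult)
  \<comment> \<open>If \<open>g = 0\<close> this gives \<open>K = 0\<close>, and \<open>bnd\<close>
    forces \<open>B = 0\<close>, so \<open>BK\<close> remains true.\<close>
  define K where "K = mat n n (\<lambda>(i, j). of_real (1 / g) * B $$ (i, j))"
  have K: "K \<in> carrier_mat n n" by (simp add: K_def)
  have Kq: "?q K x y = of_real (1 / g) * ?q B x y" for x y
    unfolding sum_distrib_left by (intro sum.cong refl) (simp add: K_def ac_simps)
  have "(cmod (?q K x y))^2 \<le> sqnorm ?S x * sqnorm ?S y" for x y
  proof (cases "g = 0")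
    case True then show ?thesis unfolding Kq by (simp add: sqnorm_nonneg)
  next
    case False
    have "(cmod (?q K x y))^2 = (1 / g)^2 * (cmod (?q B x y))^2" unfolding Kq norm_mult power_mult_distrib norm_of_real power2_abs ..
    also have "\<dots> \<le> (1 / g)^2 * (g^2 * (sqnorm ?S x * sqnorm ?S y))" unfolding g(2) by (intro mult_left_mono bnd) auto
    finally show ?thesis using False by (simp add: power_divide)
  qed
  from contraction_normal_dilation[OF K this] obtain z \<zeta> where z: "\<forall>k<n+n. cmod (z k) = 1"
    and \<zeta>: "\<forall>i<n. \<forall>j<n. (\<Sum>k<n+n. \<zeta> k i * cnj (\<zeta> k j)) = (if i = j then 1 else 0) \<and> K $$ (i, j) = (\<Sum>k<n+n. z k * \<zeta> k i * cnj (\<zeta> k j))"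
    by blast
  have BK: "B $$ (i, j) = of_real g * K $$ (i, j)" if ij: "i < n" "j < n" for i j
  proof (cases "g = 0")
    case True
    have "?q B (\<lambda>l. if l = i then 1 else 0) (\<lambda>l. if l = j then 1 else 0) = (\<Sum>k<n. \<Sum>l<n. if l = j then (if k = i then B $$ (k, l) else 0) else 0)"
      by (intro sum.cong refl) auto
    also have "\<dots> = B $$ (i, j)" using ij by simp
    finally have "(cmod (B $$ (i, j)))^2 \<le> p * r * (sqnorm ?S (\<lambda>l. if l = i then 1 else 0) * sqnorm ?S (\<lambda>l. if l = j then 1 else 0))"
      using bnd[of "\<lambda>l. if l = i then 1 else 0" "\<lambda>l. if l = j then 1 else 0"] by simp
    moreover have "p * r = 0" using True g(2) by simp
    ultimately have "(cmod (B $$ (i, j)))^2 \<le> 0" by (simp only: mult_zero_left)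
    then show ?thesis using True by simp
  next
    case False then show ?thesis using ij by (simp add: K_def)
  qed
  \<comment> \<open>In the last group the first factor is
    \<open>(sqrt p, sqrt r * cnj (z k))\<close>. The conjugate appears because the second entry is
    conjugated again in \<open>B\<close>; the modulus 1 of \<open>z k\<close> makes it invisible in
    \<open>C\<close>.\<close>
  define xs where "xs = map (\<lambda>k. (\<lambda>a::nat. if a = 0 then complex_of_real (sqrt (e k - p)) else 0, \<lambda>i. U $$ (i, k))) [0..<n]
     @ map (\<lambda>k. (\<lambda>a::nat. if a = 0 then 0 else complex_of_real (sqrt (f k - r)), \<lambda>i. V $$ (i, k))) [0..<n]
     @ map (\<lambda>k. (\<lambda>a::nat. if a = 0 then complex_of_real (sqrt p) else of_real (sqrt r) * cnj (z k), \<zeta> k)) [0..<n+n]"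
  have sp: "(of_real (sqrt x) * a) * cnj (of_real (sqrt x) * b) = of_real x * a * cnj b" if "0 \<le> x" for x :: real and a b :: complex
  proof -
    have "(of_real (sqrt x) * a) * cnj (of_real (sqrt x) * b) = of_real (sqrt x * sqrt x) * a * cnj b"
      by (simp only: of_real_mult complex_cnj_mult complex_cnj_complex_of_real ac_simps)
    then show ?thesis using that by simp
  qed
  have sp': "of_real (sqrt x) * a * (of_real (sqrt x) * b) = of_real x * a * b" if "0 \<le> x" for x :: real and a b :: complex
    using sp[OF that, of a "cnj b"] by simp
  have diag: "of_real l * (\<Sum>k<m. Q k i * cnj (Q k j)) + (\<Sum>k<m'. of_real (d k - l) * R k i * cnj (R k j)) = (\<Sum>k<m'. of_real (d k) * R k i * cnj (R k j))"
    if "(\<Sum>k<m. Q k i * cnj (Q k j)) = (\<Sum>k<m'. R k i * cnj (R k j))" for l :: real and d :: "nat \<Rightarrow> real" and Q R :: "nat \<Rightarrow> nat \<Rightarrow> complex" and m m' i j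
    unfolding that sum_distrib_left sum.distrib[symmetric] by (intro sum.cong refl) (simp add: algebra_simps)
  show ?thesis
  proof (intro exI[of _ xs] allI impI conjI)
    fix i j assume ij: "i < n" "j < n"
    have \<zeta>ij: "(\<Sum>k<n+n. \<zeta> k i * cnj (\<zeta> k j)) = (if i = j then 1 else 0)" "K $$ (i, j) = (\<Sum>k<n+n. z k * \<zeta> k i * cnj (\<zeta> k j))"
      using \<zeta> ij by auto
    have "(\<Sum>(\<xi>, \<zeta>)\<leftarrow>xs. (\<xi> 0 * \<zeta> i) * cnj (\<xi> 0 * \<zeta> j))
       = (\<Sum>k<n. of_real (e k - p) * U $$ (i, k) * cnj (U $$ (j, k))) + (\<Sum>k<n+n. of_real p * \<zeta> k i * cnj (\<zeta> k j))"
      unfolding xs_def map_append sum_list.append map_map comp_def prod.case sum_list_map_upt if_True simp_thms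
      using U(4) pr(1) by (simp add: sp' p_def cong: sum.cong_simp del: of_real_diff)
    also have "(\<Sum>k<n+n. of_real p * \<zeta> k i * cnj (\<zeta> k j)) = of_real p * (\<Sum>k<n+n. \<zeta> k i * cnj (\<zeta> k j))"
      by (simp add: sum_distrib_left mult.assoc)
    finally have s1: "(\<Sum>(\<xi>, \<zeta>)\<leftarrow>xs. (\<xi> 0 * \<zeta> i) * cnj (\<xi> 0 * \<zeta> j))
      = (\<Sum>k<n. of_real (e k - p) * U $$ (i, k) * cnj (U $$ (j, k))) + of_real p * (\<Sum>k<n+n. \<zeta> k i * cnj (\<zeta> k j))" .
    have "of_real p * (\<Sum>k<n+n. \<zeta> k i * cnj (\<zeta> k j)) + (\<Sum>k<n. of_real (e k - p) * U $$ (i, k) * cnj (U $$ (j, k)))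
      = (\<Sum>k<n. of_real (e k) * U $$ (i, k) * cnj (U $$ (j, k)))"
      by (rule diag) (simp only: \<zeta>ij(1) unitary_mat_rows[OF U(1) ij])
    moreover have "A $$ (i, j) = (\<Sum>k<n. of_real (e k) * U $$ (i, k) * cnj (U $$ (j, k)))"
      unfolding U(2) by (rule conj_diag_index[OF u(1) ij])
    ultimately show "A $$ (i, j) = (\<Sum>(\<xi>, \<zeta>)\<leftarrow>xs. (\<xi> 0 * \<zeta> i) * cnj (\<xi> 0 * \<zeta> j))"
      unfolding s1 by (simp only: add.commute)
    have "(\<Sum>(\<xi>, \<zeta>)\<leftarrow>xs. (\<xi> 1 * \<zeta> i) * cnj (\<xi> 1 * \<zeta> j))
       = (\<Sum>k<n. of_real (f k - r) * V $$ (i, k) * cnj (V $$ (j, k)))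
        + (\<Sum>k<n+n. of_real (sqrt r) * cnj (z k) * \<zeta> k i * cnj (of_real (sqrt r) * cnj (z k) * \<zeta> k j))"
      unfolding xs_def map_append sum_list.append map_map comp_def prod.case sum_list_map_upt
      using V(4) by (simp add: sp' r_def cong: sum.cong_simp del: of_real_diff)
    also have "(\<Sum>k<n+n. of_real (sqrt r) * cnj (z k) * \<zeta> k i * cnj (of_real (sqrt r) * cnj (z k) * \<zeta> k j))
       = (\<Sum>k<n+n. of_real r * (\<zeta> k i * cnj (\<zeta> k j)))"
    proof (intro sum.cong refl)
      fix k assume "k \<in> {..<n+n}"
      then have zk: "cnj (z k) * z k = 1" using z cnj_mult_self[of "z k"] by simp
      have "of_real (sqrt r) * cnj (z k) * \<zeta> k i * cnj (of_real (sqrt r) * cnj (z k) * \<zeta> k j)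
        = (of_real (sqrt r) * (cnj (z k) * \<zeta> k i)) * cnj (of_real (sqrt r) * (cnj (z k) * \<zeta> k j))" by (simp only: mult.assoc)
      also have "\<dots> = of_real r * (cnj (z k) * z k) * (\<zeta> k i * cnj (\<zeta> k j))" unfolding sp[OF pr(2)] by (simp add: ac_simps)
      finally show "of_real (sqrt r) * cnj (z k) * \<zeta> k i * cnj (of_real (sqrt r) * cnj (z k) * \<zeta> k j) = of_real r * (\<zeta> k i * cnj (\<zeta> k j))"
        unfolding zk by simp
    qed
    also have "\<dots> = of_real r * (\<Sum>k<n+n. \<zeta> k i * cnj (\<zeta> k j))" by (simp add: sum_distrib_left)
    finally have s1: "(\<Sum>(\<xi>, \<zeta>)\<leftarrow>xs. (\<xi> 1 * \<zeta> i) * cnj (\<xi> 1 * \<zeta> j))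
      = (\<Sum>k<n. of_real (f k - r) * V $$ (i, k) * cnj (V $$ (j, k))) + of_real r * (\<Sum>k<n+n. \<zeta> k i * cnj (\<zeta> k j))" .
    have "of_real r * (\<Sum>k<n+n. \<zeta> k i * cnj (\<zeta> k j)) + (\<Sum>k<n. of_real (f k - r) * V $$ (i, k) * cnj (V $$ (j, k)))
      = (\<Sum>k<n. of_real (f k) * V $$ (i, k) * cnj (V $$ (j, k)))"
      by (rule diag) (simp only: \<zeta>ij(1) unitary_mat_rows[OF V(1) ij])
    moreover have "C $$ (i, j) = (\<Sum>k<n. of_real (f k) * V $$ (i, k) * cnj (V $$ (j, k)))"
      unfolding V(2) by (rule conj_diag_index[OF v(1) ij])
    ultimately show "C $$ (i, j) = (\<Sum>(\<xi>, \<zeta>)\<leftarrow>xs. (\<xi> 1 * \<zeta> i) * cnj (\<xi> 1 * \<zeta> j))"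
      unfolding s1 by (simp only: add.commute)
    have "(\<Sum>(\<xi>, \<zeta>)\<leftarrow>xs. (\<xi> 0 * \<zeta> i) * cnj (\<xi> 1 * \<zeta> j))
       = (\<Sum>k<n+n. of_real (sqrt p) * \<zeta> k i * cnj (of_real (sqrt r) * cnj (z k) * \<zeta> k j))"
      unfolding xs_def map_append sum_list.append map_map comp_def prod.case sum_list_map_upt by simp
    also have "\<dots> = of_real g * (\<Sum>k<n+n. z k * \<zeta> k i * cnj (\<zeta> k j))"
      unfolding sum_distrib_left g(3) by (intro sum.cong refl) (simp add: ac_simps)
    finally show "B $$ (i, j) = (\<Sum>(\<xi>, \<zeta>)\<leftarrow>xs. (\<xi> 0 * \<zeta> i) * cnj (\<xi> 1 * \<zeta> j))"
      using BK[OF ij] \<zeta>ij(2) by simp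
  qed
qed

section \<open>Balancing rotations and separability\<close>

lemma ex_unit_orthogonal3:
  fixes r1 r2 r3 s1 s2 s3 :: real
  shows "\<exists>x y z. x^2 + y^2 + z^2 = 1 \<and> x * r1 + y * r2 + z * r3 = 0 \<and> x * s1 + y * s2 + z * s3 = 0"
proof -
  have ex: "\<exists>x y z. x^2 + y^2 + z^2 = 1 \<and> x * r1 + y * r2 + z * r3 = 0 \<and> x * s1 + y * s2 + z * s3 = 0"
    if "x * r1 + y * r2 + z * r3 = 0" "x * s1 + y * s2 + z * s3 = 0" "\<not> (x = 0 \<and> y = 0 \<and> z = 0)" for x y z :: real
  proof -
    define N where "N = sqrt (x^2 + y^2 + z^2)"
    have "x^2 + y^2 + z^2 > 0" using that(3) by (smt (verit) zero_le_power2 zero_less_power2)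
    then have N: "N > 0" "N^2 = x^2 + y^2 + z^2" by (auto simp: N_def)
    have sq: "(x / N)^2 + (y / N)^2 + (z / N)^2 = 1"
      using N(1) by (simp add: power_divide add_divide_distrib[symmetric] N(2)[symmetric])
    have lin: "x / N * a + y / N * b + z / N * c = (x * a + y * b + z * c) / N" for a b c
      by (simp add: add_divide_distrib)
    show ?thesis
      by (rule exI[of _ "x / N"], rule exI[of _ "y / N"], rule exI[of _ "z / N"]) (use sq that in \<open>simp add: lin del: times_divide_eq_left\<close>)
  qed
  \<comment> \<open>The cross product of the two vectors. If it vanishes they are parallel, and it
    is enough to be orthogonal to a nonzero one of them, if there is one.\<close>
  define c1 where "c1 = r2 * s3 - r3 * s2"
  define c2 where "c2 = r3 * s1 - r1 * s3"
  define c3 where "c3 = r1 * s2 - r2 * s1"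
  show ?thesis
  proof (cases "c1 = 0 \<and> c2 = 0 \<and> c3 = 0")
    case False
    then show ?thesis by (intro ex[of c1 c2 c3]) (auto simp: c1_def c2_def c3_def algebra_simps)
  next
    case True
    then have c: "r2 * s3 = r3 * s2" "r3 * s1 = r1 * s3" "r1 * s2 = r2 * s1" by (auto simp: c1_def c2_def c3_def)
    show ?thesis
    proof (cases "r1 = 0 \<and> r2 = 0 \<and> r3 = 0")
      case False
      then consider "r1 \<noteq> 0 \<or> r2 \<noteq> 0" | "r3 \<noteq> 0" by blast
      then show ?thesis
      proof cases
        case 1 then show ?thesis using c by (intro ex[of r2 "- r1" 0]) (auto simp: algebra_simps)
      next
        case 2 then show ?thesis using c by (intro ex[of 0 r3 "- r2"]) (auto simp: algebra_simps)
      qed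
    next
      case r: True
      show ?thesis
      proof (cases "s1 = 0 \<and> s2 = 0")
        case True then show ?thesis using r by (intro ex[of 1 0 0]) auto
      next
        case False then show ?thesis using r by (intro ex[of s2 "- s1" 0]) auto
      qed
    qed
  qed
qed

text \<open>Both conditions are linear in the Bloch vector of \<open>(w0, w1)\<close>, whose
  components are the real and imaginary part of \<open>2 * w0 * cnj w1\<close> and the difference of
  the squared moduli. Two linear conditions leave a unit vector in R^3, and every point of the
  sphere is the Bloch vector of some unit \<open>(w0, w1)\<close>.\<close>

lemma ex_balancing_rotation:
  fixes A A' :: real and g g' :: complex
  shows "\<exists>w0 w1. (cmod w0)^2 + (cmod w1)^2 = 1 \<and> ((cmod w0)^2 - (cmod w1)^2) * A + 4 * Re (w0 * cnj w1 * g) = 0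
     \<and> ((cmod w0)^2 - (cmod w1)^2) * A' + 4 * Re (w0 * cnj w1 * g') = 0"
proof -
  obtain x y z where n: "x^2 + y^2 + z^2 = 1" and o: "x * (2 * Re g) + y * (- 2 * Im g) + z * A = 0" "x * (2 * Re g') + y * (- 2 * Im g') + z * A' = 0"
    using ex_unit_orthogonal3[of "2 * Re g" "- 2 * Im g" A "2 * Re g'" "- 2 * Im g'" A'] by blast
  have z1: "z^2 \<le> 1^2" using n zero_le_power2[of x] zero_le_power2[of y] unfolding one_power2 by linarith
  then have z: "-1 \<le> z" "z \<le> 1" using abs_le_square_iff[of z 1] by auto
  have "\<exists>w0 w1. (cmod w0)^2 = (1 + z) / 2 \<and> (cmod w1)^2 = (1 - z) / 2 \<and> 2 * (w0 * cnj w1) = Complex x y"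
  proof (cases "z = -1")
    case True
    then have "x = 0" "y = 0" using n by (auto simp: sum_power2_eq_zero_iff)
    with True show ?thesis by - (rule exI[of _ 0], rule exI[of _ 1], auto simp: complex_eq_iff)
  next
    case False
    define w where "w = sqrt ((1 + z) / 2)"
    have w: "w > 0" "w^2 = (1 + z) / 2" using z False by (auto simp: w_def)
    define w1 where "w1 = Complex (x / (2 * w)) (- y / (2 * w))"
    have "(cmod w1)^2 = (x^2 + y^2) / (4 * w^2)" by (simp add: w1_def cmod_power2 power_divide power_mult_distrib add_divide_distrib)
    also have "x^2 + y^2 = (1 + z) * (1 - z)" using n by (simp add: power2_eq_square algebra_simps)
    also have "\<dots> / (4 * w^2) = (1 - z) / 2" unfolding w(2) using z False by (simp add: field_simps)
    finally have "(cmod w1)^2 = (1 - z) / 2" .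
    moreover have "2 * (of_real w * cnj w1) = Complex x y" using w by (simp add: w1_def complex_eq_iff)
    moreover have "(cmod (of_real w))^2 = (1 + z) / 2" using w by simp
    ultimately show ?thesis by blast
  qed
  then obtain w0 w1 where w: "(cmod w0)^2 = (1 + z) / 2" "(cmod w1)^2 = (1 - z) / 2" "2 * (w0 * cnj w1) = Complex x y" by blast
  have re4: "4 * Re (w0 * cnj w1 * h) = x * (2 * Re h) + y * (- 2 * Im h)" for h
  proof -
    have "4 * Re (w0 * cnj w1 * h) = 2 * Re (2 * (w0 * cnj w1) * h)" by (simp add: algebra_simps)
    then show ?thesis unfolding w(3) by (simp add: algebra_simps)
  qed
  have wz: "(cmod w0)^2 - (cmod w1)^2 = z" unfolding w(1,2) by (simp add: field_simps)
  have "z * A + 4 * Re (w0 * cnj w1 * g) = 0" "z * A' + 4 * Re (w0 * cnj w1 * g') = 0"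
    unfolding re4 using o by (simp_all add: algebra_simps)
  moreover have "(cmod w0)^2 + (cmod w1)^2 = 1" unfolding w(1,2) by (simp add: field_simps)
  ultimately show ?thesis using wz by blast
qed

lemma sesquilinear_frame_sum:
  "(\<Sum>i\<in>S. \<Sum>j\<in>T. cnj (u i) * (\<Sum>k\<in>K. of_real (lam k) * (p k i * cnj (q k j))) * v j)
    = (\<Sum>k\<in>K. of_real (lam k) * (cnj (cdot S (p k) u) * cdot T (q k) v))"
proof -
  have "(\<Sum>i\<in>S. \<Sum>j\<in>T. cnj (u i) * (\<Sum>k\<in>K. of_real (lam k) * (p k i * cnj (q k j))) * v j)
    = (\<Sum>i\<in>S. \<Sum>j\<in>T. \<Sum>k\<in>K. of_real (lam k) * ((cnj (u i) * p k i) * (cnj (q k j) * v j)))"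
    unfolding sum_distrib_left sum_distrib_right by (intro sum.cong refl) (simp only: ac_simps)
  also have "\<dots> = (\<Sum>k\<in>K. \<Sum>i\<in>S. \<Sum>j\<in>T. of_real (lam k) * ((cnj (u i) * p k i) * (cnj (q k j) * v j)))"
  proof -
    have "(\<Sum>i\<in>S. \<Sum>j\<in>T. \<Sum>k\<in>K. F i j k) = (\<Sum>k\<in>K. \<Sum>i\<in>S. \<Sum>j\<in>T. F i j k)" for F :: "_ \<Rightarrow> _ \<Rightarrow> _ \<Rightarrow> complex"
    proof -
      have "(\<Sum>i\<in>S. \<Sum>j\<in>T. \<Sum>k\<in>K. F i j k) = (\<Sum>i\<in>S. \<Sum>k\<in>K. \<Sum>j\<in>T. F i j k)"
        by (intro sum.cong refl sum.swap)
      then show ?thesis by (simp only: sum.swap[of _ K S])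
    qed
    then show ?thesis .
  qed
  also have "\<dots> = (\<Sum>k\<in>K. of_real (lam k) * (cnj (cdot S (p k) u) * cdot T (q k) v))"
    unfolding cdot_def cnj_sum sum_product unfolding sum_distrib_left
    by (intro sum.cong refl) (simp only: ac_simps complex_cnj_mult complex_cnj_cnj)
  finally show ?thesis .
qed

text \<open>A rotation of the C^2 factor takes product vectors to product vectors, so a
  decomposition found in the balanced coordinates \<open>p\<close>, \<open>q\<close> is carried back
  by \<open>T\<close>.\<close>

lemma product_decomposition_from_spectrum:
  fixes f :: "'k \<Rightarrow> nat \<Rightarrow> nat \<Rightarrow> complex" and lam :: "'k \<Rightarrow> real"
  assumes K: "finite K" "k0 \<in> K" "k1 \<in> K" "k0 \<noteq> k1" and n: "0 < n"
    and frame: "\<And>a b i j. a < 2 \<Longrightarrow> b < 2 \<Longrightarrow> i < n \<Longrightarrow> j < n \<Longrightarrow> (\<Sum>k\<in>K. f k a i * cnj (f k b j)) = (if a = b \<and> i = j then 1 else 0)"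
    and unit: "sqnorm {..<n} (f k0 0) + sqnorm {..<n} (f k0 1) = 1" "sqnorm {..<n} (f k1 0) + sqnorm {..<n} (f k1 1) = 1"
    and orth: "cdot {..<n} (f k0 0) (f k1 0) + cdot {..<n} (f k0 1) (f k1 1) = 0"
    and ev: "lam k0 = a0" "lam k1 = b0" "0 \<le> a0" "a0 \<le> b0" "b0 \<le> c0" "c0 \<le> L" "b0 \<le> L"
    and rest: "\<And>k. k \<in> K - {k0, k1} \<Longrightarrow> c0 \<le> lam k \<and> lam k \<le> L"
    and spec: "(L - b0)^2 \<le> 4 * a0 * c0"
  shows "\<exists>xs :: ((nat \<Rightarrow> complex) \<times> (nat \<Rightarrow> complex)) list. \<forall>a<2. \<forall>b<2. \<forall>i<n. \<forall>j<n.
     (\<Sum>k\<in>K. of_real (lam k) * (f k a i * cnj (f k b j))) = (\<Sum>(\<xi>, \<zeta>)\<leftarrow>xs. (\<xi> a * \<zeta> i) * cnj (\<xi> b * \<zeta> j))"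
proof -
  let ?S = "{..<n}"
  define gg where "gg = (\<lambda>k. cdot ?S (f k 0) (f k 1))"
  define AA where "AA = (\<lambda>k. sqnorm ?S (f k 0) - sqnorm ?S (f k 1))"
  obtain w0 w1 where w: "(cmod w0)^2 + (cmod w1)^2 = 1"
    and wk: "((cmod w0)^2 - (cmod w1)^2) * AA k0 + 4 * Re (w0 * cnj w1 * gg k0) = 0"
      "((cmod w0)^2 - (cmod w1)^2) * AA k1 + 4 * Re (w0 * cnj w1 * gg k1) = 0"
    using ex_balancing_rotation by blast
  have wc: "w0 * cnj w0 + w1 * cnj w1 = 1"
  proof -
    have "w0 * cnj w0 + w1 * cnj w1 = of_real ((cmod w0)^2 + (cmod w1)^2)" by (simp only: complex_norm_square of_real_add)
    then show ?thesis using w by simp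
  qed
  define p where "p = (\<lambda>k i. cnj w0 * f k 0 i + cnj w1 * f k 1 i)"
  define q where "q = (\<lambda>k i. (- w1) * f k 0 i + w0 * f k 1 i)"
  have fr: "(\<Sum>k\<in>K. (x * f k 0 i + y * f k 1 i) * cnj (x' * f k 0 j + y' * f k 1 j)) = (if i = j then x * cnj x' + y * cnj y' else 0)"
    if ij: "i < n" "j < n" for x y x' y' i j
  proof -
    have "(\<Sum>k\<in>K. (x * f k 0 i + y * f k 1 i) * cnj (x' * f k 0 j + y' * f k 1 j))
      = x * cnj x' * (\<Sum>k\<in>K. f k 0 i * cnj (f k 0 j)) + x * cnj y' * (\<Sum>k\<in>K. f k 0 i * cnj (f k 1 j))
      + y * cnj x' * (\<Sum>k\<in>K. f k 1 i * cnj (f k 0 j)) + y * cnj y' * (\<Sum>k\<in>K. f k 1 i * cnj (f k 1 j))"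
      unfolding sum_distrib_left sum.distrib[symmetric] by (intro sum.cong refl) (simp add: algebra_simps)
    then show ?thesis using frame[of 0 0 i j] frame[of 0 1 i j] frame[of 1 0 i j] frame[of 1 1 i j] ij by simp
  qed
  have pp: "(\<Sum>k\<in>K. p k i * cnj (p k j)) = (if i = j then 1 else 0)" if "i \<in> ?S" "j \<in> ?S" for i j
    using fr[of i j "cnj w0" "cnj w1" "cnj w0" "cnj w1"] that wc unfolding p_def by (simp add: mult.commute)
  have qq: "(\<Sum>k\<in>K. q k i * cnj (q k j)) = (if i = j then 1 else 0)" if "i \<in> ?S" "j \<in> ?S" for i j
    using fr[of i j "- w1" w0 "- w1" w0] that wc unfolding q_def by (simp add: add.commute)
  have pq: "(\<Sum>k\<in>K. p k i * cnj (q k j)) = 0" if "i \<in> ?S" "j \<in> ?S" for i j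
    using fr[of i j "cnj w0" "cnj w1" "- w1" w0] that unfolding p_def q_def by (simp add: mult.commute)
  have sp: "sqnorm ?S (p k) = (cmod w0)^2 * sqnorm ?S (f k 0) + (cmod w1)^2 * sqnorm ?S (f k 1) + 2 * Re (w0 * cnj w1 * gg k)"
    and sq: "sqnorm ?S (q k) = (cmod w1)^2 * sqnorm ?S (f k 0) + (cmod w0)^2 * sqnorm ?S (f k 1) - 2 * Re (w0 * cnj w1 * gg k)" for k
    unfolding p_def q_def sqnorm_add sqnorm_scale cdot_scale_left cdot_scale_right gg_def by (simp_all add: algebra_simps)
  have bal: "sqnorm ?S (p k) = 1/2 \<and> sqnorm ?S (q k) = 1/2"
    if u: "sqnorm ?S (f k 0) + sqnorm ?S (f k 1) = 1" and wk: "((cmod w0)^2 - (cmod w1)^2) * AA k + 4 * Re (w0 * cnj w1 * gg k) = 0" for k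
  proof -
    define s0 where "s0 = sqnorm ?S (f k 0)"
    define x0 where "x0 = (cmod w0)^2"
    define re where "re = Re (w0 * cnj w1 * gg k)"
    have s1: "sqnorm ?S (f k 1) = 1 - s0" using u by (simp add: s0_def)
    have x1: "(cmod w1)^2 = 1 - x0" using w by (simp add: x0_def)
    have eq: "(x0 - (1 - x0)) * (s0 - (1 - s0)) + 4 * re = 0"
      using wk unfolding AA_def s1 x1 x0_def[symmetric] s0_def[symmetric] re_def[symmetric] .
    show ?thesis unfolding sp sq s1 x1 x0_def[symmetric] s0_def[symmetric] re_def[symmetric] using eq by (simp add: algebra_simps)
  qed
  have opq: "cdot ?S (p k0) (p k1) + cdot ?S (q k0) (q k1) = 0"
  proof -
    have "cdot ?S (p k0) (p k1) + cdot ?S (q k0) (q k1)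
      = (w0 * cnj w0 + w1 * cnj w1) * (cdot ?S (f k0 0) (f k1 0) + cdot ?S (f k0 1) (f k1 1))"
      unfolding p_def q_def cdot_bilinear by (simp add: algebra_simps)
    then show ?thesis using orth by simp
  qed
  define R where "R = (\<lambda>(x :: 'k \<Rightarrow> nat \<Rightarrow> complex) (y :: 'k \<Rightarrow> nat \<Rightarrow> complex) i j. \<Sum>k\<in>K. of_real (lam k) * (x k i * cnj (y k j)))"
  have Rc: "cnj (R x y i j) = R y x j i" for x y i j unfolding R_def by (simp add: cnj_sum ac_simps)
  have lam0: "0 \<le> lam k" if "k \<in> K" for k using ev rest[of k] that by (cases "k = k0"; cases "k = k1") auto
  define MA where "MA = mat n n (\<lambda>(i, j). R p p i j)"
  define MB where "MB = mat n n (\<lambda>(i, j). R p q i j)"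
  define MC where "MC = mat n n (\<lambda>(i, j). R q q i j)"
  have quad: "(\<Sum>i<n. \<Sum>j<n. cnj (u i) * mat n n (\<lambda>(i, j). R x y i j) $$ (i, j) * v j) = (\<Sum>k\<in>K. of_real (lam k) * (cnj (cdot ?S (x k) u) * cdot ?S (y k) v))"
    for x y u v
    unfolding sesquilinear_frame_sum[where S = ?S and T = ?S, symmetric] R_def by (intro sum.cong refl) simp
  have diag: "Re (\<Sum>k\<in>K. of_real (lam k) * (cnj (cdot ?S (x k) u) * cdot ?S (x k) u)) = (\<Sum>k\<in>K. lam k * (cmod (cdot ?S (x k) u))^2)" for x u
    unfolding cnj_mult_self by (simp add: Re_sum del: of_real_power of_real_mult flip: of_real_mult)
  have "\<exists>xs :: ((nat \<Rightarrow> complex) \<times> (nat \<Rightarrow> complex)) list. \<forall>i<n. \<forall>j<n.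
       MA $$ (i, j) = (\<Sum>(\<xi>, \<zeta>)\<leftarrow>xs. (\<xi> 0 * \<zeta> i) * cnj (\<xi> 0 * \<zeta> j))
     \<and> MB $$ (i, j) = (\<Sum>(\<xi>, \<zeta>)\<leftarrow>xs. (\<xi> 0 * \<zeta> i) * cnj (\<xi> 1 * \<zeta> j))
     \<and> MC $$ (i, j) = (\<Sum>(\<xi>, \<zeta>)\<leftarrow>xs. (\<xi> 1 * \<zeta> i) * cnj (\<xi> 1 * \<zeta> j))"
  proof (rule block_product_decomposition[OF n])
    show "adj MA = MA" "adj MC = MC" unfolding MA_def MC_def by (auto intro!: eq_matI simp: adj_def Rc)
    show "0 \<le> Re (\<Sum>i<n. \<Sum>j<n. cnj (y i) * MA $$ (i, j) * y j)" "0 \<le> Re (\<Sum>i<n. \<Sum>j<n. cnj (y i) * MC $$ (i, j) * y j)" for y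
      unfolding MA_def MC_def quad diag using lam0 by (auto intro!: sum_nonneg)
    fix y z u v :: "nat \<Rightarrow> complex" and s t :: real
    assume *: "sqnorm ?S y = 1" "sqnorm ?S z = 1" "sqnorm ?S u = 1" "sqnorm ?S v = 1" "0 \<le> s" "0 \<le> t" "s^2 + t^2 = 1"
    show "2 * s * t * Re (\<Sum>i<n. \<Sum>j<n. cnj (u i) * MB $$ (i, j) * v j)
      \<le> s^2 * Re (\<Sum>i<n. \<Sum>j<n. cnj (y i) * MA $$ (i, j) * y j) + t^2 * Re (\<Sum>i<n. \<Sum>j<n. cnj (z i) * MC $$ (i, j) * z j)"
      unfolding MA_def MB_def MC_def quad diag
      by (rule block_witness_nonneg[OF K _ pp qq pq _ _ _ _ opq ev rest spec *(1,3,2,4) *(5-7)])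
        (use bal[OF unit(1) wk(1)] bal[OF unit(2) wk(2)] in auto)
  qed (auto simp: MA_def MB_def MC_def)
  then obtain xs :: "((nat \<Rightarrow> complex) \<times> (nat \<Rightarrow> complex)) list" where xs:
    "\<And>i j. i < n \<Longrightarrow> j < n \<Longrightarrow> R p p i j = (\<Sum>(\<xi>, \<zeta>)\<leftarrow>xs. (\<xi> 0 * \<zeta> i) * cnj (\<xi> 0 * \<zeta> j))"
    "\<And>i j. i < n \<Longrightarrow> j < n \<Longrightarrow> R p q i j = (\<Sum>(\<xi>, \<zeta>)\<leftarrow>xs. (\<xi> 0 * \<zeta> i) * cnj (\<xi> 1 * \<zeta> j))"
    "\<And>i j. i < n \<Longrightarrow> j < n \<Longrightarrow> R q q i j = (\<Sum>(\<xi>, \<zeta>)\<leftarrow>xs. (\<xi> 1 * \<zeta> i) * cnj (\<xi> 1 * \<zeta> j))"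
    unfolding MA_def MB_def MC_def by auto
  have cl: "cnj (sum_list l) = sum_list (map cnj l)" for l by (induction l) auto
  have xs10: "R q p i j = (\<Sum>(\<xi>, \<zeta>)\<leftarrow>xs. (\<xi> 1 * \<zeta> i) * cnj (\<xi> 0 * \<zeta> j))" if "i < n" "j < n" for i j
    unfolding Rc[of p q j i, symmetric] xs(2)[OF that(2,1)] cl map_map
    by (rule arg_cong[of _ _ sum_list], rule map_cong[OF refl]) (auto simp: ac_simps)
  define ma where "ma = (\<lambda>a::nat. if a = 0 then w0 else w1)"
  define mb where "mb = (\<lambda>a::nat. if a = 0 then - cnj w1 else cnj w0)"
  have inv: "f k a i = ma a * p k i + mb a * q k i" if "a < 2" for k a i
  proof -
    have "f k a i = (w0 * cnj w0 + w1 * cnj w1) * f k a i" using wc by simp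
    moreover have "a = 0 \<or> a = 1" using that by auto
    ultimately show ?thesis by (auto simp: ma_def mb_def p_def q_def algebra_simps)
  qed
  define T where "T = (\<lambda>(\<xi> :: nat \<Rightarrow> complex, \<zeta> :: nat \<Rightarrow> complex). (\<lambda>a. ma a * \<xi> 0 + mb a * \<xi> 1, \<zeta>))"
  show ?thesis
  proof (intro exI[of _ "map T xs"] allI impI)
    fix a b i j :: nat assume ab: "a < 2" "b < 2" and ij: "i < n" "j < n"
    have "(\<Sum>k\<in>K. of_real (lam k) * (f k a i * cnj (f k b j)))
      = ma a * cnj (ma b) * R p p i j + ma a * cnj (mb b) * R p q i j + mb a * cnj (ma b) * R q p i j + mb a * cnj (mb b) * R q q i j"
      unfolding R_def sum_distrib_left sum.distrib[symmetric] inv[OF ab(1)] inv[OF ab(2)]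
      by (intro sum.cong refl) (simp add: algebra_simps)
    also have "\<dots> = (\<Sum>(\<xi>, \<zeta>)\<leftarrow>map T xs. (\<xi> a * \<zeta> i) * cnj (\<xi> b * \<zeta> j))"
      unfolding xs(1)[OF ij] xs(2)[OF ij] xs(3)[OF ij] xs10[OF ij]
      by (induction xs) (auto simp: T_def algebra_simps)
    finally show "(\<Sum>k\<in>K. of_real (lam k) * (f k a i * cnj (f k b j))) = (\<Sum>(\<xi>, \<zeta>)\<leftarrow>map T xs. (\<xi> a * \<zeta> i) * cnj (\<xi> b * \<zeta> j))" .
  qed
qed

section \<open>Absolutely PPT states\<close>

text \<open>With index \<open>i * d + j\<close> for a basis vector |ij>, index 1 is |01> and index
  \<open>d\<close> is |10>. This is the computational basis with these two vectors replaced by their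
  normalised sum and difference.\<close>

definition bell_vec :: "nat \<Rightarrow> nat \<Rightarrow> nat \<Rightarrow> complex" where
  "bell_vec d l i = (if l = 1 then (if i = 1 \<or> i = d then of_real (sqrt (1/2)) else 0)
     else if l = d then (if i = 1 then of_real (sqrt (1/2)) else if i = d then - of_real (sqrt (1/2)) else 0)
     else if i = l then 1 else 0)"

lemma bell_vec_orthogonal:
  assumes d: "2 \<le> d" "d < N" and ij: "i < N" "j < N"
  shows "(\<Sum>l<N. bell_vec d l i * cnj (bell_vec d l j)) = (if i = j then 1 else 0)"
proof -
  have h: "complex_of_real (sqrt (1/2)) * of_real (sqrt (1/2)) = 1/2"
    by (simp only: of_real_mult[symmetric]) (simp add: real_sqrt_mult[symmetric])
  have split: "(\<Sum>l<N. F l) = F 1 + F d + (\<Sum>l\<in>{..<N} - {1, d}. F l)" for F :: "nat \<Rightarrow> complex"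
    using d sum.subset_diff[of "{1, d}" "{..<N}" F] by (auto simp: add.commute)
  have "(\<Sum>l\<in>{..<N} - {1, d}. bell_vec d l i * cnj (bell_vec d l j))
      = (\<Sum>l\<in>{..<N} - {1, d}. if l = i then (if i = j then 1 else 0) else 0)"
    by (intro sum.cong refl) (auto simp: bell_vec_def)
  also have "\<dots> = (if i \<in> {1, d} then 0 else if i = j then 1 else 0)"
    using ij by (auto simp: sum.delta)
  finally show ?thesis unfolding split using d by (auto simp: bell_vec_def h)
qed

lemma two_point_quadratic:
  fixes w :: "nat \<Rightarrow> complex"
  assumes pq: "p < N" "q < N" "p \<noteq> q" and w: "\<And>i. i \<noteq> p \<Longrightarrow> i \<noteq> q \<Longrightarrow> w i = 0"
  shows "(\<Sum>i<N. \<Sum>j<N. cnj (w i) * A $$ (i, j) * w j)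
    = cnj (w p) * A $$ (p, p) * w p + cnj (w p) * A $$ (p, q) * w q + (cnj (w q) * A $$ (q, p) * w p + cnj (w q) * A $$ (q, q) * w q)"
proof -
  have two: "(\<Sum>i<N. H i) = H p + H q" if "\<And>i. i \<noteq> p \<Longrightarrow> i \<noteq> q \<Longrightarrow> H i = 0" for H :: "nat \<Rightarrow> complex"
  proof -
    have "(\<Sum>i<N. H i) = (\<Sum>i\<in>{p, q}. H i)" using pq that by (intro sum.mono_neutral_right) auto
    then show ?thesis using pq(3) by simp
  qed
  have "(\<Sum>i<N. \<Sum>j<N. cnj (w i) * A $$ (i, j) * w j) = (\<Sum>i<N. cnj (w i) * A $$ (i, p) * w p + cnj (w i) * A $$ (i, q) * w q)"
    by (rule sum.cong[OF refl], rule two) (simp add: w)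
  then show ?thesis by (simp only:, intro two) (simp add: w)
qed

lemma psd_quadratic:
  assumes "psd N A"
  shows "Im (\<Sum>i<N. \<Sum>j<N. cnj (y i) * A $$ (i, j) * y j) = 0 \<and> 0 \<le> Re (\<Sum>i<N. \<Sum>j<N. cnj (y i) * A $$ (i, j) * y j)"
proof -
  have "(\<Sum>i<N. \<Sum>j<N. cnj (vec N y $ i) * A $$ (i, j) * vec N y $ j) = (\<Sum>i<N. \<Sum>j<N. cnj (y i) * A $$ (i, j) * y j)"
    by (intro sum.cong refl) simp
  then show ?thesis
    using bspec[OF conjunct2[OF assms[unfolded psd_def Let_def]], of "vec N y"] by (simp only: vec_carrier simp_thms)
qed

lemma absolutely_PPT_eigenvalue_bound:
  fixes lam :: "nat \<Rightarrow> real"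
  assumes d1: "2 \<le> d1" and d2: "2 \<le> d2" and F: "unitary_mat (d1 * d2) F"
    and ap: "absolutely_PPT d1 d2 (conj_diag (d1 * d2) F (\<lambda>k. of_real (lam k)))"
    and k: "k0 < d1 * d2" "k1 < d1 * d2" "k2 < d1 * d2" "kL < d1 * d2" "distinct [k0, k1, k2, kL]"
    and pos: "0 \<le> lam k0" "0 \<le> lam k2"
  shows "(lam kL - lam k1)^2 \<le> 4 * lam k0 * lam k2"
proof -
  define N where "N = d1 * d2"
  have "2 * d2 \<le> N" unfolding N_def using d1 by simp
  then have dN: "d2 + 1 < N" "d2 < N" "1 < N" "0 < N" using d2 by auto
  note f = unitary_matD[OF F, folded N_def]
  let ?A = "{..<N} - {k0, k1, k2, kL}" and ?B = "{..<N} - {0, 1, d2 + 1, d2}"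
  have "card ?A = N - 4" "card ?B = N - 4" using k dN d2 by (auto simp: card_Diff_subset N_def)
  \<comment> \<open>The remaining eigenvectors may go anywhere: the minor used at the end involves
    only the four prescribed positions.\<close>
  then obtain h where h: "bij_betw h ?A ?B" using finite_same_card_bij[of ?A ?B] by auto
  define \<pi> where "\<pi> = (\<lambda>k. if k = k0 then 0 else if k = k1 then 1 else if k = k2 then d2 + 1 else if k = kL then d2 else h k)"
  have \<pi>k: "\<pi> k0 = 0" "\<pi> k1 = 1" "\<pi> k2 = d2 + 1" "\<pi> kL = d2" using k(5) by (auto simp: \<pi>_def)
  have bij: "bij_betw \<pi> {..<N} {..<N}"
  proof -
    have b1: "bij_betw \<pi> ?A ?B" using h by (rule bij_betw_cong[THEN iffD1, rotated]) (auto simp: \<pi>_def)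
    have b2: "bij_betw \<pi> {k0, k1, k2, kL} {0, 1, d2 + 1, d2}"
      unfolding bij_betw_def using \<pi>k k(5) d2 by (auto simp: inj_on_def)
    have "bij_betw \<pi> (?A \<union> {k0, k1, k2, kL}) (?B \<union> {0, 1, d2 + 1, d2})" by (rule bij_betw_combine[OF b1 b2]) auto
    moreover have "?A \<union> {k0, k1, k2, kL} = {..<N}" "?B \<union> {0, 1, d2 + 1, d2} = {..<N}" using k dN by (auto simp: N_def)
    ultimately show ?thesis by simp
  qed
  define G where "G = mat N N (\<lambda>(i, k). bell_vec d2 (\<pi> k) i)"
  have Gc: "G \<in> carrier_mat N N" by (simp add: G_def)
  have re: "(\<Sum>k<N. H (\<pi> k)) = (\<Sum>l<N. H l)" for H :: "nat \<Rightarrow> complex" by (rule sum.reindex_bij_betw[OF bij])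
  have G: "unitary_mat N G"
  proof (rule unitary_matI[OF Gc], rule eq_matI)
    fix i j assume "i < dim_row (1\<^sub>m N :: complex mat)" "j < dim_col (1\<^sub>m N :: complex mat)"
    then have ij: "i < N" "j < N" by auto
    have "(G * adj G) $$ (i, j) = (\<Sum>k<N. bell_vec d2 (\<pi> k) i * cnj (bell_vec d2 (\<pi> k) j))"
      unfolding mult_adj_index[OF Gc Gc ij] using ij by (intro sum.cong refl) (simp add: G_def)
    also have "\<dots> = 1\<^sub>m N $$ (i, j)"
      unfolding re[of "\<lambda>l. bell_vec d2 l i * cnj (bell_vec d2 l j)"] bell_vec_orthogonal[OF d2 dN(2) ij] using ij by simp
    finally show "(G * adj G) $$ (i, j) = 1\<^sub>m N $$ (i, j)" .
  qed (use Gc in auto)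
  define \<rho> where "\<rho> = conj_diag N F (\<lambda>k. of_real (lam k))"
  define U where "U = G * adj F"
  have U: "unitary_mat N U" unfolding U_def using G F unfolding N_def by (intro unitary_mat_mult unitary_mat_adj) auto
  have "U * \<rho> * adj U = G * (adj F * F) * mat_diag N (\<lambda>k. of_real (lam k)) * (adj F * F) * adj G"
    unfolding U_def \<rho>_def conj_diag_def using f(1) Gc by (simp add: adj_mult[of _ N N _ N] square_mat[where n = N])
  then have UU: "U * \<rho> * adj U = conj_diag N G (\<lambda>k. of_real (lam k))"
    unfolding f(3) conj_diag_def using Gc by (simp add: square_mat[where n = N] left_mult_one_mat[of _ N N])
  define R where "R = conj_diag N G (\<lambda>k. of_real (lam k))"
  have Rij: "R $$ (i, j) = (\<Sum>k<N. of_real (lam k) * bell_vec d2 (\<pi> k) i * cnj (bell_vec d2 (\<pi> k) j))" if "i < N" "j < N" for i j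
    unfolding R_def conj_diag_index[OF Gc that] using that by (intro sum.cong refl) (simp add: G_def)
  have inv: "\<pi> k = \<pi> k' \<longleftrightarrow> k = k'" if "k < N" "k' < N" for k k'
    using bij that by (auto simp: bij_betw_def inj_on_def)
  have p0: "\<pi> k = 0 \<longleftrightarrow> k = k0" and p1: "\<pi> k = 1 \<longleftrightarrow> k = k1" and p2: "\<pi> k = d2 + 1 \<longleftrightarrow> k = k2" and pL: "\<pi> k = d2 \<longleftrightarrow> k = kL"
    if "k < N" for k
    using inv[OF that] k(1-4) \<pi>k unfolding N_def by metis+
  have h: "complex_of_real (sqrt (1/2)) * of_real (sqrt (1/2)) = 1/2"
    by (simp only: of_real_mult[symmetric]) (simp add: real_sqrt_mult[symmetric])
  have bv: "bell_vec d2 l 0 = (if l = 0 then 1 else 0)" "bell_vec d2 l (d2 + 1) = (if l = d2 + 1 then 1 else 0)"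
      "bell_vec d2 l 1 * cnj (bell_vec d2 l d2) = (if l = 1 then 1/2 else if l = d2 then - 1/2 else 0)"
      "bell_vec d2 l d2 * cnj (bell_vec d2 l 1) = (if l = 1 then 1/2 else if l = d2 then - 1/2 else 0)" for l
    using d2 by (auto simp: bell_vec_def h)
  have R00: "R $$ (0, 0) = of_real (lam k0)"
  proof -
    have "R $$ (0, 0) = (\<Sum>k<N. if k = k0 then of_real (lam k0) else 0)"
      unfolding Rij[OF dN(4) dN(4)] by (intro sum.cong refl) (auto simp: bv p0)
    then show ?thesis using k(1) by (simp add: N_def)
  qed
  have R22: "R $$ (d2 + 1, d2 + 1) = of_real (lam k2)"
  proof -
    have "R $$ (d2 + 1, d2 + 1) = (\<Sum>k<N. if k = k2 then of_real (lam k2) else 0)"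
      unfolding Rij[OF dN(1) dN(1)] by (intro sum.cong refl) (simp add: bv p2 del: One_nat_def add_Suc_right)
    then show ?thesis using k(3) by (simp add: N_def)
  qed
  have R12: "R $$ (i, j) = of_real ((lam k1 - lam kL) / 2)" if "(i, j) = (1, d2) \<or> (i, j) = (d2, 1)" for i j
  proof -
    have ij: "i < N" "j < N" using that dN by auto
    have "R $$ (i, j) = (\<Sum>k<N. (if k = k1 then of_real (lam k1) / 2 else 0) + (if k = kL then - of_real (lam kL) / 2 else 0))"
      unfolding Rij[OF ij] mult.assoc
    proof (intro sum.cong refl)
      fix l assume "l \<in> {..<N}"
      then have l: "l < N" by simp
      have "bell_vec d2 (\<pi> l) i * cnj (bell_vec d2 (\<pi> l) j) = (if l = k1 then 1/2 else if l = kL then - 1/2 else 0)"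
        using that by (auto simp only: bv p1[OF l] pL[OF l])
      then show "of_real (lam l) * (bell_vec d2 (\<pi> l) i * cnj (bell_vec d2 (\<pi> l) j))
        = (if l = k1 then of_real (lam k1) / 2 else 0) + (if l = kL then - of_real (lam kL) / 2 else 0)"
        using k(5) by auto
    qed
    then show ?thesis using k(2,4) by (simp add: N_def sum.distrib diff_divide_distrib)
  qed
  have "PPT d1 d2 R"
    using ap U UU unfolding absolutely_PPT_def R_def \<rho>_def N_def by auto
  then have psd: "psd N (partial_transpose d1 d2 R)" by (simp add: PPT_def N_def)
  define M where "M = partial_transpose d1 d2 R"
  have Mij: "M $$ (r, c) = R $$ ((r div d2) * d2 + c mod d2, (c div d2) * d2 + r mod d2)" if "r < N" "c < N" for r c
    unfolding M_def partial_transpose_def using that by (simp add: N_def)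
  have "Suc d2 div d2 = 1" "Suc d2 mod d2 = 1" using d2 by (auto simp: mod_Suc intro!: div_nat_eqI)
  then have dm: "(d2 + 1) div d2 = 1" "(d2 + 1) mod d2 = 1" "Suc d2 div d2 = 1" "Suc d2 mod d2 = 1" by simp_all
  \<comment> \<open>Partial transposition moves the coherence between |01> and |10>, which is
    \<open>(lam k1 - lam kL) / 2\<close>, to the entry between |00> and |11>, and leaves the two
    diagonal entries in place.\<close>
  have M4: "M $$ (0, 0) = of_real (lam k0)" "M $$ (d2 + 1, d2 + 1) = of_real (lam k2)"
      "M $$ (0, d2 + 1) = of_real ((lam k1 - lam kL) / 2)" "M $$ (d2 + 1, 0) = of_real ((lam k1 - lam kL) / 2)"
    using R00 R22 R12[of 1 d2] R12[of d2 1] dN dm by (simp_all add: Mij)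
  have "((lam k1 - lam kL) / 2)^2 \<le> lam k0 * lam k2"
  proof (rule discriminant_bound[OF pos])
    fix r :: real
    define w where "w = (\<lambda>i. if i = 0 then 1 else if i = d2 + 1 then complex_of_real r else 0)"
    have "(\<Sum>i<N. \<Sum>j<N. cnj (w i) * M $$ (i, j) * w j) = cnj (w 0) * M $$ (0, 0) * w 0 + cnj (w 0) * M $$ (0, d2 + 1) * w (d2 + 1)
       + (cnj (w (d2 + 1)) * M $$ (d2 + 1, 0) * w 0 + cnj (w (d2 + 1)) * M $$ (d2 + 1, d2 + 1) * w (d2 + 1))"
      by (rule two_point_quadratic[OF dN(4) dN(1)]) (auto simp: w_def)
    also have "\<dots> = of_real (lam k0 + 2 * r * ((lam k1 - lam kL) / 2) + r^2 * lam k2)"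
      unfolding M4 by (simp add: w_def power2_eq_square algebra_simps diff_divide_distrib)
    finally have "Re (\<Sum>i<N. \<Sum>j<N. cnj (w i) * M $$ (i, j) * w j) = lam k0 + 2 * r * ((lam k1 - lam kL) / 2) + r^2 * lam k2"
      by (simp only: Re_complex_of_real)
    then show "0 \<le> lam k0 + 2 * r * ((lam k1 - lam kL) / 2) + r^2 * lam k2"
      using psd_quadratic[OF psd[folded M_def], of w] by (simp only: simp_thms)
  qed
  moreover have "((lam k1 - lam kL) / 2)^2 = (lam kL - lam k1)^2 / 4" by (simp add: power2_eq_square field_simps)
  ultimately show ?thesis by simp
qed

lemma ex_min_on:
  fixes f :: "'a \<Rightarrow> real"
  assumes "finite S" "S \<noteq> {}"
  shows "\<exists>k\<in>S. \<forall>j\<in>S. f k \<le> f j"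
proof -
  have "Min (f ` S) \<in> f ` S" using assms by (intro Min_in) auto
  then obtain k where "k \<in> S" "f k = Min (f ` S)" by auto
  then show ?thesis using assms by (intro bexI[of _ k]) auto
qed

text \<open>The largest eigenvalue is sought outside the three lowest indices, so the four positions
  stay distinct even when eigenvalues coincide.\<close>

lemma ex_extreme_indices:
  fixes lam :: "nat \<Rightarrow> real"
  assumes "4 \<le> N"
  shows "\<exists>k0 k1 k2 kL. k0 < N \<and> k1 < N \<and> k2 < N \<and> kL < N \<and> distinct [k0, k1, k2, kL] \<and> lam k0 \<le> lam k1 \<and> lam k1 \<le> lam k2
     \<and> lam k2 \<le> lam kL \<and> (\<forall>k<N. k \<noteq> k0 \<longrightarrow> k \<noteq> k1 \<longrightarrow> lam k2 \<le> lam k \<and> lam k \<le> lam kL)"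
proof -
  let ?S = "{..<N}"
  have ne: "?S - X \<noteq> {}" if "finite X" "card X < 4" for X
    using card_mono[OF that(1), of ?S] that assms by (metis Diff_eq_empty_iff card_lessThan le_trans not_le)
  obtain k0 where k0: "k0 \<in> ?S" "\<forall>j\<in>?S. lam k0 \<le> lam j" using ex_min_on[of ?S lam] ne[of "{}"] by auto
  obtain k1 where k1: "k1 \<in> ?S - {k0}" "\<forall>j\<in>?S - {k0}. lam k1 \<le> lam j" using ex_min_on[of "?S - {k0}" lam] ne[of "{k0}"] by auto
  have "card {k0, k1} < 4" "card {k0, k1, k2} < 4" for k2 by (simp_all add: card_insert_if)
  then have n2: "?S - {k0, k1} \<noteq> {}" and n3: "?S - {k0, k1, k2} \<noteq> {}" for k2 by (intro ne; simp)+
  obtain k2 where k2: "k2 \<in> ?S - {k0, k1}" "\<forall>j\<in>?S - {k0, k1}. lam k2 \<le> lam j" using ex_min_on[OF _ n2, of lam] by auto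
  obtain kL where kL: "kL \<in> ?S - {k0, k1, k2}" "\<forall>j\<in>?S - {k0, k1, k2}. - lam kL \<le> - lam j"
    using ex_min_on[OF _ n3, of k2 "\<lambda>k. - lam k"] by auto
  have "lam k2 \<le> lam k \<and> lam k \<le> lam kL" if "k < N" "k \<noteq> k0" "k \<noteq> k1" for k
    using k2 kL that by (cases "k = k2") auto
  then show ?thesis using k0 k1 k2 kL
    by - (rule exI[of _ k0], rule exI[of _ k1], rule exI[of _ k2], rule exI[of _ kL], auto)
qed

section \<open>Schmidt rank of vectors with two proportional rows or columns\<close>

lemma rank_sum_product_le:
  fixes f g :: "nat \<Rightarrow> nat \<Rightarrow> complex"
  shows "vec_space.rank n (mat n n (\<lambda>(r, c). \<Sum>i<m. f i r * g i c)) \<le> m"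
proof (induction m)
  case 0
  have eq: "mat n n (\<lambda>(r, c). \<Sum>i<0. f i r * g i c) = 0\<^sub>m n n" by (rule eq_matI) auto
  show ?case unfolding eq vec_space.rank_0I by simp
next
  case (Suc m)
  let ?A = "mat n n (\<lambda>(r, c). \<Sum>i<m. f i r * g i c)" and ?B = "mat n n (\<lambda>(r, c). f m r * g m c)"
  have "mat n n (\<lambda>(r, c). \<Sum>i<Suc m. f i r * g i c) = ?A + ?B" by (rule eq_matI) auto
  moreover have "vec_space.rank n (?A + ?B) \<le> vec_space.rank n ?A + vec_space.rank n ?B"
    by (rule vec_space.rank_subadditive[of _ n n]) auto
  moreover have "vec_space.rank n ?B \<le> 1" by (rule vec_space.rank_le_1_product_entries[where nc = n and f = "f m" and g = "g m"]) auto
  ultimately show ?case using Suc by simp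
qed

lemma ptrace_A_proj:
  assumes "\<psi> \<in> carrier_vec (d1 * d2)"
  shows "ptrace_A d1 d2 (proj \<psi>) = mat d2 d2 (\<lambda>(r, c). \<Sum>i<d1. \<psi> $ (i * d2 + r) * cnj (\<psi> $ (i * d2 + c)))"
proof -
  have "i * d2 + j < d1 * d2" if "i < d1" "j < d2" for i j
  proof -
    have "i * d2 + j < Suc i * d2" using that by simp
    also have "\<dots> \<le> d1 * d2" using that by (intro mult_le_mono1) auto
    finally show ?thesis .
  qed
  then show ?thesis unfolding ptrace_A_def proj_def using assms
    by (intro cong_mat refl sum.cong) auto
qed

text \<open>The reduced matrix is a sum of one rank-one term for each row of the coefficient matrix,
  and two proportional rows contribute a single term between them.\<close>

lemma schmidt_rank_proportional_rows:
  assumes \<psi>: "\<psi> \<in> carrier_vec (d1 * d2)" and d1: "2 \<le> d1"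
    and rows: "\<And>j. j < d2 \<Longrightarrow> \<psi> $ j = x * z j" "\<And>j. j < d2 \<Longrightarrow> \<psi> $ (d2 + j) = y * z j"
  shows "schmidt_rank d1 d2 \<psi> \<le> d1 - 1"
proof -
  obtain m where m: "d1 = Suc (Suc m)" using d1 by (metis Suc_le_D numeral_2_eq_2 Suc_le_mono)
  \<comment> \<open>Term 0 is the merged pair of rows 0 and 1; every later term \<open>i\<close> is
    row \<open>Suc i\<close>.\<close>
  define f where "f = (\<lambda>i r. if i = 0 then of_real ((cmod x)^2 + (cmod y)^2) * z r else \<psi> $ (Suc i * d2 + r))"
  define g where "g = (\<lambda>i r. if i = 0 then cnj (z r) else cnj (\<psi> $ (Suc i * d2 + r)))"
  have "ptrace_A d1 d2 (proj \<psi>) = mat d2 d2 (\<lambda>(r, c). \<Sum>i<Suc m. f i r * g i c)"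
    unfolding ptrace_A_proj[OF \<psi>]
  proof (intro cong_mat refl)
    fix r c assume rc: "r < d2" "c < d2"
    have "(\<Sum>i<Suc (Suc m). \<psi> $ (i * d2 + r) * cnj (\<psi> $ (i * d2 + c)))
      = x * z r * cnj (x * z c) + y * z r * cnj (y * z c) + (\<Sum>i<m. \<psi> $ (Suc (Suc i) * d2 + r) * cnj (\<psi> $ (Suc (Suc i) * d2 + c)))"
      using rows rc by (simp add: sum.lessThan_Suc_shift del: sum.lessThan_Suc)
    also have "x * z r * cnj (x * z c) + y * z r * cnj (y * z c) = f 0 r * g 0 c"
    proof -
      have "f 0 r * g 0 c = (x * cnj x + y * cnj y) * z r * cnj (z c)"
        unfolding f_def g_def by (simp only: of_real_add complex_norm_square if_True simp_thms)
      then show ?thesis by (simp add: algebra_simps)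
    qed
    also have "f 0 r * g 0 c + (\<Sum>i<m. \<psi> $ (Suc (Suc i) * d2 + r) * cnj (\<psi> $ (Suc (Suc i) * d2 + c))) = (\<Sum>i<Suc m. f i r * g i c)"
      unfolding sum.lessThan_Suc_shift by (simp add: f_def g_def)
    finally show "(case (r, c) of (r, c) \<Rightarrow> \<Sum>i<d1. \<psi> $ (i * d2 + r) * cnj (\<psi> $ (i * d2 + c))) = (case (r, c) of (r, c) \<Rightarrow> \<Sum>i<Suc m. f i r * g i c)"
      unfolding m by simp
  qed
  then show ?thesis unfolding schmidt_rank_def m using rank_sum_product_le[where n = d2 and m = "Suc m" and f = f and g = g] by simp
qed

text \<open>The reduced matrix is indexed by columns, so here terms cannot be merged. Instead the
  linear relation between the first two columns yields a kernel vector, and the reduced matrix is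
  singular.\<close>

lemma schmidt_rank_proportional_columns:
  assumes \<psi>: "\<psi> \<in> carrier_vec (d1 * d2)" and d2: "2 \<le> d2"
    and cols: "\<And>i. i < d1 \<Longrightarrow> \<psi> $ (i * d2) = x * z i" "\<And>i. i < d1 \<Longrightarrow> \<psi> $ (i * d2 + 1) = y * z i"
  shows "schmidt_rank d1 d2 \<psi> \<le> d2 - 1"
proof -
  define M where "M = ptrace_A d1 d2 (proj \<psi>)"
  have M: "M \<in> carrier_mat d2 d2" by (simp add: M_def ptrace_A_def)
  \<comment> \<open>The kernel vector is \<open>(cnj y, - cnj x, 0, ...)\<close>. If
    \<open>x = y = 0\<close> both columns vanish and the first basis vector is taken, to keep it
    nonzero.\<close>
  define a where "a = (if x = 0 \<and> y = 0 then 1 else cnj y)"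
  define b where "b = - cnj x"
  define v where "v = vec d2 (\<lambda>j. if j = 0 then a else if j = 1 then b else 0)"
  have ab: "cnj x * a + cnj y * b = 0" by (auto simp: a_def b_def)
  have "v \<noteq> 0\<^sub>v d2"
  proof
    assume "v = 0\<^sub>v d2"
    then have "v $ 0 = 0" "v $ 1 = 0" using d2 by auto
    then have "a = 0" "b = 0" using d2 by (auto simp: v_def)
    then show False by (auto simp: a_def b_def split: if_splits)
  qed
  moreover have "M *\<^sub>v v = 0\<^sub>v d2"
  proof (rule eq_vecI)
    fix r assume "r < dim_vec (0\<^sub>v d2 :: complex vec)"
    then have r: "r < d2" by simp
    have "(M *\<^sub>v v) $ r = (\<Sum>c<d2. M $$ (r, c) * (if c = 0 then a else if c = 1 then b else 0))"
      using M r by (simp add: scalar_prod_def v_def atLeast0LessThan)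
    also have "\<dots> = (\<Sum>c\<in>{0, 1}. M $$ (r, c) * (if c = 0 then a else if c = 1 then b else 0))"
      using d2 by (intro sum.mono_neutral_right) auto
    also have "\<dots> = M $$ (r, 0) * a + M $$ (r, 1) * b" by simp
    also have "\<dots> = (\<Sum>i<d1. \<psi> $ (i * d2 + r) * (cnj (z i) * (cnj x * a + cnj y * b)))"
    proof -
      have "M $$ (r, 0) = (\<Sum>i<d1. \<psi> $ (i * d2 + r) * cnj (x * z i))" "M $$ (r, 1) = (\<Sum>i<d1. \<psi> $ (i * d2 + r) * cnj (y * z i))"
        unfolding M_def ptrace_A_proj[OF \<psi>] using r d2 cols by (auto intro!: sum.cong)
      then have "M $$ (r, 0) * a + M $$ (r, 1) * b
        = (\<Sum>i<d1. \<psi> $ (i * d2 + r) * cnj (x * z i) * a + \<psi> $ (i * d2 + r) * cnj (y * z i) * b)"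
        by (simp only: sum_distrib_right sum.distrib)
      then show ?thesis by (simp add: algebra_simps)
    qed
    finally show "(M *\<^sub>v v) $ r = 0\<^sub>v d2 $ r" unfolding ab using r by simp
  qed (use M in auto)
  ultimately have "det M = 0" using det_0_iff_vec_prod_zero_field[OF M] by (auto intro!: exI[of _ v] simp: v_def)
  then show ?thesis unfolding schmidt_rank_def M_def[symmetric] using vec_space.det_zero_low_rank[OF M] by simp
qed

section \<open>Padding the state and restricting its product decomposition\<close>

lemma psd_adj:
  assumes A: "psd N A"
  shows "adj A = A"
proof -
  have Ac: "A \<in> carrier_mat N N" using A by (simp add: psd_def)
  have quad2: "Im (cnj x * A $$ (p, p) * x + cnj x * A $$ (p, q) * y + (cnj y * A $$ (q, p) * x + cnj y * A $$ (q, q) * y)) = 0"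
    if "p < N" "q < N" "p \<noteq> q" for p q x y
  proof -
    define w where "w = (\<lambda>i. if i = p then x else if i = q then y else 0)"
    have w: "w p = x" "w q = y" "\<And>i. i \<noteq> p \<Longrightarrow> i \<noteq> q \<Longrightarrow> w i = 0" using that(3) by (auto simp: w_def)
    have "(\<Sum>i<N. \<Sum>j<N. cnj (w i) * A $$ (i, j) * w j)
        = cnj (w p) * A $$ (p, p) * w p + cnj (w p) * A $$ (p, q) * w q + (cnj (w q) * A $$ (q, p) * w p + cnj (w q) * A $$ (q, q) * w q)"
      by (rule two_point_quadratic[OF that]) (rule w(3))
    then show ?thesis
      using psd_quadratic[OF A, of w, THEN conjunct1] unfolding w(1,2) by (simp only:)
  qed
  have diag: "Im (A $$ (p, p)) = 0" if p: "p < N" for p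
  proof (cases "\<exists>q<N. q \<noteq> p")
    case True
    then obtain q where q: "q < N" "p \<noteq> q" by blast
    show ?thesis using quad2[OF p q, of 1 0] by simp
  next
    case False
    then have N: "{..<N} = {p}" using p unfolding set_eq_iff lessThan_iff singleton_iff by metis
    show ?thesis using psd_quadratic[OF A, of "\<lambda>_. 1"] unfolding N by simp
  qed
  have "cnj (A $$ (q, p)) = A $$ (p, q)" if pq: "p < N" "q < N" for p q
  proof (cases "p = q")
    case True then show ?thesis using diag[OF pq(1)] by (simp add: complex_eq_iff)
  next
    case False
    \<comment> \<open>Reality of the form at \<open>(1, 1)\<close> compares the imaginary parts of
      the two off-diagonal entries, and at \<open>(1, \<i>)\<close> their real parts.\<close>
    then show ?thesis using quad2[OF pq False, of 1 1] quad2[OF pq False, of 1 \<i>] diag[OF pq(1)] diag[OF pq(2)]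
      by (simp add: complex_eq_iff)
  qed
  then show ?thesis using Ac by (intro eq_matI) (auto simp: adj_def)
qed

text \<open>Padding must leave the spectral data alone. With the value \<open>c\<close> on the
  missing basis vectors, all eigenvalues except the two lowest still lie between \<open>c\<close>
  and \<open>L\<close>, so \<open>spec\<close> is inherited, whereas padding by 0 would in general
  destroy it. The added vectors vanish on the image of the index map, so restricting to the image
  recovers the original matrix.\<close>

lemma pulled_back_product_decomposition:
  fixes lam :: "nat \<Rightarrow> real" and \<alpha> l :: "nat \<Rightarrow> nat"
  assumes F: "unitary_mat N F" and inj: "inj_on (\<lambda>r. (\<alpha> r, l r)) {..<N}" and rng: "\<And>r. r < N \<Longrightarrow> \<alpha> r < 2 \<and> l r < N"
    and k: "k0 < N" "k1 < N" "k0 \<noteq> k1"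
    and ev: "0 \<le> lam k0" "lam k0 \<le> lam k1" "lam k1 \<le> c" "c \<le> L"
    and rest: "\<And>k. k < N \<Longrightarrow> k \<noteq> k0 \<Longrightarrow> k \<noteq> k1 \<Longrightarrow> c \<le> lam k \<and> lam k \<le> L"
    and spec: "(L - lam k1)^2 \<le> 4 * lam k0 * c"
  shows "\<exists>xs :: ((nat \<Rightarrow> complex) \<times> (nat \<Rightarrow> complex)) list. \<forall>r<N. \<forall>r'<N.
    conj_diag N F (\<lambda>k. of_real (lam k)) $$ (r, r') = (\<Sum>(\<xi>, \<zeta>)\<leftarrow>xs. (\<xi> (\<alpha> r) * \<zeta> (l r)) * cnj (\<xi> (\<alpha> r') * \<zeta> (l r')))"
proof -
  note Fc = unitary_matD(1)[OF F]
  define \<iota> where "\<iota> = (\<lambda>r. (\<alpha> r, l r))"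
  have inj': "inj_on \<iota> {..<N}" using inj by (simp add: \<iota>_def)
  define R where "R = \<iota> ` {..<N}"
  define C where "C = {..<2} \<times> {..<N} - R"
  define back_ix where "back_ix = the_inv_into {..<N} \<iota>"
  have bi: "back_ix (\<iota> r) = r" if "r < N" for r unfolding back_ix_def using the_inv_into_f_f[OF inj'] that by simp
  \<comment> \<open>\<open>Inl\<close> indexes the transported eigenvectors of the state,
    \<open>Inr\<close> the basis vectors outside the image \<open>R\<close>.\<close>
  define K :: "(nat + nat \<times> nat) set" where "K = Inl ` {..<N} \<union> Inr ` C"
  define f :: "nat + nat \<times> nat \<Rightarrow> nat \<Rightarrow> nat \<Rightarrow> complex" where
    "f = (\<lambda>k a i. case k of Inl k \<Rightarrow> if (a, i) \<in> R then F $$ (back_ix (a, i), k) else 0 | Inr x \<Rightarrow> if x = (a, i) then 1 else 0)"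
  define lam' where "lam' = (\<lambda>k :: nat + nat \<times> nat. case k of Inl k \<Rightarrow> lam k | Inr x \<Rightarrow> c)"
  have finC: "finite C" by (simp add: C_def)
  have Ksum: "(\<Sum>k\<in>K. H k) = (\<Sum>k<N. H (Inl k)) + (\<Sum>x\<in>C. H (Inr x))" for H :: "nat + nat \<times> nat \<Rightarrow> complex"
    unfolding K_def using finC by (subst sum.union_disjoint) (auto simp: sum.reindex)
  have RR: "R \<subseteq> {..<2} \<times> {..<N}" unfolding R_def \<iota>_def using rng by auto
  have gsum: "(\<Sum>i<N. G (0, i)) + (\<Sum>i<N. G (1, i)) = (\<Sum>r<N. G (\<iota> r))" if "\<And>x. x \<notin> R \<Longrightarrow> G x = 0" for G :: "nat \<times> nat \<Rightarrow> 'z :: comm_monoid_add"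
  proof -
    have "(\<Sum>i<N. G (0, i)) + (\<Sum>i<N. G (1, i)) = (\<Sum>a<2. \<Sum>i<N. G (a, i))" by (simp add: numeral_2_eq_2)
    also have "\<dots> = (\<Sum>x\<in>{..<2} \<times> {..<N}. G x)" by (simp add: sum.cartesian_product)
    also have "\<dots> = (\<Sum>x\<in>R. G x)" using RR that by (intro sum.mono_neutral_right) auto
    also have "\<dots> = (\<Sum>r<N. G (\<iota> r))" unfolding R_def by (simp add: sum.reindex[OF inj'])
    finally show ?thesis .
  qed
  have frame: "(\<Sum>k\<in>K. f k a i * cnj (f k b j)) = (if a = b \<and> i = j then 1 else 0)" if ab: "a < 2" "b < 2" and ij: "i < N" "j < N" for a b i j
  proof -
    have C0: "(\<Sum>x\<in>C. f (Inr x) a i * cnj (f (Inr x) b j)) = (if (a, i) = (b, j) \<and> (a, i) \<in> C then 1 else 0)"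
    proof -
      have "(\<Sum>x\<in>C. f (Inr x) a i * cnj (f (Inr x) b j)) = (\<Sum>x\<in>C. if x = (a, i) then (if (a, i) = (b, j) then 1 else 0) else 0)"
        by (intro sum.cong refl) (auto simp: f_def)
      then show ?thesis using finC by auto
    qed
    have R0: "(\<Sum>k<N. f (Inl k) a i * cnj (f (Inl k) b j)) = (if (a, i) = (b, j) \<and> (a, i) \<in> R then 1 else 0)"
    proof (cases "(a, i) \<in> R \<and> (b, j) \<in> R")
      case True
      then obtain r r' where r: "(a, i) = \<iota> r" "r < N" and r': "(b, j) = \<iota> r'" "r' < N" unfolding R_def by blast
      have "(\<Sum>k<N. f (Inl k) a i * cnj (f (Inl k) b j)) = (\<Sum>k<N. F $$ (r, k) * cnj (F $$ (r', k)))"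
        using True r r' bi by (intro sum.cong refl) (simp add: f_def)
      also have "\<dots> = (if r = r' then 1 else 0)" by (rule unitary_mat_rows[OF F r(2) r'(2)])
      finally show ?thesis using True r r' inj' by (auto simp: inj_on_def)
    next
      case False then show ?thesis by (auto simp: f_def)
    qed
    have "(a, i) \<in> R \<or> (a, i) \<in> C" "\<not> ((a, i) \<in> R \<and> (a, i) \<in> C)" using ab ij by (auto simp: C_def)
    then show ?thesis unfolding Ksum C0 R0 by auto
  qed
  have dot: "cdot {..<N} (f (Inl k) 0) (f (Inl k') 0) + cdot {..<N} (f (Inl k) 1) (f (Inl k') 1) = (if k = k' then 1 else 0)" if "k < N" "k' < N" for k k'
  proof -
    have "cdot {..<N} (f (Inl k) 0) (f (Inl k') 0) + cdot {..<N} (f (Inl k) 1) (f (Inl k') 1)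
      = (\<Sum>r<N. cnj (f (Inl k) (fst (\<iota> r)) (snd (\<iota> r))) * f (Inl k') (fst (\<iota> r)) (snd (\<iota> r)))"
      unfolding cdot_def using gsum[of "\<lambda>x. cnj (f (Inl k) (fst x) (snd x)) * f (Inl k') (fst x) (snd x)"] by (auto simp: f_def)
    also have "\<dots> = (\<Sum>r<N. cnj (F $$ (r, k)) * F $$ (r, k'))"
      using bi by (intro sum.cong refl) (auto simp: f_def R_def)
    finally show ?thesis using unitary_mat_cols[OF F that] by simp
  qed
  have unit: "sqnorm {..<N} (f (Inl k) 0) + sqnorm {..<N} (f (Inl k) 1) = 1" if "k < N" for k
  proof -
    have "complex_of_real (sqnorm {..<N} (f (Inl k) 0) + sqnorm {..<N} (f (Inl k) 1)) = of_real 1"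
      using dot[OF that that] unfolding cdot_self by simp
    then show ?thesis unfolding of_real_eq_iff .
  qed
  have "\<exists>xs :: ((nat \<Rightarrow> complex) \<times> (nat \<Rightarrow> complex)) list. \<forall>a<2. \<forall>b<2. \<forall>i<N. \<forall>j<N.
     (\<Sum>k\<in>K. of_real (lam' k) * (f k a i * cnj (f k b j))) = (\<Sum>(\<xi>, \<zeta>)\<leftarrow>xs. (\<xi> a * \<zeta> i) * cnj (\<xi> b * \<zeta> j))"
  proof (rule product_decomposition_from_spectrum[where ?k0.0 = "Inl k0" and ?k1.0 = "Inl k1" and ?a0.0 = "lam k0" and ?b0.0 = "lam k1" and ?c0.0 = c and L = L])
    show "cdot {..<N} (f (Inl k0) 0) (f (Inl k1) 0) + cdot {..<N} (f (Inl k0) 1) (f (Inl k1) 1) = 0"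
      using dot[OF k(1,2)] k(3) by simp
    show "c \<le> lam' k \<and> lam' k \<le> L" if "k \<in> K - {Inl k0, Inl k1}" for k
      using that rest ev unfolding K_def lam'_def by auto
  qed (use k ev spec unit frame finC in \<open>auto simp: K_def lam'_def\<close>)
  then obtain xs :: "((nat \<Rightarrow> complex) \<times> (nat \<Rightarrow> complex)) list" where xs:
    "\<And>a b i j. a < 2 \<Longrightarrow> b < 2 \<Longrightarrow> i < N \<Longrightarrow> j < N \<Longrightarrow>
     (\<Sum>k\<in>K. of_real (lam' k) * (f k a i * cnj (f k b j))) = (\<Sum>(\<xi>, \<zeta>)\<leftarrow>xs. (\<xi> a * \<zeta> i) * cnj (\<xi> b * \<zeta> j))" by blast
  show ?thesis
  proof (intro exI[of _ xs] allI impI)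
    fix r r' assume r: "r < N" "r' < N"
    have "conj_diag N F (\<lambda>k. of_real (lam k)) $$ (r, r') = (\<Sum>k<N. of_real (lam k) * (F $$ (r, k) * cnj (F $$ (r', k))))"
      unfolding conj_diag_index[OF Fc r] by (simp add: mult.assoc)
    also have "\<dots> = (\<Sum>k\<in>K. of_real (lam' k) * (f k (\<alpha> r) (l r) * cnj (f k (\<alpha> r') (l r'))))"
    proof -
      have m: "(\<alpha> q, l q) \<in> R" "(\<alpha> q, l q) \<notin> C" "back_ix (\<alpha> q, l q) = q" if "q < N" for q
        using that bi[of q] by (auto simp: R_def \<iota>_def C_def)
      have "(\<Sum>x\<in>C. of_real (lam' (Inr x)) * (f (Inr x) (\<alpha> r) (l r) * cnj (f (Inr x) (\<alpha> r') (l r')))) = 0"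
        using m[OF r(1)] by (intro sum.neutral) (auto simp: f_def)
      then show ?thesis unfolding Ksum using m[OF r(1)] m[OF r(2)] by (simp add: f_def lam'_def)
    qed
    also have "\<dots> = (\<Sum>(\<xi>, \<zeta>)\<leftarrow>xs. (\<xi> (\<alpha> r) * \<zeta> (l r)) * cnj (\<xi> (\<alpha> r') * \<zeta> (l r')))"
      using rng r by (intro xs) auto
    finally show "conj_diag N F (\<lambda>k. of_real (lam k)) $$ (r, r') = (\<Sum>(\<xi>, \<zeta>)\<leftarrow>xs. (\<xi> (\<alpha> r) * \<zeta> (l r)) * cnj (\<xi> (\<alpha> r') * \<zeta> (l r')))" .
  qed
qed

text \<open>The weights are the squared norms, which add up to the trace. Zero vectors are discarded
  since weights must be positive, and the factor \<open>s\<close> in the rank hypothesis permits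
  normalisation.\<close>

lemma has_decomp_from_vectors:
  fixes xs :: "(nat \<Rightarrow> complex) list"
  assumes \<rho>: "\<rho> \<in> carrier_mat (d1 * d2) (d1 * d2)"
    and dec: "\<And>r r'. r < d1 * d2 \<Longrightarrow> r' < d1 * d2 \<Longrightarrow> \<rho> $$ (r, r') = (\<Sum>x\<leftarrow>xs. x r * cnj (x r'))"
    and tr: "(\<Sum>r<d1 * d2. \<rho> $$ (r, r)) = 1"
    and rk: "\<And>x s. x \<in> set xs \<Longrightarrow> schmidt_rank d1 d2 (vec (d1 * d2) (\<lambda>r. s * x r)) \<le> k"
  shows "has_decomp_rank_le d1 d2 \<rho> k"
proof -
  define N where "N = d1 * d2"
  define ys where "ys = filter (\<lambda>x. sqnorm {..<N} x \<noteq> 0) xs"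
  define p where "p = (\<lambda>i. sqnorm {..<N} (ys ! i))"
  define \<psi> where "\<psi> = (\<lambda>i. vec N (\<lambda>r. of_real (1 / sqrt (p i)) * (ys ! i) r))"
  have ysx: "ys ! i \<in> set xs" and pp: "0 < p i" if "i < length ys" for i
  proof -
    have "ys ! i \<in> set ys" using that by simp
    then show "ys ! i \<in> set xs" "0 < p i" using sqnorm_nonneg[of "{..<N}" "ys ! i"] unfolding ys_def p_def by (auto simp: less_le)
  qed
  have ls: "(\<Sum>x\<leftarrow>ys. f x) = (\<Sum>i<length ys. f (ys ! i))" for f :: "(nat \<Rightarrow> complex) \<Rightarrow> complex"
    unfolding sum_list_sum_nth by (simp add: atLeast0LessThan)
  have dec': "\<rho> $$ (r, r') = (\<Sum>i<length ys. (ys ! i) r * cnj ((ys ! i) r'))" if "r < N" "r' < N" for r r'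
  proof -
    have "(\<Sum>x\<leftarrow>ys. x r * cnj (x r')) = (\<Sum>x\<leftarrow>xs. x r * cnj (x r'))"
      unfolding ys_def using that sqnorm_zeroD[of "{..<N}" _ r] by (intro sum_list_map_filter) auto
    then show ?thesis using dec[of r r'] that unfolding ls N_def by simp
  qed
  have unit: "(\<Sum>r<N. (cmod (\<psi> i $ r))^2) = 1" if i: "i < length ys" for i
  proof -
    have "(\<Sum>r<N. (cmod (\<psi> i $ r))^2) = sqnorm {..<N} (\<lambda>r. of_real (1 / sqrt (p i)) * (ys ! i) r)"
      unfolding sqnorm_def \<psi>_def by (intro sum.cong refl) simp
    then show ?thesis unfolding sqnorm_scale using pp[OF i] by (simp add: p_def norm_divide power_divide)
  qed
  have sum1: "(\<Sum>i<length ys. p i) = 1"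
  proof -
    have "complex_of_real (\<Sum>i<length ys. p i) = (\<Sum>i<length ys. \<Sum>r<N. (ys ! i) r * cnj ((ys ! i) r))"
      unfolding p_def of_real_sum cdot_self[symmetric] cdot_def by (simp add: mult.commute)
    also have "\<dots> = (\<Sum>r<N. \<rho> $$ (r, r))" by (subst sum.swap) (simp add: dec')
    finally have "complex_of_real (\<Sum>i<length ys. p i) = of_real 1" using tr by (simp add: N_def)
    then show ?thesis unfolding of_real_eq_iff .
  qed
  have "\<rho> = mat N N (\<lambda>rc. \<Sum>i<length ys. complex_of_real (p i) * proj (\<psi> i) $$ rc)"
  proof (rule eq_matI)
    fix r r' assume "r < dim_row (mat N N (\<lambda>rc. \<Sum>i<length ys. complex_of_real (p i) * proj (\<psi> i) $$ rc))"
      "r' < dim_col (mat N N (\<lambda>rc. \<Sum>i<length ys. complex_of_real (p i) * proj (\<psi> i) $$ rc))"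
    then have r: "r < N" "r' < N" by auto
    have "complex_of_real (p i) * proj (\<psi> i) $$ (r, r') = (ys ! i) r * cnj ((ys ! i) r')" if i: "i < length ys" for i
    proof -
      have "complex_of_real (sqrt (p i)) * of_real (sqrt (p i)) = of_real (p i)"
        unfolding of_real_mult[symmetric] using pp[OF i] by simp
      then show ?thesis using r pp[OF i] by (simp add: proj_def \<psi>_def field_simps)
    qed
    then show "\<rho> $$ (r, r') = mat N N (\<lambda>rc. \<Sum>i<length ys. complex_of_real (p i) * proj (\<psi> i) $$ rc) $$ (r, r')"
      using r dec'[OF r] by simp
  qed (use \<rho> in \<open>auto simp: N_def\<close>)
  moreover have "schmidt_rank d1 d2 (\<psi> i) \<le> k" if "i < length ys" for i
    unfolding \<psi>_def N_def by (rule rk[OF ysx[OF that]])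
  ultimately show ?thesis
    unfolding has_decomp_rank_le_def N_def[symmetric] using pp unit sum1
    by (intro exI[of _ "length ys"] exI[of _ p] exI[of _ \<psi>]) (auto simp: \<psi>_def)
qed

theorem theorem21:
  fixes d1 d2 :: nat and \<rho> :: "complex mat"
  assumes "d1 \<ge> 2" and "d2 \<ge> 2"
    and "is_state d1 d2 \<rho>"
    and "absolutely_PPT d1 d2 \<rho>"
  shows "schmidt_number d1 d2 \<rho> \<le> min d1 d2 - 1"
proof -
  define N where "N = d1 * d2"
  have N4: "4 \<le> N" unfolding N_def using mult_le_mono[OF assms(1,2)] by simp
  have psd: "psd N \<rho>" and tr: "(\<Sum>i<d1 * d2. \<rho> $$ (i, i)) = 1" using assms(3) by (auto simp: is_state_def N_def)
  have \<rho>c: "\<rho> \<in> carrier_mat N N" using psd by (simp add: psd_def)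
  obtain F lam kk where F: "unitary_mat N F" and \<rho>F: "\<rho> = conj_diag N F (\<lambda>k. of_real (lam k))"
    and kk: "kk < N" "\<forall>k<N. lam kk \<le> lam k"
    "(\<Sum>i<N. \<Sum>j<N. cnj (F $$ (i, kk)) * \<rho> $$ (i, j) * F $$ (j, kk)) = of_real (lam kk)"
    using hermitian_diagonalisation_min[OF \<rho>c psd_adj[OF psd]] N4 by auto
  have "0 \<le> lam kk" using psd_quadratic[OF psd, of "\<lambda>i. F $$ (i, kk)"] kk(3) by simp
  then have pos: "0 \<le> lam k" if "k < N" for k using kk(2) that by (meson order_trans)
  obtain k0 k1 k2 kL where k: "k0 < N" "k1 < N" "k2 < N" "kL < N" "distinct [k0, k1, k2, kL]"
    and ev: "lam k0 \<le> lam k1" "lam k1 \<le> lam k2" "lam k2 \<le> lam kL"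
    and rest: "\<forall>k<N. k \<noteq> k0 \<longrightarrow> k \<noteq> k1 \<longrightarrow> lam k2 \<le> lam k \<and> lam k \<le> lam kL"
    using ex_extreme_indices[OF N4, of lam] by blast
  have spec: "(lam kL - lam k1)^2 \<le> 4 * lam k0 * lam k2"
    by (rule absolutely_PPT_eigenvalue_bound[OF assms(1,2) F[unfolded N_def] _ k(1-4)[unfolded N_def] k(5) pos[OF k(1)] pos[OF k(3)]])
      (use assms(4) \<rho>F in \<open>simp add: N_def\<close>)
  \<comment> \<open>The cases \<open>d1 \<le> d2\<close> and \<open>d2 < d1\<close> differ only in
    the index map and in the rank bound for product vectors restricted along it.\<close>
  have main: "has_decomp_rank_le d1 d2 \<rho> m"
    if inj: "inj_on (\<lambda>r. (\<alpha> r, l r)) {..<N}" and rng: "\<And>r. r < N \<Longrightarrow> \<alpha> r < 2 \<and> l r < N"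
      and rk: "\<And>\<xi> \<zeta> s. schmidt_rank d1 d2 (vec N (\<lambda>r. s * (\<xi> (\<alpha> r) * \<zeta> (l r)))) \<le> m" for \<alpha> l :: "nat \<Rightarrow> nat" and m
  proof -
    obtain xs :: "((nat \<Rightarrow> complex) \<times> (nat \<Rightarrow> complex)) list" where xs: "\<forall>r<N. \<forall>r'<N.
      \<rho> $$ (r, r') = (\<Sum>(\<xi>, \<zeta>)\<leftarrow>xs. (\<xi> (\<alpha> r) * \<zeta> (l r)) * cnj (\<xi> (\<alpha> r') * \<zeta> (l r')))"
      using pulled_back_product_decomposition[OF F inj rng k(1,2) _ pos[OF k(1)] ev rest[rule_format] spec] k(5) \<rho>F by auto
    define vs where "vs = map (\<lambda>(\<xi>, \<zeta>) r. \<xi> (\<alpha> r) * \<zeta> (l r)) xs"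
    have vs: "(\<Sum>x\<leftarrow>vs. x r * cnj (x r')) = (\<Sum>(\<xi>, \<zeta>)\<leftarrow>xs. (\<xi> (\<alpha> r) * \<zeta> (l r)) * cnj (\<xi> (\<alpha> r') * \<zeta> (l r')))" for r r'
      unfolding vs_def map_map by (rule arg_cong[of _ _ sum_list], rule map_cong[OF refl]) auto
    show ?thesis
    proof (rule has_decomp_from_vectors[of \<rho> d1 d2 vs])
      show "schmidt_rank d1 d2 (vec (d1 * d2) (\<lambda>r. s * x r)) \<le> m" if "x \<in> set vs" for x s
        using that rk unfolding vs_def N_def by auto
    qed (use \<rho>c tr xs vs in \<open>auto simp: N_def\<close>)
  qed
  have "has_decomp_rank_le d1 d2 \<rho> (min d1 d2 - 1)"
  proof (cases "d1 \<le> d2")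
    case True
    \<comment> \<open>Row 1, the indices from \<open>d2\<close> to \<open>2 * d2 - 1\<close>, is put
      above row 0. All other indices keep their own value of \<open>l\<close> with
      \<open>\<alpha> = 0\<close>, so the map is injective.\<close>
    define \<alpha> where "\<alpha> = (\<lambda>r. if d2 \<le> r \<and> r < 2 * d2 then 1 else 0 :: nat)"
    define l where "l = (\<lambda>r. if d2 \<le> r \<and> r < 2 * d2 then r - d2 else r)"
    have le: "j < d1 * d2" "d2 + j < d1 * d2" if "j < d2" for j
      using mult_le_mono1[OF assms(1), of d2] that by linarith+
    have "has_decomp_rank_le d1 d2 \<rho> (d1 - 1)"
    proof (rule main[of \<alpha> l])
      show "inj_on (\<lambda>r. (\<alpha> r, l r)) {..<N}" by (auto simp: inj_on_def \<alpha>_def l_def split: if_splits)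
      show "\<alpha> r < 2 \<and> l r < N" if "r < N" for r using that by (auto simp: \<alpha>_def l_def)
      show "schmidt_rank d1 d2 (vec N (\<lambda>r. s * (\<xi> (\<alpha> r) * \<zeta> (l r)))) \<le> d1 - 1" for \<xi> \<zeta> :: "nat \<Rightarrow> complex" and s
        by (rule schmidt_rank_proportional_rows[OF _ assms(1), where x = "s * \<xi> 0" and y = "s * \<xi> 1" and z = \<zeta>])
          (use le in \<open>auto simp: \<alpha>_def l_def N_def\<close>)
    qed
    then show ?thesis using True by (simp add: min_def)
  next
    case False
    \<comment> \<open>The same for columns: \<open>r mod d2 = 1\<close> singles out column 1, and
      \<open>r - 1\<close> is its neighbour in column 0.\<close>
    define \<alpha> where "\<alpha> = (\<lambda>r. if r mod d2 = 1 then 1 else 0 :: nat)"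
    define l where "l = (\<lambda>r. if r mod d2 = 1 then r - 1 else r)"
    have "has_decomp_rank_le d1 d2 \<rho> (d2 - 1)"
    proof (rule main[of \<alpha> l])
      show "inj_on (\<lambda>r. (\<alpha> r, l r)) {..<N}"
      proof (rule inj_onI)
        fix r r' assume "(\<alpha> r, l r) = (\<alpha> r', l r')"
        then have eq: "\<alpha> r = \<alpha> r'" "l r = l r'" by blast+
        have "r mod d2 = 1 \<longleftrightarrow> r' mod d2 = 1" using eq(1) unfolding \<alpha>_def by presburger
        moreover have "r \<noteq> 0" if "r mod d2 = 1" for r using that by (intro notI) simp
        ultimately show "r = r'" using eq(2) unfolding l_def by (metis Suc_pred' gr0I One_nat_def)
      qed
      show "\<alpha> r < 2 \<and> l r < N" if "r < N" for r using that by (auto simp: \<alpha>_def l_def)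
      have ix: "i * d2 + j < N" if "i < d1" "j < d2" for i j
      proof -
        have "i * d2 + j < Suc i * d2" using that by simp
        also have "\<dots> \<le> N" unfolding N_def using that by (intro mult_le_mono1) auto
        finally show ?thesis .
      qed
      have md: "Suc (i * d2) mod d2 = Suc 0" for i using mod_mult_self1[of 1 i d2] assms(2) by simp
      show "schmidt_rank d1 d2 (vec N (\<lambda>r. s * (\<xi> (\<alpha> r) * \<zeta> (l r)))) \<le> d2 - 1" for \<xi> \<zeta> :: "nat \<Rightarrow> complex" and s
        by (rule schmidt_rank_proportional_columns[OF _ assms(2), where x = "s * \<xi> 0" and y = "s * \<xi> 1" and z = "\<lambda>i. \<zeta> (i * d2)"])
          (use ix[of _ 0] ix[of _ 1] md assms(2) in \<open>auto simp: \<alpha>_def l_def N_def[symmetric]\<close>)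
    qed
    then show ?thesis using False by (simp add: min_def)
  qed
  then show ?thesis unfolding schmidt_number_def by (rule Least_le)
qed

end
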